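(* Suppose the input consists of an overdetermined sparse rational polynomial system $F=(f_1,\dots,f_m)\in\mathbb Q[x_1,\dots,x_n]^m$, $m>n$ (encoded sparsely by rational coefficients and binary integer exponents), together with a list of rational points promised to be exactly the solution set $S=V_{\mathbb C}(F)$, each of them nondegenerate. Then the problem of deciding the existence of a strongly valid selection (Listed Strong Selection) is in NP, for arbitrary such systems. That is, there is a polynomial-time verifier, with certificates of polynomially bounded length, such that for every input satisfying the promise there is an accepted certificate if and only if a strongly valid selection exists.
   Context: $S=V_{\mathbb C}(F)\subseteq\mathbb C^n$ is assumed finite and nonempty. A selection is an index set $A\subseteq\{1,\dots,m\}$ with $|A|=n$, determining $F_A=(f_i)_{i\in A}$. It is strongly valid if $\det DF_A(p)\neq0$ for every $p\in S$. A solution $p\in S$ is nondegenerate if $\operatorname{rank}DF(p)=n$. Exponents are written in binary, so degrees may be exponential in the input length; no bound on degrees and no bound on the number of listed solutions (beyond their being part of the input) is assumed. For a promise problem, membership in NP is understood for inputs satisfying the promise. *)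

theory Defs
  imports
    Jordan_Normal_Form.DL_Rank
    Jordan_Normal_Form.Determinant
    "HOL-Computational_Algebra.Polynomial"
    Complex_Main
begin

section \<open>Turing machines and polynomial-time verifiers\<close>

datatype move = Leftward | Stay | Rightward

text \<open>A tape is two-way infinite and is given by its contents and the position of the head.\<close>

type_synonym tape = "(int \<Rightarrow> nat) \<times> int"

text \<open>A configuration consists of the control state and the list of tapes.\<close>

type_synonym config = "nat \<times> tape list"

text \<open>
  A deterministic multi-tape Turing machine: the control states are the numbers below
  \<open>num_states\<close>, the tape symbols are the numbers below \<open>num_symbols\<close>. The transition function maps
  the current state and the scanned symbols to the next state and, for each tape, the symbol to
  be written and the move of the head. Its values outside these finite ranges are irrelevant.
\<close>

record tm =
  num_tapes :: nat
  num_symbols :: nat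
  num_states :: nat
  start_state :: nat
  accept_state :: nat
  reject_state :: nat
  transition :: "nat \<Rightarrow> nat list \<Rightarrow> nat \<times> (nat \<times> move) list"

text \<open>
  Symbol 0 is the blank, symbols 1 and 2 represent the bits. Tape 0 initially holds the input and
  tape 1 the certificate, so there are at least two tapes and three symbols.
\<close>

definition turing_machine :: "tm \<Rightarrow> bool" where
  "turing_machine M \<longleftrightarrow>
     num_tapes M \<ge> 2 \<and> num_symbols M \<ge> 3 \<and>
     start_state M < num_states M \<and> accept_state M < num_states M \<and>
     reject_state M < num_states M \<and> accept_state M \<noteq> reject_state M \<and>
     (\<forall>q ss. q < num_states M \<and> length ss = num_tapes M \<and> (\<forall>s \<in> set ss. s < num_symbols M) \<longrightarrow>
        (case transition M q ss of (q', acts) \<Rightarrow>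
           q' < num_states M \<and> length acts = num_tapes M \<and>
           (\<forall>(s, d) \<in> set acts. s < num_symbols M)))"

fun scanned :: "tape \<Rightarrow> nat" where
  "scanned (t, h) = t h"

fun offset :: "move \<Rightarrow> int" where
  "offset Leftward = -1"
| "offset Stay = 0"
| "offset Rightward = 1"

fun act :: "nat \<times> move \<Rightarrow> tape \<Rightarrow> tape" where
  "act (s, d) (t, h) = (t(h := s), h + offset d)"

definition halted :: "tm \<Rightarrow> config \<Rightarrow> bool" where
  "halted M c \<longleftrightarrow> fst c = accept_state M \<or> fst c = reject_state M"

definition step :: "tm \<Rightarrow> config \<Rightarrow> config" where
  "step M c =
     (if halted M c then c
      else let (q', acts) = transition M (fst c) (map scanned (snd c))
           in (q', map2 act acts (snd c)))"

fun bit_symbol :: "bool \<Rightarrow> nat" where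
  "bit_symbol False = 1"
| "bit_symbol True = 2"

definition word_tape :: "bool list \<Rightarrow> tape" where
  "word_tape w =
     ((\<lambda>i. if 0 \<le> i \<and> nat i < length w then bit_symbol (w ! nat i) else 0), 0)"

definition initial_config :: "tm \<Rightarrow> bool list \<Rightarrow> bool list \<Rightarrow> config" where
  "initial_config M x u =
     (start_state M, word_tape x # word_tape u # replicate (num_tapes M - 2) (word_tape []))"

definition config_after :: "tm \<Rightarrow> bool list \<Rightarrow> bool list \<Rightarrow> nat \<Rightarrow> config" where
  "config_after M x u t = (step M ^^ t) (initial_config M x u)"

definition accepts :: "tm \<Rightarrow> bool list \<Rightarrow> bool list \<Rightarrow> bool" where
  "accepts M x u \<longleftrightarrow> (\<exists>t. fst (config_after M x u t) = accept_state M)"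

text \<open>
  The time bound is required for all pairs of words, not only for encodings of instances that
  satisfy a promise.
\<close>

definition polytime_verifier :: "tm \<Rightarrow> bool" where
  "polytime_verifier M \<longleftrightarrow>
     turing_machine M \<and>
     (\<exists>p :: nat poly. \<forall>x u. halted M (config_after M x u (poly p (length x + length u))))"

text \<open>
  Membership in NP of the promise problem with instances encoded by \<open>enc\<close>, promise \<open>P\<close> and
  yes-instances \<open>Y\<close>.
\<close>

definition promise_NP :: "('i \<Rightarrow> bool list) \<Rightarrow> ('i \<Rightarrow> bool) \<Rightarrow> ('i \<Rightarrow> bool) \<Rightarrow> bool" where
  "promise_NP enc P Y \<longleftrightarrow>
     (\<exists>M. polytime_verifier M \<and>
       (\<exists>q :: nat poly. \<forall>I. P I \<longrightarrow>
          ((\<exists>u. length u \<le> poly q (length (enc I)) \<and> accepts M (enc I) u) \<longleftrightarrow> Y I)))"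

section \<open>Sparse polynomial systems\<close>

text \<open>
  A term is a coefficient together with its exponent vector; a list of terms denotes their sum.
  Variables and polynomials are indexed from 0.
\<close>

type_synonym sparse_poly = "(rat \<times> nat list) list"

definition eval_sparse :: "sparse_poly \<Rightarrow> complex list \<Rightarrow> complex" where
  "eval_sparse f z = (\<Sum>(c, e) \<leftarrow> f. of_rat c * (\<Prod>j < length e. z ! j ^ (e ! j)))"

text \<open>
  The formal partial derivative with respect to variable \<open>j\<close>. For a term with exponent 0 in
  variable \<open>j\<close>, the resulting coefficient is 0, so the truncated subtraction does no harm.
\<close>

definition partial_deriv :: "nat \<Rightarrow> sparse_poly \<Rightarrow> sparse_poly" where
  "partial_deriv j f = map (\<lambda>(c, e). (c * of_nat (e ! j), e[j := e ! j - 1])) f"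

definition jacobian :: "nat \<Rightarrow> sparse_poly list \<Rightarrow> complex list \<Rightarrow> complex mat" where
  "jacobian n F z =
     mat (length F) n (\<lambda>(i, j). eval_sparse (partial_deriv j (F ! i)) z)"

definition zero_set :: "nat \<Rightarrow> sparse_poly list \<Rightarrow> complex list set" where
  "zero_set n F = {z. length z = n \<and> (\<forall>f \<in> set F. eval_sparse f z = 0)}"

definition nondegenerate :: "nat \<Rightarrow> sparse_poly list \<Rightarrow> complex list \<Rightarrow> bool" where
  "nondegenerate n F z \<longleftrightarrow> vec_space.rank (length F) (jacobian n F z) = n"

definition selection :: "nat \<Rightarrow> sparse_poly list \<Rightarrow> nat set \<Rightarrow> bool" where
  "selection n F A \<longleftrightarrow> A \<subseteq> {..<length F} \<and> card A = n"

text \<open>The subsystem \<open>F\<^sub>A\<close> is \<open>nths F A\<close>.\<close>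

definition strongly_valid :: "nat \<Rightarrow> sparse_poly list \<Rightarrow> nat set \<Rightarrow> bool" where
  "strongly_valid n F A \<longleftrightarrow> (\<forall>z \<in> zero_set n F. det (jacobian n (nths F A) z) \<noteq> 0)"

section \<open>The problem Listed Strong Selection\<close>

record lss_instance =
  num_vars :: nat
  system :: "sparse_poly list"
  points :: "rat list list"

definition lss_promise :: "lss_instance \<Rightarrow> bool" where
  "lss_promise I \<longleftrightarrow>
     (\<forall>f \<in> set (system I). \<forall>(c, e) \<in> set f. length e = num_vars I) \<and>
     length (system I) > num_vars I \<and>
     zero_set (num_vars I) (system I) = map of_rat ` set (points I) \<and>
     zero_set (num_vars I) (system I) \<noteq> {} \<and>
     (\<forall>z \<in> zero_set (num_vars I) (system I). nondegenerate (num_vars I) (system I) z)"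

definition lss_yes :: "lss_instance \<Rightarrow> bool" where
  "lss_yes I \<longleftrightarrow>
     (\<exists>A. selection (num_vars I) (system I) A \<and> strongly_valid (num_vars I) (system I) A)"

text \<open>
  The encoding by bit strings. Every list element is preceded by the bit 1 and the end of a list is
  marked by the bit 0, which makes all encodings prefix-free. Natural numbers are written in binary,
  least significant bit first; a rational number is written as numerator and denominator in lowest
  terms.
\<close>

fun bits :: "nat \<Rightarrow> bool list" where
  "bits n = (if n = 0 then [] else odd n # bits (n div 2))"

declare bits.simps [simp del]

definition enc_list :: "('a \<Rightarrow> bool list) \<Rightarrow> 'a list \<Rightarrow> bool list" where
  "enc_list enc xs = concat (map (\<lambda>x. True # enc x) xs) @ [False]"

definition enc_nat :: "nat \<Rightarrow> bool list" where
  "enc_nat n = enc_list (\<lambda>b. [b]) (bits n)"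

definition enc_int :: "int \<Rightarrow> bool list" where
  "enc_int k = (k < 0) # enc_nat (nat \<bar>k\<bar>)"

definition enc_rat :: "rat \<Rightarrow> bool list" where
  "enc_rat r = (case quotient_of r of (a, b) \<Rightarrow> enc_int a @ enc_int b)"

definition enc_sparse_poly :: "sparse_poly \<Rightarrow> bool list" where
  "enc_sparse_poly = enc_list (\<lambda>(c, e). enc_rat c @ enc_list enc_nat e)"

definition enc_lss :: "lss_instance \<Rightarrow> bool list" where
  "enc_lss I =
     enc_nat (num_vars I) @ enc_list enc_sparse_poly (system I) @
     enc_list (enc_list enc_rat) (points I)"

end

theory Submission
  imports Defs "HOL-Number_Theory.Number_Theory"
begin

text \<open>
  The certificate consists of a selection, a number \<open>N\<close>, and for each listed point \<open>p\<close> a list of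
  vectors. All computations are done modulo \<open>N + 2\<close>, where a rational number has a residue if its
  denominator is a unit. The vectors have to be such that the derivatives at \<open>p\<close> of the selected
  polynomials along them form a triangular matrix with unit diagonal. Then the determinant of the
  Jacobian matrix is a unit modulo \<open>N + 2\<close>, in particular it is not zero. Powers with huge exponents
  are computed by repeated squaring.

  Conversely, the nonzero determinants are rational numbers with at most exponentially many bits.
  All numbers up to \<open>K\<close> have a least common multiple of at least \<open>2 ^ (K div 2)\<close>, roughly, so some
  prime with polynomially many bits divides neither the numerators of the determinants nor the
  denominators of the data. The columns of the inverse matrix modulo this prime are a certificate.

  The Turing machine is compiled from a nondeterministic program that operates on stacks of bits.
  A tape with one bit for each step resolves the nondeterminism and at the same time limits the
  running time; so it remains to show that accepting runs are sound and that short accepting runs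
  exist. The relations computed by short runs are closed under composition, pairing, guessing,
  union and iteration, which yields arithmetic and list functions on encoded data.
\<close>

section \<open>Nondeterministic stack programs\<close>

text \<open>With exponents in binary, the value of a monomial at a listed point may have
  exponentially many bits, so neither the Jacobian matrix nor its determinant can be written down
  exactly. Hence the passage to residues. Primality of the modulus is never verified: soundness
  holds for every modulus M >= 2 for which the denominators are units, because a vanishing rational
  determinant has residue 0, and no multiple of 0 is 1 modulo M. Primality matters only for the
  existence of a certificate, where it makes the relevant numbers invertible. The second obstacle is
  the concrete machine model. Computability is only ever shown nondeterministically: a function
  counts as computable if all finished runs return its value and a short one exists. So sums and
  remainders can be guessed and checked against their defining equations instead of being computed
  by an algorithm; these auxiliary guesses simply join the certificate.\<close>

datatype com =
    Skip
  | Push nat bool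
  | Pop nat bool
  | Empty nat
  | Seq com com (infixr ";;" 60)
  | Choice com com
  | Star com

type_synonym store = "nat \<Rightarrow> bool list"

text \<open>A failed test has no run: \<open>Pop r b\<close> needs \<open>b\<close> on top and
  \<open>Empty r\<close> an empty stack. Branches and loops are therefore free choices, of which the
  wrong ones get stuck. Every rule costs exactly one unit besides its parts, so that the time is the
  number of small steps.\<close>

inductive run :: "com \<Rightarrow> store \<Rightarrow> nat \<Rightarrow> store \<Rightarrow> bool" where
  run_Skip: "run Skip s 1 s"
| run_Push: "run (Push r b) s 1 (s(r := b # s r))"
| run_Pop: "s r = b # w \<Longrightarrow> run (Pop r b) s 1 (s(r := w))"
| run_Empty: "s r = [] \<Longrightarrow> run (Empty r) s 1 s"
| run_Seq: "run c s t s' \<Longrightarrow> run d s' t' s'' \<Longrightarrow> run (c ;; d) s (Suc (t + t')) s''"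
| run_ChoiceL: "run c s t s' \<Longrightarrow> run (Choice c d) s (Suc t) s'"
| run_ChoiceR: "run d s t s' \<Longrightarrow> run (Choice c d) s (Suc t) s'"
| run_Star_stop: "run (Star c) s 1 s"
| run_Star_step: "run c s t s' \<Longrightarrow> run (Star c) s' t' s'' \<Longrightarrow> run (Star c) s (Suc (t + t')) s''"

inductive_cases run_SkipE[elim!]: "run Skip s t s'"
inductive_cases run_PushE[elim!]: "run (Push r b) s t s'"
inductive_cases run_PopE[elim!]: "run (Pop r b) s t s'"
inductive_cases run_EmptyE[elim!]: "run (Empty r) s t s'"
inductive_cases run_SeqE[elim!]: "run (c ;; d) s t s'"
inductive_cases run_ChoiceE[elim!]: "run (Choice c d) s t s'"
inductive_cases run_StarE: "run (Star c) s t s'"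

fun num_regs :: "com \<Rightarrow> nat" where
  "num_regs Skip = 0"
| "num_regs (Push r b) = Suc r"
| "num_regs (Pop r b) = Suc r"
| "num_regs (Empty r) = Suc r"
| "num_regs (c ;; d) = max (num_regs c) (num_regs d)"
| "num_regs (Choice c d) = max (num_regs c) (num_regs d)"
| "num_regs (Star c) = num_regs c"

text \<open>Small steps on the list of commands still to be executed. Each step is charged one bit,
  although only \<open>Choice\<close> and \<open>Star\<close> look at it; the number of bits is then
  the running time.\<close>

fun micro :: "bool \<Rightarrow> com list \<Rightarrow> store \<Rightarrow> (com list \<times> store) option" where
  "micro b [] s = None"
| "micro b (Skip # k) s = Some (k, s)"
| "micro b (Push r x # k) s = Some (k, s(r := x # s r))"
| "micro b (Pop r x # k) s = (if s r \<noteq> [] \<and> hd (s r) = x then Some (k, s(r := tl (s r))) else None)"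
| "micro b (Empty r # k) s = (if s r = [] then Some (k, s) else None)"
| "micro b ((c ;; d) # k) s = Some (c # d # k, s)"
| "micro b (Choice c d # k) s = Some ((if b then c else d) # k, s)"
| "micro b (Star c # k) s = Some (if b then c # Star c # k else k, s)"

fun mrun :: "bool list \<Rightarrow> com list \<Rightarrow> store \<Rightarrow> com list \<Rightarrow> store \<Rightarrow> bool" where
  "mrun [] k s k' s' \<longleftrightarrow> k = k' \<and> s = s'"
| "mrun (b # u) k s k' s' \<longleftrightarrow> (\<exists>k1 s1. micro b k s = Some (k1, s1) \<and> mrun u k1 s1 k' s')"

lemma mrun_append: "mrun u k s k1 s1 \<Longrightarrow> mrun v k1 s1 k' s' \<Longrightarrow> mrun (u @ v) k s k' s'"
  by (induction u arbitrary: k s) auto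

lemma run_imp_mrun: "run c s t s' \<Longrightarrow> \<exists>u. length u = t \<and> (\<forall>k. mrun u (c # k) s k s')"
proof (induction rule: run.induct)
  case (run_Skip s) show ?case by (rule exI[of _ "[True]"]) auto
next
  case (run_Push r b s) show ?case by (rule exI[of _ "[True]"]) auto
next
  case (run_Pop s r b w) then show ?case by (intro exI[of _ "[True]"]) auto
next
  case (run_Empty s r) then show ?case by (intro exI[of _ "[True]"]) auto
next
  case (run_Seq c s t s' d t' s'')
  then obtain u v where "length u = t" "\<forall>k. mrun u (c # k) s k s'"
    "length v = t'" "\<forall>k. mrun v (d # k) s' k s''" by auto
  then show ?case by (intro exI[of _ "True # u @ v"]) (auto intro: mrun_append)
next
  case (run_ChoiceL c s t s' d)
  then obtain u where "length u = t" "\<forall>k. mrun u (c # k) s k s'" by auto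
  then show ?case by (intro exI[of _ "True # u"]) auto
next
  case (run_ChoiceR d s t s' c)
  then obtain u where "length u = t" "\<forall>k. mrun u (d # k) s k s'" by auto
  then show ?case by (intro exI[of _ "False # u"]) auto
next
  case (run_Star_stop c s) show ?case by (rule exI[of _ "[False]"]) auto
next
  case (run_Star_step c s t s' t' s'')
  then obtain u v where "length u = t" "\<forall>k. mrun u (c # k) s k s'"
    "length v = t'" "\<forall>k. mrun v (Star c # k) s' k s''" by auto
  then show ?case by (intro exI[of _ "True # u @ v"]) (auto intro: mrun_append)
qed

text \<open>A loop puts itself back on the list, so the induction is not on the command but on the
  number of remaining bits. The part \<open>v\<close> left for the rest \<open>k\<close> is claimed
  to be shorter so that the hypothesis can be applied to it once more.\<close>

lemma mrun_imp_run:
  "mrun u (c # k) s [] s'' \<Longrightarrow>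
    \<exists>t s' v. run c s t s' \<and> mrun v k s' [] s'' \<and> length v < length u"
proof (induction "length u" arbitrary: u c k s rule: less_induct)
  case less
  obtain b v where u: "u = b # v" using less.prems by (cases u) auto
  note IH = less.hyps[unfolded u]
  show ?case
  proof (cases c)
    case Skip with less.prems u show ?thesis by (auto intro: run.intros)
  next
    case (Push r b) with less.prems u show ?thesis by (fastforce intro: run.intros)
  next
    case (Pop r b) with less.prems u show ?thesis
      by (auto split: if_splits simp: neq_Nil_conv intro!: run.intros exI)
  next
    case (Empty r) with less.prems u show ?thesis by (auto split: if_splits intro: run.intros)
  next
    case (Seq c1 c2)
    with less.prems u have "mrun v (c1 # c2 # k) s [] s''" by auto
    from IH[OF _ this] obtain t s' w where 1: "run c1 s t s'" "mrun w (c2 # k) s' [] s''" "length w < length v" by auto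
    from IH[OF _ 1(2)] 1(3) obtain t2 s2 w2 where 2: "run c2 s' t2 s2" "mrun w2 k s2 [] s''" "length w2 < length w" by auto
    have "run c s (Suc (t + t2)) s2" using Seq run_Seq[OF 1(1) 2(1)] by simp
    moreover have "length w2 < length u" using u 1 2 by simp
    ultimately show ?thesis using 2(2) by blast
  next
    case (Choice c1 c2)
    with less.prems u have "mrun v ((if b then c1 else c2) # k) s [] s''" by auto
    from IH[OF _ this] obtain t s' w where 1: "run (if b then c1 else c2) s t s'" "mrun w k s' [] s''" "length w < length v" by auto
    then have "run c s (Suc t) s'" using Choice by (auto split: if_splits intro: run.intros)
    with 1 u show ?thesis by (auto intro!: exI)
  next
    case (Star c1)
    show ?thesis
    proof (cases b)
      case True
      with less.prems u Star have "mrun v (c1 # Star c1 # k) s [] s''" by auto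
      from IH[OF _ this] obtain t s' w where 1: "run c1 s t s'" "mrun w (Star c1 # k) s' [] s''" "length w < length v" by auto
      from IH[OF _ 1(2)] 1(3) obtain t2 s2 w2 where 2: "run (Star c1) s' t2 s2" "mrun w2 k s2 [] s''" "length w2 < length w" by auto
      have "run c s (Suc (t + t2)) s2" using Star run_Star_step[OF 1(1) 2(1)] by simp
      moreover have "length w2 < length u" using u 1 2 by simp
      ultimately show ?thesis using 2(2) by blast
    next
      case False
      with less.prems u Star show ?thesis by (auto intro!: exI run_Star_stop)
    qed
  qed
qed

text \<open>The command lists reachable from \<open>[c]\<close>, in the manner of Antimirov's
  partial derivatives of a regular expression. Finiteness of this set is what turns the small steps
  into the finite control of a machine.\<close>

fun conts :: "com \<Rightarrow> com list set" where
  "conts (c ;; d) = {[c ;; d]} \<union> (\<lambda>x. x @ [d]) ` conts c \<union> conts d"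
| "conts (Choice c d) = {[Choice c d]} \<union> conts c \<union> conts d"
| "conts (Star c) = {[Star c], []} \<union> (\<lambda>x. x @ [Star c]) ` conts c"
| "conts c = {[c], []}"

lemma finite_conts: "finite (conts c)"
  by (induction c) auto

lemma self_in_conts: "[c] \<in> conts c"
  by (cases c) auto

lemma micro_append:
  "x \<noteq> [] \<Longrightarrow> micro b (x @ y) s = map_option (\<lambda>(k, s). (k @ y, s)) (micro b x s)"
  by (cases "(b, x, s)" rule: micro.cases) auto

lemma micro_conts: "x \<in> conts c \<Longrightarrow> micro b x s = Some (x', s') \<Longrightarrow> x' \<in> conts c"
proof (induction c arbitrary: x x')
  case (Seq c d)
  consider "x = [c ;; d]" | "x \<in> conts d" | y where "x = y @ [d]" "y \<in> conts c" "y \<noteq> []"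
    using Seq.prems self_in_conts by fastforce
  then show ?case
  proof cases
    case 1 then show ?thesis using Seq.prems self_in_conts[of c] by force
  next
    case 2 then show ?thesis using Seq by auto
  next
    case 3 then show ?thesis using Seq by (force simp: micro_append)
  qed
next
  case (Choice c d) then show ?case using self_in_conts by (auto split: if_splits)
next
  case (Star c)
  consider "x = [Star c]" | "x = []" | y where "x = y @ [Star c]" "y \<in> conts c" "y \<noteq> []"
    using Star.prems by fastforce
  then show ?case
  proof cases
    case 1 then show ?thesis using Star.prems self_in_conts[of c] by (force split: if_splits)
  next
    case 2 then show ?thesis using Star.prems by auto
  next
    case 3 then show ?thesis using Star by (force simp: micro_append)
  qed
qed (auto split: if_splits)

lemma num_regs_conts: "x \<in> conts c \<Longrightarrow> d \<in> set x \<Longrightarrow> num_regs d \<le> num_regs c"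
  by (induction c arbitrary: x d) (fastforce simp: max_def)+

section \<open>Compilation\<close>

text \<open>Tape 1 is reserved for the certificate.\<close>

definition reg_tape :: "nat \<Rightarrow> nat" where
  "reg_tape r = (if r = 0 then 0 else Suc r)"

text \<open>
  Phase \<open>False\<close> only moves the head of a stack that is going to be pushed; phase \<open>True\<close> does the rest
  and consumes one bit of the certificate. Hence the certificate resolves the nondeterminism and
  is also the clock.
\<close>

definition state_code :: "com \<Rightarrow> com list \<Rightarrow> bool \<Rightarrow> nat" where
  "state_code c = (SOME g. (\<forall>k p. g k p < 3 + 2 * card (conts c)) \<and> (\<forall>p. g [] p = 1) \<and>
     (\<forall>k\<in>conts c. \<forall>p. k \<noteq> [] \<longrightarrow> 2 \<le> g k p) \<and>
     inj_on (\<lambda>(k, p). g k p) ((conts c - {[]}) \<times> UNIV))"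

text \<open>The states 0 and 1 are kept for rejecting and accepting. The empty list is accepting in
  both phases, so injectivity can be asked only away from it.\<close>

lemma state_code:
  shows state_code_less: "state_code c k p < 3 + 2 * card (conts c)"
    and state_code_Nil [simp]: "state_code c [] p = 1"
    and state_code_ge: "k \<in> conts c \<Longrightarrow> k \<noteq> [] \<Longrightarrow> 2 \<le> state_code c k p"
    and state_code_inj: "inj_on (\<lambda>(k, p). state_code c k p) ((conts c - {[]}) \<times> UNIV)"
proof -
  obtain h :: "com list \<times> bool \<Rightarrow> nat" where h: "bij_betw h (conts c \<times> UNIV) {0..<card (conts c \<times> (UNIV :: bool set))}"
    using ex_bij_betw_finite_nat finite_conts by (metis finite_SigmaI finite)
  have card: "card (conts c \<times> (UNIV :: bool set)) = 2 * card (conts c)"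
    by (simp add: card_cartesian_product)
  define g where "g = (\<lambda>k p. if k = [] then 1 else if k \<in> conts c then 2 + h (k, p) else 0)"
  have 1: "g k p < 3 + 2 * card (conts c)" for k p
    using bij_betwE[OF h, rule_format, of "(k, p)"] card unfolding g_def by auto
  have 2: "inj_on (\<lambda>(k, p). g k p) ((conts c - {[]}) \<times> UNIV)"
    using h unfolding g_def bij_betw_def inj_on_def by force
  have "\<exists>g. (\<forall>k (p :: bool). g k p < 3 + 2 * card (conts c)) \<and> (\<forall>p. g [] p = 1) \<and>
     (\<forall>k\<in>conts c. \<forall>p. k \<noteq> [] \<longrightarrow> 2 \<le> g k p) \<and>
     inj_on (\<lambda>(k, p). g k p) ((conts c - {[]}) \<times> UNIV)"
  proof (intro exI[of _ g] conjI)
    show "\<forall>k p. g k p < 3 + 2 * card (conts c)" using 1 by blast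
    show "inj_on (\<lambda>(k, p). g k p) ((conts c - {[]}) \<times> UNIV)" by (rule 2)
  qed (auto simp: g_def)
  from someI_ex[OF this] show "state_code c k p < 3 + 2 * card (conts c)"
    "state_code c [] p = 1" "k \<in> conts c \<Longrightarrow> k \<noteq> [] \<Longrightarrow> 2 \<le> state_code c k p"
    "inj_on (\<lambda>(k, p). state_code c k p) ((conts c - {[]}) \<times> UNIV)"
    unfolding state_code_def by blast+
qed

fun control :: "bool \<Rightarrow> com list \<Rightarrow> nat list \<Rightarrow> com list option" where
  "control b [] ss = None"
| "control b (Skip # k) ss = Some k"
| "control b (Push r x # k) ss = Some k"
| "control b (Pop r x # k) ss = (if ss ! reg_tape r = bit_symbol x then Some k else None)"
| "control b (Empty r # k) ss = (if ss ! reg_tape r = 0 then Some k else None)"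
| "control b ((c ;; d) # k) ss = Some (c # d # k)"
| "control b (Choice c d # k) ss = Some ((if b then c else d) # k)"
| "control b (Star c # k) ss = Some (if b then c # Star c # k else k)"

fun prepare_act :: "com list \<Rightarrow> nat \<Rightarrow> nat \<Rightarrow> nat \<times> move" where
  "prepare_act (Push r x # k) j s = (s, if j = reg_tape r then Leftward else Stay)"
| "prepare_act k j s = (s, Stay)"

fun main_act :: "com list \<Rightarrow> nat \<Rightarrow> nat \<Rightarrow> nat \<times> move" where
  "main_act (Push r x # k) j s = (if j = reg_tape r then bit_symbol x else s, if j = 1 then Rightward else Stay)"
| "main_act (Pop r x # k) j s = (s, if j = 1 \<or> j = reg_tape r then Rightward else Stay)"
| "main_act k j s = (s, if j = 1 then Rightward else Stay)"

definition acts :: "(nat \<Rightarrow> nat \<Rightarrow> nat \<times> move) \<Rightarrow> nat list \<Rightarrow> (nat \<times> move) list" where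
  "acts f ss = map (\<lambda>j. f j (ss ! j)) [0..<length ss]"

text \<open>A blank on the certificate tape means that the clock has run out; like a failed test, it
  leads to the rejecting state 0.\<close>

definition transition_of :: "com \<Rightarrow> com list \<Rightarrow> bool \<Rightarrow> nat list \<Rightarrow> nat \<times> (nat \<times> move) list" where
  "transition_of c k p ss =
     (if \<not> p then (state_code c k True, acts (prepare_act k) ss)
      else if ss ! 1 = 0 then (0, acts (\<lambda>_ s. (s, Stay)) ss)
      else case control (ss ! 1 = 2) k ss of
             None \<Rightarrow> (0, acts (\<lambda>_ s. (s, Stay)) ss)
           | Some k' \<Rightarrow> (state_code c k' False, acts (main_act k) ss))"

definition compile :: "com \<Rightarrow> tm" where
  "compile c =
     \<lparr> num_tapes = Suc (max 1 (num_regs c)), num_symbols = 3,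
       num_states = 3 + 2 * card (conts c),
       start_state = state_code c [c] False, accept_state = 1, reject_state = 0,
       transition = (\<lambda>q ss.
         if q \<in> (\<lambda>(k, p). state_code c k p) ` ((conts c - {[]}) \<times> UNIV)
         then case inv_into ((conts c - {[]}) \<times> UNIV) (\<lambda>(k, p). state_code c k p) q of
           (k, p) \<Rightarrow> transition_of c k p ss
         else (0, acts (\<lambda>_ s. (s, Stay)) ss)) \<rparr>"

lemma transition_compile:
  assumes "k \<in> conts c" "k \<noteq> []"
  shows "transition (compile c) (state_code c k p) = transition_of c k p"
proof
  fix ss
  have in_dom: "(k, p) \<in> (conts c - {[]}) \<times> UNIV" using assms by auto
  have "inv_into ((conts c - {[]}) \<times> UNIV) (\<lambda>(k, p). state_code c k p) (state_code c k p) = (k, p)"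
    using inv_into_f_f[OF state_code_inj in_dom] by simp
  moreover have "state_code c k p \<in> (\<lambda>(k, p). state_code c k p) ` ((conts c - {[]}) \<times> UNIV)"
    using imageI[OF in_dom, of "\<lambda>(k, p). state_code c k p"] by simp
  ultimately show "transition (compile c) (state_code c k p) ss = transition_of c k p ss"
    by (simp add: compile_def)
qed

section \<open>Well-formedness of the compiled machine\<close>

lemma length_acts [simp]: "length (acts f ss) = length ss"
  by (simp add: acts_def)

lemma nth_acts [simp]: "j < length ss \<Longrightarrow> acts f ss ! j = f j (ss ! j)"
  by (simp add: acts_def)

lemma bit_symbol_range: "bit_symbol x < 3" "bit_symbol x \<noteq> 0"
  by (cases x; simp)+

lemma bit_symbol_inj [simp]: "bit_symbol x = bit_symbol y \<longleftrightarrow> x = y"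
  by (cases x; cases y) auto

lemma acts_symbols:
  assumes "\<And>j s. s < 3 \<Longrightarrow> fst (f j s) < 3" "\<forall>s\<in>set ss. s < (3::nat)"
  shows "\<forall>(s, d)\<in>set (acts f ss). s < 3"
  using assms by (auto simp: acts_def) (metis fst_conv nth_mem)

lemma prepare_act_symbol: "s < 3 \<Longrightarrow> fst (prepare_act k j s) < 3"
  by (cases "(k, j, s)" rule: prepare_act.cases) auto

lemma main_act_symbol: "s < 3 \<Longrightarrow> fst (main_act k j s) < 3"
  using bit_symbol_range by (cases "(k, j, s)" rule: main_act.cases) auto

lemma turing_machine_compile: "turing_machine (compile c)"
proof -
  have "case transition_of c k p ss of (q', as) \<Rightarrow>
      q' < 3 + 2 * card (conts c) \<and> length as = length ss \<and> (\<forall>(s, d)\<in>set as. s < 3)"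
    if "\<forall>s\<in>set ss. s < 3" for k p ss
    using state_code_less[of c] acts_symbols[OF prepare_act_symbol that]
      acts_symbols[OF main_act_symbol that] acts_symbols[of "\<lambda>_ s. (s, Stay)", OF _ that]
    unfolding transition_of_def by (auto split: option.split)
  moreover have "s < 3" if "\<forall>s\<in>set ss. s < 3" "(s, d) \<in> set (acts (\<lambda>_ s. (s, Stay)) ss)" for s d ss
    using acts_symbols[of "\<lambda>_ s. (s, Stay)", OF _ that(1)] that(2) by fastforce
  ultimately show ?thesis
    unfolding turing_machine_def compile_def
    using state_code_less[of c] by (auto simp: split_beta)
qed

section \<open>Stacks stored on tapes, and the simulation of one small step by two machine
  steps\<close>

definition holds :: "tape \<Rightarrow> bool list \<Rightarrow> bool" where
  "holds T w \<longleftrightarrow> (\<forall>i. fst T (snd T + int i) = (if i < length w then bit_symbol (w ! i) else 0))"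

definition represents :: "com \<Rightarrow> store \<Rightarrow> bool list \<Rightarrow> tape list \<Rightarrow> bool" where
  "represents c s v Ts \<longleftrightarrow> length Ts = Suc (max 1 (num_regs c)) \<and> holds (Ts ! 1) v \<and>
     (\<forall>r < max 1 (num_regs c). holds (Ts ! reg_tape r) (s r))"

lemma holds_word_tape: "holds (word_tape w) w"
  by (auto simp: holds_def word_tape_def)

lemma holds_push:
  assumes "holds T w"
  shows "holds ((fst T)(snd T - 1 := bit_symbol x), snd T - 1) (x # w)"
  unfolding holds_def
proof
  fix i
  show "fst ((fst T)(snd T - 1 := bit_symbol x), snd T - 1) (snd ((fst T)(snd T - 1 := bit_symbol x), snd T - 1) + int i) =
    (if i < length (x # w) then bit_symbol ((x # w) ! i) else 0)"
  proof (cases i)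
    case (Suc j)
    then have "snd T - 1 + int i = snd T + int j" by simp
    then show ?thesis using assms Suc by (simp add: holds_def)
  qed simp
qed

text \<open>The cells to the left of the head are left open by \<open>holds\<close>, so popping
  moves the head and erases nothing.\<close>

lemma holds_pop:
  assumes "holds T (x # w)"
  shows "holds (fst T, snd T + 1) w"
  unfolding holds_def
proof
  fix i
  have "fst T (snd T + int (Suc i)) = (if Suc i < length (x # w) then bit_symbol ((x # w) ! Suc i) else 0)"
    using assms unfolding holds_def by blast
  then show "fst (fst T, snd T + 1) (snd (fst T, snd T + 1) + int i) = (if i < length w then bit_symbol (w ! i) else 0)"
    by (simp add: ac_simps)
qed

lemma scanned_eq: "scanned T = fst T (snd T)"
  by (cases T) simp

lemma scanned_holds:
  assumes "holds T w"
  shows "scanned T = (case w of [] \<Rightarrow> 0 | x # _ \<Rightarrow> bit_symbol x)"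
proof -
  have "fst T (snd T + int 0) = (if 0 < length w then bit_symbol (w ! 0) else 0)"
    using assms unfolding holds_def by blast
  then show ?thesis by (simp add: scanned_eq split: list.split)
qed

lemma act_scanned [simp]: "act (scanned T, d) T = (fst T, snd T + offset d)"
  by (cases T) simp

lemma reg_tape_neq_1 [simp]: "reg_tape r \<noteq> 1" "reg_tape r \<noteq> Suc 0" "Suc 0 \<noteq> reg_tape r"
  by (auto simp: reg_tape_def)

lemma reg_tape_inj [simp]: "reg_tape r = reg_tape r' \<longleftrightarrow> r = r'"
  by (auto simp: reg_tape_def)

lemma reg_tape_less: "r < max 1 R \<Longrightarrow> reg_tape r < Suc (max 1 R)"
  by (auto simp: reg_tape_def)

text \<open>The combined effect of both phases on one tape. The head of a pushed stack moves in the
  first phase and writes in the second.\<close>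

definition double_act :: "com list \<Rightarrow> nat \<Rightarrow> tape \<Rightarrow> tape" where
  "double_act k j T = (let T' = act (prepare_act k j (scanned T)) T in act (main_act k j (scanned T')) T')"

lemma double_act_eq:
  "double_act k j T =
    (if j = 1 then (fst T, snd T + 1)
     else case k of
       Push r x # _ \<Rightarrow> if j = reg_tape r then ((fst T)(snd T - 1 := bit_symbol x), snd T - 1) else T
     | Pop r x # _ \<Rightarrow> if j = reg_tape r then (fst T, snd T + 1) else T
     | _ \<Rightarrow> T)"
proof (cases T)
  case (Pair t h)
  show ?thesis unfolding Pair
    by (cases "(k, j, t h)" rule: main_act.cases) (auto simp: double_act_def Let_def)
qed

text \<open>A stack about to be pushed is excluded because the first phase has already moved its
  head off the top symbol; no test reads it.\<close>

lemma control_micro: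
  assumes "\<And>r. r < num_regs (hd k) \<Longrightarrow> \<not> (\<exists>x. hd k = Push r x) \<Longrightarrow> ss ! reg_tape r = (case s r of [] \<Rightarrow> 0 | x # _ \<Rightarrow> bit_symbol x)"
  shows "control b k ss = map_option fst (micro b k s)"
  using assms bit_symbol_range(2)
  by (cases "(b, k, s)" rule: micro.cases) (auto split: list.splits)

lemma represents_double_act:
  assumes rep: "represents c s (b # v) Ts" and k: "k \<in> conts c"
    and m: "micro b k s = Some (k', s')"
  shows "represents c s' v (map (\<lambda>j. double_act k j (Ts ! j)) [0..<length Ts])"
proof -
  let ?R = "max 1 (num_regs c)"
  have len: "length Ts = Suc ?R" and cert: "holds (Ts ! 1) (b # v)"
    and regs: "\<And>r. r < ?R \<Longrightarrow> holds (Ts ! reg_tape r) (s r)"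
    using rep by (auto simp: represents_def)
  have "holds (double_act k (reg_tape r) (Ts ! reg_tape r)) (s' r)" if "r < ?R" for r
  proof -
    note h = regs[OF that]
    show ?thesis
      using m h holds_push[OF h] holds_pop[of "Ts ! reg_tape r" "hd (s r)" "tl (s r)"]
      by (cases "(b, k, s)" rule: micro.cases) (auto simp: double_act_eq split: if_splits)
  qed
  moreover have "holds (double_act k 1 (Ts ! 1)) v"
    using holds_pop[OF cert] by (simp add: double_act_eq)
  moreover have "map (\<lambda>j. double_act k j (Ts ! j)) [0..<length Ts] ! j = double_act k j (Ts ! j)"
    if "j < length Ts" for j using that by simp
  ultimately show ?thesis
    using reg_tape_less[of _ "num_regs c"] len by (simp add: represents_def del: upt_Suc)
qed

lemma double_step:
  assumes rep: "represents c s v Ts" and k: "k \<in> conts c" "k \<noteq> []"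
  defines "M \<equiv> compile c"
  defines "C \<equiv> step M (step M (state_code c k False, Ts))"
  shows "v = [] \<Longrightarrow> fst C = 0"
    and "v = b # v' \<Longrightarrow> micro b k s = None \<Longrightarrow> fst C = 0"
    and "v = b # v' \<Longrightarrow> micro b k s = Some (k', s') \<Longrightarrow>
      \<exists>Ts'. C = (state_code c k' False, Ts') \<and> represents c s' v' Ts'"
proof -
  let ?R = "max 1 (num_regs c)"
  have len: "length Ts = Suc ?R" and cert: "holds (Ts ! 1) v"
    and regs: "\<And>r. r < ?R \<Longrightarrow> holds (Ts ! reg_tape r) (s r)"
    using rep by (auto simp: represents_def)
  have not_halted: "\<not> halted M (state_code c k p, Ts')" for p Ts'
    using state_code_ge[OF k, of p] by (simp add: halted_def M_def compile_def)
  define Ts1 where "Ts1 = map2 act (acts (prepare_act k) (map scanned Ts)) Ts"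
  have len1: "length Ts1 = length Ts" by (simp add: Ts1_def)
  have nth1: "Ts1 ! j = act (prepare_act k j (scanned (Ts ! j))) (Ts ! j)" if "j < length Ts" for j
    using that by (simp add: Ts1_def)
  have step1: "step M (state_code c k False, Ts) = (state_code c k True, Ts1)"
    using not_halted by (simp add: step_def M_def transition_compile[OF k] transition_of_def Ts1_def)
  define ss where "ss = map scanned Ts1"
  have C: "C = (case transition_of c k True ss of (q', as) \<Rightarrow> (q', map2 act as Ts1))"
    using not_halted unfolding C_def step1
    by (simp add: step_def M_def transition_compile[OF k] ss_def)
  have "Ts1 ! 1 = Ts ! 1"
    using len by (cases "(k, 1 :: nat, scanned (Ts ! 1))" rule: prepare_act.cases) (auto simp: nth1)
  then have ss1: "ss ! 1 = (case v of [] \<Rightarrow> 0 | x # _ \<Rightarrow> bit_symbol x)"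
    using scanned_holds[OF cert] len len1 by (simp add: ss_def)
  show "fst C = 0" if "v = []"
    using that ss1 by (simp add: C transition_of_def)
  have ctl: "control b k ss = map_option fst (micro b k s)" for b
  proof (rule control_micro)
    fix r assume r: "r < num_regs (hd k)" "\<not> (\<exists>x. hd k = Push r x)"
    have "hd k \<in> set k" using k by simp
    from num_regs_conts[OF k(1) this] r have "r < ?R" by simp
    note j = reg_tape_less[OF this]
    have "prepare_act k (reg_tape r) t = (t, Stay)" for t
      using r by (cases "(k, reg_tape r, t)" rule: prepare_act.cases) auto
    then have "Ts1 ! reg_tape r = Ts ! reg_tape r"
      using j len nth1[of "reg_tape r"] by simp
    then show "ss ! reg_tape r = (case s r of [] \<Rightarrow> 0 | x # _ \<Rightarrow> bit_symbol x)"
      using scanned_holds[OF regs[OF \<open>r < ?R\<close>]] j len len1 by (simp add: ss_def)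
  qed
  have bit: "ss ! 1 \<noteq> 0" "(ss ! 1 = 2) = b" if "v = b # v'"
    using that ss1 by (cases b; simp)+
  show "fst C = 0" if "v = b # v'" "micro b k s = None"
    using that bit ctl[of b] by (simp add: C transition_of_def)
  show "\<exists>Ts'. C = (state_code c k' False, Ts') \<and> represents c s' v' Ts'"
    if "v = b # v'" "micro b k s = Some (k', s')"
  proof -
    have "C = (state_code c k' False, map2 act (acts (main_act k) ss) Ts1)"
      using that bit ctl[of b] by (simp add: C transition_of_def)
    moreover have "map2 act (acts (main_act k) ss) Ts1 = map (\<lambda>j. double_act k j (Ts ! j)) [0..<length Ts]"
      by (rule nth_equalityI) (simp_all add: ss_def len1 nth1 double_act_def Let_def del: upt_Suc)
    ultimately show ?thesis
      using represents_double_act[OF rep[unfolded that(1)] k(1) that(2)] by simp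
  qed
qed

section \<open>Acceptance and running time of the compiled machine\<close>

lemma step_halted: "halted M C \<Longrightarrow> step M C = C"
  by (simp add: step_def)

lemma steps_halted: "halted M C \<Longrightarrow> (step M ^^ t) C = C"
  by (induction t) (auto simp: step_halted)

lemma steps_accept_shift:
  "(\<exists>t. fst ((step M ^^ t) C) = accept_state M) \<longleftrightarrow>
   (\<exists>t. fst ((step M ^^ t) (step M C)) = accept_state M)"
proof
  assume "\<exists>t. fst ((step M ^^ t) C) = accept_state M"
  then obtain t where t: "fst ((step M ^^ t) C) = accept_state M" by blast
  then have "halted M ((step M ^^ t) C)" by (simp add: halted_def)
  then have "(step M ^^ Suc t) C = (step M ^^ t) C" by (simp add: step_halted)
  then show "\<exists>t. fst ((step M ^^ t) (step M C)) = accept_state M"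
    using t by (metis funpow_Suc_right comp_apply)
next
  assume "\<exists>t. fst ((step M ^^ t) (step M C)) = accept_state M"
  then show "\<exists>t. fst ((step M ^^ t) C) = accept_state M"
    by (metis funpow_Suc_right comp_apply)
qed

lemma compile_simps [simp]:
  "accept_state (compile c) = 1" "reject_state (compile c) = 0"
  "num_tapes (compile c) = Suc (max 1 (num_regs c))"
  "start_state (compile c) = state_code c [c] False"
  by (auto simp: compile_def)

text \<open>The machine accepts as soon as the command list is empty, hence only a prefix
  \<open>v1\<close> of the certificate has to drive the run and further bits are ignored. Each bit
  takes two machine steps; the last two steps serve to notice the blank at the end.\<close>

lemma compile_simulates:
  assumes "represents c s v Ts" "k \<in> conts c"
  defines "M \<equiv> compile c"
  shows "(\<exists>t. fst ((step M ^^ t) (state_code c k False, Ts)) = 1) \<longleftrightarrow>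
      (\<exists>v1 v2 s'. v = v1 @ v2 \<and> mrun v1 k s [] s')"
    and "halted M ((step M ^^ (2 * length v + 2)) (state_code c k False, Ts))"
proof -
  have "((\<exists>t. fst ((step M ^^ t) (state_code c k False, Ts)) = 1) \<longleftrightarrow>
      (\<exists>v1 v2 s'. v = v1 @ v2 \<and> mrun v1 k s [] s')) \<and>
    halted M ((step M ^^ (2 * length v + 2)) (state_code c k False, Ts))"
    using assms(1,2)
  proof (induction v arbitrary: k s Ts)
    case Nil
    show ?case
    proof (cases "k = []")
      case True
      then have "halted M (state_code c k False, Ts)" by (simp add: halted_def M_def)
      with True steps_halted[OF this] show ?thesis by (auto intro: exI[of _ 0] simp: step_halted)
    next
      case False
      let ?C = "step M (step M (state_code c k False, Ts))"
      have C: "fst ?C = 0" using double_step(1)[OF Nil False] by (simp add: M_def)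
      then have h: "halted M ?C" by (simp add: halted_def M_def)
      have "\<not> (\<exists>t. fst ((step M ^^ t) (state_code c k False, Ts)) = accept_state M)"
        unfolding steps_accept_shift[of M "(state_code c k False, Ts)"] steps_accept_shift[of M "step M (state_code c k False, Ts)"]
        using C steps_halted[OF h] by (simp add: M_def)
      then show ?thesis using False h by (auto simp: M_def)
    qed
  next
    case (Cons b v)
    show ?case
    proof (cases "k = []")
      case True
      then have "halted M (state_code c k False, Ts)" by (simp add: halted_def M_def)
      moreover have "\<exists>v1 v2 s'. b # v = v1 @ v2 \<and> mrun v1 k s [] s'"
        using True by (metis append_Nil mrun.simps(1))
      ultimately show ?thesis using True steps_halted[of M "(state_code c k False, Ts)"]
        by (auto intro: exI[of _ 0] simp del: funpow.simps)
    next
      case False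
      let ?C = "step M (step M (state_code c k False, Ts))"
      have shift: "(\<exists>t. fst ((step M ^^ t) (state_code c k False, Ts)) = 1) \<longleftrightarrow>
          (\<exists>t. fst ((step M ^^ t) ?C) = 1)"
        using steps_accept_shift[of M "(state_code c k False, Ts)"] steps_accept_shift[of M "step M (state_code c k False, Ts)"]
        by (simp add: M_def)
      have runs: "(\<exists>v1 v2 s'. b # v = v1 @ v2 \<and> mrun v1 k s [] s') \<longleftrightarrow>
         (\<exists>k1 s1. micro b k s = Some (k1, s1) \<and> (\<exists>v1 v2 s'. v = v1 @ v2 \<and> mrun v1 k1 s1 [] s'))"
      proof
        assume "\<exists>v1 v2 s'. b # v = v1 @ v2 \<and> mrun v1 k s [] s'"
        then obtain v1 v2 s' where "b # v = v1 @ v2" "mrun v1 k s [] s'" by blast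
        then show "\<exists>k1 s1. micro b k s = Some (k1, s1) \<and> (\<exists>v1 v2 s'. v = v1 @ v2 \<and> mrun v1 k1 s1 [] s')"
          using False by (cases v1) auto
      next
        assume "\<exists>k1 s1. micro b k s = Some (k1, s1) \<and> (\<exists>v1 v2 s'. v = v1 @ v2 \<and> mrun v1 k1 s1 [] s')"
        then obtain k1 s1 v1 v2 s' where "micro b k s = Some (k1, s1)" "v = v1 @ v2" "mrun v1 k1 s1 [] s'" by blast
        then have "b # v = (b # v1) @ v2 \<and> mrun (b # v1) k s [] s'" by simp
        then show "\<exists>v1 v2 s'. b # v = v1 @ v2 \<and> mrun v1 k s [] s'" by blast
      qed
      have time: "(step M ^^ (2 * length (b # v) + 2)) (state_code c k False, Ts) = (step M ^^ (2 * length v + 2)) ?C"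
        by (simp add: funpow_swap1)
      show ?thesis
      proof (cases "micro b k s")
        case None
        then have C: "fst ?C = 0" using double_step(2)[OF Cons.prems False] by (simp add: M_def)
        then have h: "halted M ?C" by (simp add: halted_def M_def)
        show ?thesis unfolding shift runs time steps_halted[OF h] using None C h by simp
      next
        case (Some x)
        obtain k1 s1 where x: "micro b k s = Some (k1, s1)" using Some by (cases x) auto
        from double_step(3)[OF Cons.prems False refl x] obtain Ts'
          where C: "?C = (state_code c k1 False, Ts')" and rep: "represents c s1 v Ts'" by (auto simp: M_def)
        from Cons.IH[OF rep micro_conts[OF Cons.prems(2) x]]
        show ?thesis unfolding shift runs time C x by simp
      qed
    qed
  qed
  then show "(\<exists>t. fst ((step M ^^ t) (state_code c k False, Ts)) = 1) \<longleftrightarrow>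
      (\<exists>v1 v2 s'. v = v1 @ v2 \<and> mrun v1 k s [] s')"
    "halted M ((step M ^^ (2 * length v + 2)) (state_code c k False, Ts))" by blast+
qed

text \<open>The calling convention of the programs that compute relations below: input and output
  stand alone on stack 0.\<close>

definition clean :: "bool list \<Rightarrow> store" where
  "clean w = (\<lambda>r. if r = 0 then w else [])"

lemma represents_initial:
  "\<exists>Ts. initial_config (compile c) x u = (state_code c [c] False, Ts) \<and> represents c (clean x) u Ts"
proof -
  let ?Ts = "word_tape x # word_tape u # replicate (max 1 (num_regs c) - 1) (word_tape [])"
  have "represents c (clean x) u ?Ts"
    by (auto simp: represents_def holds_word_tape clean_def reg_tape_def)
  then show ?thesis by (auto simp: initial_config_def)
qed

lemma polytime_verifier_compile: "polytime_verifier (compile c)"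
proof -
  have "halted (compile c) (config_after (compile c) x u (poly [:2, 2:] (length x + length u)))" for x u
  proof -
    obtain Ts where init: "initial_config (compile c) x u = (state_code c [c] False, Ts)"
      and rep: "represents c (clean x) u Ts" using represents_initial by blast
    have h: "halted (compile c) ((step (compile c) ^^ (2 * length u + 2)) (state_code c [c] False, Ts))"
      using compile_simulates(2)[OF rep self_in_conts] .
    \<comment> \<open>The clock gives the bound \<open>2 * length u + 2\<close>. The surplus
      \<open>2 * length x\<close> comes from the form of the required bound and is spent in a halted
      configuration.\<close>
    have "poly [:2, 2:] (length x + length u) = 2 * length x + (2 * length u + 2)" by simp
    then have "config_after (compile c) x u (poly [:2, 2:] (length x + length u)) =
        (step (compile c) ^^ (2 * length u + 2)) (state_code c [c] False, Ts)"
      using steps_halted[OF h] by (simp only: config_after_def init funpow_add comp_apply)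
    then show ?thesis using h by simp
  qed
  then show ?thesis using turing_machine_compile unfolding polytime_verifier_def by blast
qed

lemma accepts_compile_iff:
  "accepts (compile c) x u \<longleftrightarrow> (\<exists>v1 v2 s'. u = v1 @ v2 \<and> mrun v1 [c] (clean x) [] s')"
proof -
  obtain Ts where init: "initial_config (compile c) x u = (state_code c [c] False, Ts)"
    and rep: "represents c (clean x) u Ts" using represents_initial by blast
  show ?thesis using compile_simulates(1)[OF rep self_in_conts]
    by (simp add: accepts_def config_after_def init)
qed

text \<open>The certificate of a yes-instance is the list of choice bits of a run, and its length is
  the running time.\<close>

theorem promise_NP_if_run:
  assumes sound: "\<And>I t s'. P I \<Longrightarrow> run c (clean (enc I)) t s' \<Longrightarrow> Y I"
    and complete: "\<And>I. P I \<Longrightarrow> Y I \<Longrightarrow> \<exists>t s'. t \<le> (length (enc I) + 2) ^ k \<and> run c (clean (enc I)) t s'"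
  shows "promise_NP enc P Y"
  unfolding promise_NP_def
proof (intro exI conjI allI impI)
  show "polytime_verifier (compile c)" by (rule polytime_verifier_compile)
  fix I assume P: "P I"
  have poly: "poly ([:2, 1:] ^ k) (length (enc I)) = (length (enc I) + 2) ^ k"
    by (simp add: poly_power ac_simps)
  show "(\<exists>u. length u \<le> poly ([:2, 1:] ^ k) (length (enc I)) \<and> accepts (compile c) (enc I) u) = Y I"
  proof
    assume "\<exists>u. length u \<le> poly ([:2, 1:] ^ k) (length (enc I)) \<and> accepts (compile c) (enc I) u"
    then obtain v s' where "mrun v [c] (clean (enc I)) [] s'" by (auto simp: accepts_compile_iff)
    from mrun_imp_run[OF this] sound[OF P] show "Y I" by blast
  next
    assume "Y I"
    from complete[OF P this] obtain t s' where t: "t \<le> (length (enc I) + 2) ^ k" "run c (clean (enc I)) t s'" by blast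
    from run_imp_mrun[OF t(2)] obtain u where "length u = t" "mrun u [c] (clean (enc I)) [] s'" by blast
    then show "\<exists>u. length u \<le> poly ([:2, 1:] ^ k) (length (enc I)) \<and> accepts (compile c) (enc I) u"
      using t(1) unfolding poly accepts_compile_iff by (intro exI[of _ u]) auto
  qed
qed

section \<open>Basic stack programs\<close>

lemma run_frame: "run c s t s' \<Longrightarrow> r \<ge> num_regs c \<Longrightarrow> s' r = s r"
  by (induction rule: run.induct) auto

definition merge :: "nat \<Rightarrow> store \<Rightarrow> store \<Rightarrow> store" where
  "merge K s s1 = (\<lambda>r. if r < K then s r else s1 r)"

lemma merge_upd: "r < K \<Longrightarrow> merge K (s(r := w)) s1 = (merge K s s1)(r := w)"
  by (auto simp: merge_def)

lemma merge_less: "r < K \<Longrightarrow> merge K s s1 r = s r"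
  by (simp add: merge_def)

text \<open>The frame property: a program neither reads nor changes the stacks from
  \<open>num_regs c\<close> on, so their contents can be exchanged freely.\<close>

lemma run_merge:
  "run c s t s' \<Longrightarrow> num_regs c \<le> K \<Longrightarrow> run c (merge K s s1) t (merge K s' s1)"
proof (induction rule: run.induct)
  case (run_Push r b s)
  then have e: "(merge K s s1)(r := b # merge K s s1 r) = merge K (s(r := b # s r)) s1"
    by (simp add: merge_upd merge_less)
  show ?case using run.run_Push[of r b "merge K s s1"] unfolding e .
next
  case (run_Pop s r b w)
  then have "merge K (s(r := w)) s1 = (merge K s s1)(r := w)" "merge K s s1 r = b # w"
    by (simp_all add: merge_upd merge_less)
  then show ?case using run.run_Pop[of "merge K s s1" r b w] by (simp only:)
next
  case (run_Empty s r)
  then show ?case using run.run_Empty[of "merge K s s1" r] by (simp add: merge_less)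
qed (auto intro: run.intros run_Skip[simplified] run_Star_stop[simplified])

text \<open>Determinism up to dead ends: all runs that finish agree on the result, but only one of
  them has to be short.\<close>

definition exact :: "com \<Rightarrow> store \<Rightarrow> store \<Rightarrow> nat \<Rightarrow> bool" where
  "exact c s s' T \<longleftrightarrow> (\<forall>t s''. run c s t s'' \<longrightarrow> s'' = s') \<and> (\<exists>t\<le>T. run c s t s')"

definition stuck :: "com \<Rightarrow> store \<Rightarrow> bool" where
  "stuck c s \<longleftrightarrow> (\<forall>t s'. \<not> run c s t s')"

lemma exact_mono: "exact c s s' T \<Longrightarrow> T \<le> T' \<Longrightarrow> exact c s s' T'"
  unfolding exact_def using le_trans by blast

lemma exactI: "(\<And>t s''. run c s t s'' \<Longrightarrow> s'' = s') \<Longrightarrow> run c s t s' \<Longrightarrow> t \<le> T \<Longrightarrow> exact c s s' T"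
  unfolding exact_def by blast

lemma exact_runD: "exact c s s' T \<Longrightarrow> run c s t s'' \<Longrightarrow> s'' = s'"
  unfolding exact_def by blast

lemma exact_obtain:
  assumes "exact c s s' T"
  obtains t where "t \<le> T" "run c s t s'"
  using assms unfolding exact_def by blast

lemma exact_Skip: "exact Skip s s 1"
  by (rule exactI[OF _ run_Skip]) auto

lemma exact_Push: "exact (Push r b) s (s(r := b # s r)) 1"
  by (rule exactI[OF _ run_Push]) auto

lemma exact_Pop: "s r = b # w \<Longrightarrow> exact (Pop r b) s (s(r := w)) 1"
  by (rule exactI[OF _ run_Pop]) auto

lemma exact_Empty: "s r = [] \<Longrightarrow> exact (Empty r) s s 1"
  by (rule exactI[OF _ run_Empty]) auto

lemma exact_Seq:
  assumes "exact c s s' T" "exact d s' s'' T'"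
  shows "exact (c ;; d) s s'' (Suc (T + T'))"
proof -
  obtain t t' where t: "t \<le> T" "run c s t s'" "t' \<le> T'" "run d s' t' s''"
    using assms by (metis exact_obtain)
  show ?thesis
    by (rule exactI[OF _ run_Seq[OF t(2,4)]]) (use assms t in \<open>auto dest: exact_runD\<close>)
qed

lemma exact_ChoiceL:
  assumes "exact c s s' T" "stuck d s"
  shows "exact (Choice c d) s s' (Suc T)"
proof -
  obtain t where t: "t \<le> T" "run c s t s'" using assms by (metis exact_obtain)
  show ?thesis
    by (rule exactI[OF _ run_ChoiceL[OF t(2)]]) (use assms t in \<open>auto dest: exact_runD simp: stuck_def\<close>)
qed

lemma exact_ChoiceR:
  assumes "stuck c s" "exact d s s' T"
  shows "exact (Choice c d) s s' (Suc T)"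
proof -
  obtain t where t: "t \<le> T" "run d s t s'" using assms by (metis exact_obtain)
  show ?thesis
    by (rule exactI[OF _ run_ChoiceR[OF t(2)]]) (use assms t in \<open>auto dest: exact_runD simp: stuck_def\<close>)
qed

lemma stuck_Pop: "(\<And>w. s r \<noteq> b # w) \<Longrightarrow> stuck (Pop r b) s"
  unfolding stuck_def by auto

lemma stuck_Empty: "s r \<noteq> [] \<Longrightarrow> stuck (Empty r) s"
  unfolding stuck_def by auto

lemma stuck_Seq: "stuck c s \<Longrightarrow> stuck (c ;; d) s"
  unfolding stuck_def by auto

lemma stuck_Choice: "stuck c s \<Longrightarrow> stuck d s \<Longrightarrow> stuck (Choice c d) s"
  unfolding stuck_def by auto

text \<open>A while loop is \<open>Star c ;; d\<close> with a body and an exit that are never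
  enabled together: leaving too early fails in \<open>d\<close>, going on too long fails in
  \<open>c\<close>.\<close>

lemma exact_loop_stop:
  assumes "stuck c s" "exact d s s' T"
  shows "exact (Star c ;; d) s s' (T + 2)"
proof -
  obtain t where t: "t \<le> T" "run d s t s'" using assms by (metis exact_obtain)
  have stop: "run (Star c) s t s'' \<Longrightarrow> s'' = s" for t s''
    using assms(1) unfolding stuck_def by (blast elim: run_StarE)
  show ?thesis
    by (rule exactI[OF _ run_Seq[OF run_Star_stop t(2)]]) (use assms t stop in \<open>auto dest: exact_runD\<close>)
qed

lemma exact_loop_step:
  assumes "exact c s s1 T1" "stuck d s" "exact (Star c ;; d) s1 s' T"
  shows "exact (Star c ;; d) s s' (Suc (T1 + T))"
  unfolding exact_def
proof (intro conjI allI impI)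
  fix t s'' assume "run (Star c ;; d) s t s''"
  then obtain t1 t2 sm where 1: "run (Star c) s t1 sm" "run d sm t2 s''" by blast
  have "sm \<noteq> s" using 1(2) assms(2) unfolding stuck_def by blast
  with 1(1) obtain t' s2 t'' where 2: "run c s t' s2" "run (Star c) s2 t'' sm"
    by (blast elim: run_StarE)
  have "s2 = s1" by (rule exact_runD[OF assms(1) 2(1)])
  then have "run (Star c ;; d) s1 (Suc (t'' + t2)) s''" using run_Seq[OF 2(2) 1(2)] by simp
  then show "s'' = s'" by (rule exact_runD[OF assms(3)])
next
  obtain t1 where t1: "t1 \<le> T1" "run c s t1 s1" by (rule exact_obtain[OF assms(1)])
  obtain t2 where t2: "t2 \<le> T" "run (Star c ;; d) s1 t2 s'" by (rule exact_obtain[OF assms(3)])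
  then obtain a b sm where ab: "t2 = Suc (a + b)" "run (Star c) s1 a sm" "run d sm b s'" by blast
  have "run (Star c ;; d) s (Suc (Suc (t1 + a) + b)) s'"
    using run_Seq[OF run_Star_step[OF t1(2) ab(2)] ab(3)] .
  then show "\<exists>t\<le>Suc (T1 + T). run (Star c ;; d) s t s'"
    using t1(1) t2(1) ab(1) by (intro exI[of _ "Suc (Suc (t1 + a) + b)"]) auto
qed

section \<open>Clearing, moving and copying stacks\<close>

definition clear :: "nat \<Rightarrow> com" where
  "clear a = Star (Choice (Pop a True) (Pop a False)) ;; Empty a"

text \<open>Moving a word from stack to stack reverses it, so words are moved twice to restore their
  order. The same applies to the two copies made by \<open>rdup\<close>.\<close>

definition rmove :: "nat \<Rightarrow> nat \<Rightarrow> com" where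
  "rmove a b = Star (Choice (Pop a True ;; Push b True) (Pop a False ;; Push b False)) ;; Empty a"

definition rdup :: "nat \<Rightarrow> nat \<Rightarrow> nat \<Rightarrow> com" where
  "rdup a b c = Star (Choice (Pop a True ;; (Push b True ;; Push c True))
     (Pop a False ;; (Push b False ;; Push c False))) ;; Empty a"

lemma exact_branch:
  assumes "s a = x # w" "exact (d x) (s(a := w)) s' T"
  shows "exact (Choice (Pop a True ;; d True) (Pop a False ;; d False)) s s' (T + 3)"
proof -
  have 1: "exact (Pop a x ;; d x) s s' (T + 2)"
    using exact_Seq[OF exact_Pop[of s a, OF assms(1)] assms(2)] by (rule exact_mono) simp
  have 2: "stuck (Pop a (\<not> x) ;; d (\<not> x)) s"
    by (intro stuck_Seq stuck_Pop) (use assms in auto)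
  show ?thesis
  proof (cases x)
    case True
    with exact_ChoiceL[OF 1 2] show ?thesis by (simp add: eval_nat_numeral)
  next
    case False
    with exact_ChoiceR[OF 2 1] show ?thesis by (simp add: eval_nat_numeral)
  qed
qed

lemma stuck_branch:
  "s a = [] \<Longrightarrow> stuck (Choice (Pop a True ;; c) (Pop a False ;; d)) s"
  by (intro stuck_Choice stuck_Seq stuck_Pop) auto

lemma exact_rmove:
  assumes "a \<noteq> b"
  shows "exact (rmove a b) s (s(a := [], b := rev (s a) @ s b)) (6 * length (s a) + 3)"
proof (induction "s a" arbitrary: s)
  case Nil
  then have e: "s(a := [], b := rev (s a) @ s b) = s" by auto
  show ?case unfolding rmove_def e
    by (rule exact_mono[OF exact_loop_stop[OF stuck_branch exact_Empty]]) (use Nil in auto)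
next
  case (Cons x w)
  let ?s1 = "s(a := w, b := x # s b)"
  have 1: "exact (Choice (Pop a True ;; Push b True) (Pop a False ;; Push b False)) s ?s1 4"
    using exact_branch[where d = "Push b" and T = 1 and s = s and a = a, OF Cons(2)[symmetric]] exact_Push[of b x "s(a := w)"] assms
    by (simp add: eval_nat_numeral)
  have "exact (rmove a b) ?s1 (?s1(a := [], b := rev (?s1 a) @ ?s1 b)) (6 * length (?s1 a) + 3)"
    by (rule Cons(1)) (use assms in auto)
  moreover have "?s1(a := [], b := rev (?s1 a) @ ?s1 b) = s(a := [], b := rev (s a) @ s b)"
    using assms Cons(2)[symmetric] by auto
  ultimately have 2: "exact (rmove a b) ?s1 (s(a := [], b := rev (s a) @ s b)) (6 * length w + 3)"
    using assms by simp
  have "exact (rmove a b) s (s(a := [], b := rev (s a) @ s b)) (Suc (4 + (6 * length w + 3)))"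
    unfolding rmove_def by (rule exact_loop_step[OF 1 stuck_Empty 2[unfolded rmove_def]]) (use Cons(2)[symmetric] in auto)
  then show ?case by (rule exact_mono) (use Cons(2)[symmetric] in auto)
qed

lemma exact_clear: "exact (clear a) s (s(a := [])) (6 * length (s a) + 3)"
proof (induction "s a" arbitrary: s)
  case Nil
  then have e: "s(a := []) = s" by auto
  show ?case unfolding clear_def e
    by (rule exact_mono[OF exact_loop_stop[OF stuck_Choice[OF stuck_Pop stuck_Pop] exact_Empty]]) (use Nil in auto)
next
  case (Cons x w)
  have 1: "exact (Choice (Pop a True) (Pop a False)) s (s(a := w)) 2"
  proof (cases x)
    case True
    then show ?thesis
      using exact_ChoiceL[OF exact_Pop stuck_Pop, of s a True w a False] Cons(2)[symmetric] by (simp add: eval_nat_numeral)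
  next
    case False
    then show ?thesis
      using exact_ChoiceR[OF stuck_Pop exact_Pop, of s a True a False w] Cons(2)[symmetric] by (simp add: eval_nat_numeral)
  qed
  have "exact (clear a) (s(a := w)) ((s(a := w))(a := [])) (6 * length ((s(a := w)) a) + 3)"
    by (rule Cons(1)) auto
  then have 2: "exact (clear a) (s(a := w)) (s(a := [])) (6 * length w + 3)" by simp
  have "exact (clear a) s (s(a := [])) (Suc (2 + (6 * length w + 3)))"
    unfolding clear_def by (rule exact_loop_step[OF 1 stuck_Empty 2[unfolded clear_def]]) (use Cons(2)[symmetric] in auto)
  then show ?case by (rule exact_mono) (use Cons(2)[symmetric] in auto)
qed

lemma exact_rdup:
  assumes "a \<noteq> b" "a \<noteq> c" "b \<noteq> c"
  shows "exact (rdup a b c) s (s(a := [], b := rev (s a) @ s b, c := rev (s a) @ s c)) (8 * length (s a) + 3)"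
proof (induction "s a" arbitrary: s)
  case Nil
  then have e: "s(a := [], b := rev (s a) @ s b, c := rev (s a) @ s c) = s" by auto
  show ?case unfolding rdup_def e
    by (rule exact_mono[OF exact_loop_stop[OF stuck_branch exact_Empty]]) (use Nil in auto)
next
  case (Cons x w)
  let ?s1 = "s(a := w, b := x # s b, c := x # s c)"
  have "exact (Push b x ;; Push c x) (s(a := w)) ?s1 3"
    using exact_Seq[OF exact_Push[of b x "s(a := w)"] exact_Push[of c x]] assms by (simp add: eval_nat_numeral)
  then have 1: "exact (Choice (Pop a True ;; (Push b True ;; Push c True)) (Pop a False ;; (Push b False ;; Push c False))) s ?s1 6"
    using exact_branch[where d = "\<lambda>x. Push b x ;; Push c x" and T = 3 and s = s and a = a, OF Cons(2)[symmetric]]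
    by (simp add: eval_nat_numeral)
  have "exact (rdup a b c) ?s1 (?s1(a := [], b := rev (?s1 a) @ ?s1 b, c := rev (?s1 a) @ ?s1 c)) (8 * length (?s1 a) + 3)"
    by (rule Cons(1)) (use assms in auto)
  moreover have "?s1(a := [], b := rev (?s1 a) @ ?s1 b, c := rev (?s1 a) @ ?s1 c) = s(a := [], b := rev (s a) @ s b, c := rev (s a) @ s c)"
    using assms Cons(2)[symmetric] by auto
  ultimately have 2: "exact (rdup a b c) ?s1 (s(a := [], b := rev (s a) @ s b, c := rev (s a) @ s c)) (8 * length w + 3)"
    using assms by simp
  have "exact (rdup a b c) s (s(a := [], b := rev (s a) @ s b, c := rev (s a) @ s c)) (Suc (6 + (8 * length w + 3)))"
    unfolding rdup_def by (rule exact_loop_step[OF 1 stuck_Empty 2[unfolded rdup_def]]) (use Cons(2)[symmetric] in auto)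
  then show ?case by (rule exact_mono) (use Cons(2)[symmetric] in auto)
qed

section \<open>Encoded types\<close>

text \<open>The end of the code has to be found without knowledge of \<open>w\<close>: an effective
  form of prefix-freeness. The piece read is kept, reversed, on stack 1. The time bound is linear so
  that the bounds for the parts of a list or pair add up.\<close>

definition parses :: "com \<Rightarrow> nat \<Rightarrow> ('a \<Rightarrow> bool list) \<Rightarrow> bool" where
  "parses c k e \<longleftrightarrow> (\<forall>s x w. s 0 = e x @ w \<longrightarrow>
     exact c s (s(0 := w, 1 := rev (e x) @ s 1)) (k * Suc (length (e x))))"

text \<open>Only codes of actual values may be guessed, so that later programs never meet a word
  that encodes nothing. Words are built from their end, since pushing adds symbols in front.\<close>

definition generates :: "com \<Rightarrow> nat \<Rightarrow> ('a \<Rightarrow> bool list) \<Rightarrow> bool" where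
  "generates c k e \<longleftrightarrow>
     (\<forall>s t s'. run c s t s' \<longrightarrow> (\<exists>x. s' = s(0 := e x @ s 0))) \<and>
     (\<forall>s x. \<exists>t \<le> k * Suc (length (e x)). run c s t (s(0 := e x @ s 0)))"

lemma generates_sound: "generates c k e \<Longrightarrow> run c s t s' \<Longrightarrow> \<exists>x. s' = s(0 := e x @ s 0)"
  unfolding generates_def by blast

lemma generates_complete: "generates c k e \<Longrightarrow> \<exists>t \<le> k * Suc (length (e x)). run c s t (s(0 := e x @ s 0))"
  unfolding generates_def by blast

class codable =
  fixes encode :: "'a \<Rightarrow> bool list"
  assumes parser_exists: "\<exists>c k. parses c k encode"
    and generator_exists: "\<exists>c k. generates c k encode"

abbreviation code_size :: "'a::codable \<Rightarrow> nat" where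
  "code_size x \<equiv> length (encode x)"

lemma parsesD: "parses c k e \<Longrightarrow> s 0 = e x @ w \<Longrightarrow>
   exact c s (s(0 := w, 1 := rev (e x) @ s 1)) (k * Suc (length (e x)))"
  unfolding parses_def by blast

lemma parses_bit: "parses (Choice (Pop 0 True ;; Push 1 True) (Pop 0 False ;; Push 1 False)) 4 (\<lambda>b. [b])"
  unfolding parses_def
proof (intro allI impI)
  fix s :: store and x w assume s: "s 0 = [x] @ w"
  show "exact (Choice (Pop 0 True ;; Push 1 True) (Pop 0 False ;; Push 1 False)) s
    (s(0 := w, 1 := rev [x] @ s 1)) (4 * Suc (length [x]))"
    using exact_branch[of s 0 x w "Push 1" "s(0 := w, 1 := x # s 1)" 1] s exact_Push[of 1 x "s(0 := w)"]
    by (auto intro: exact_mono)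
qed

lemma generates_bit: "generates (Choice (Push 0 True) (Push 0 False)) 4 (\<lambda>b. [b])"
  unfolding generates_def
proof (intro conjI allI impI)
  fix s :: store and x :: bool
  have "run (Choice (Push 0 True) (Push 0 False)) s 2 (s(0 := [x] @ s 0))"
    by (cases x) (use run_ChoiceL[OF run_Push[of 0 True s]] run_ChoiceR[OF run_Push[of 0 False s]] in \<open>auto simp: eval_nat_numeral\<close>)
  then show "\<exists>t\<le>4 * Suc (length [x]). run (Choice (Push 0 True) (Push 0 False)) s t (s(0 := [x] @ s 0))"
    by (intro exI[of _ 2]) auto
next
  fix s t s' assume "run (Choice (Push 0 True) (Push 0 False)) s t s'"
  then show "\<exists>x. s' = s(0 := [x] @ s 0)" by auto
qed

lemma enc_list_simps [simp]:
  "enc_list e [] = [False]"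
  "enc_list e (x # xs) = True # e x @ enc_list e xs"
  by (auto simp: enc_list_def)

lemma parses_list:
  assumes "parses c k e"
  shows "parses (Star (Pop 0 True ;; (Push 1 True ;; c)) ;; (Pop 0 False ;; Push 1 False)) (k + 8) (enc_list e)"
  unfolding parses_def
proof (intro allI impI)
  fix s :: store and xs w
  let ?L = "Star (Pop 0 True ;; (Push 1 True ;; c)) ;; (Pop 0 False ;; Push 1 False)"
  show "s 0 = enc_list e xs @ w \<Longrightarrow> exact ?L s (s(0 := w, 1 := rev (enc_list e xs) @ s 1)) ((k + 8) * Suc (length (enc_list e xs)))"
  proof (induction xs arbitrary: s)
    case Nil
    then have s0: "s 0 = False # w" by simp
    have 1: "exact (Pop 0 False ;; Push 1 False) s (s(0 := w, 1 := False # s 1)) 3"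
      using exact_Seq[OF exact_Pop[of s 0, OF s0] exact_Push[of 1 False]] by (simp add: eval_nat_numeral)
    have 2: "stuck (Pop 0 True ;; (Push 1 True ;; c)) s"
      by (intro stuck_Seq stuck_Pop) (use s0 in auto)
    have e: "s(0 := w, 1 := rev (enc_list e []) @ s 1) = s(0 := w, 1 := False # s 1)" by simp
    show ?case unfolding e by (rule exact_mono[OF exact_loop_stop[OF 2 1]]) simp
  next
    case (Cons x xs)
    then have s0: "s 0 = True # e x @ enc_list e xs @ w" by simp
    let ?s1 = "s(0 := e x @ enc_list e xs @ w, 1 := True # s 1)"
    let ?s2 = "s(0 := enc_list e xs @ w, 1 := rev (e x) @ True # s 1)"
    have p: "exact c ?s1 (?s1(0 := enc_list e xs @ w, 1 := rev (e x) @ ?s1 1)) (k * Suc (length (e x)))"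
      by (rule parsesD[OF assms]) simp
    moreover have "?s1(0 := enc_list e xs @ w, 1 := rev (e x) @ ?s1 1) = ?s2" by auto
    ultimately have p: "exact c ?s1 ?s2 (k * Suc (length (e x)))" by simp
    have "exact (Push 1 True) (s(0 := e x @ enc_list e xs @ w)) ?s1 1"
      using exact_Push[of 1 True "s(0 := e x @ enc_list e xs @ w)"] by simp
    from exact_Seq[OF exact_Pop[of s 0, OF s0] exact_Seq[OF this p]]
    have 1: "exact (Pop 0 True ;; (Push 1 True ;; c)) s ?s2 (k * Suc (length (e x)) + 4)"
      by (auto intro: exact_mono)
    have 2: "stuck (Pop 0 False ;; Push 1 False) s"
      by (intro stuck_Seq stuck_Pop) (use s0 in auto)
    have "exact ?L ?s2 (?s2(0 := w, 1 := rev (enc_list e xs) @ ?s2 1)) ((k + 8) * Suc (length (enc_list e xs)))"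
      by (rule Cons.IH) simp
    moreover have "?s2(0 := w, 1 := rev (enc_list e xs) @ ?s2 1) = s(0 := w, 1 := rev (enc_list e (x # xs)) @ s 1)"
      by auto
    ultimately have 3: "exact ?L ?s2 (s(0 := w, 1 := rev (enc_list e (x # xs)) @ s 1)) ((k + 8) * Suc (length (enc_list e xs)))"
      by simp
    show ?case by (rule exact_mono[OF exact_loop_step[OF 1 2 3]]) (simp add: algebra_simps)
  qed
qed

lemma generates_list:
  assumes "generates c k e"
  shows "generates (Push 0 False ;; Star (c ;; Push 0 True)) (k + 8) (enc_list e)"
  unfolding generates_def
proof (intro conjI allI impI)
  fix s t s'
  have star: "run C s t s' \<Longrightarrow> C = Star (c ;; Push 0 True) \<Longrightarrow> s 0 = enc_list e xs @ w \<Longrightarrow>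
      \<exists>ys. s' = s(0 := enc_list e ys @ w)" for C s t s' xs w
  proof (induction arbitrary: xs rule: run.induct)
    case (run_Star_stop c s)
    then show ?case by (intro exI[of _ xs]) auto
  next
    case (run_Star_step c' s t s' t' s'')
    then obtain t1 s1 where 1: "run c s t1 s1" "s' = s1(0 := True # s1 0)" by auto
    then obtain x where "s1 = s(0 := e x @ s 0)" using assms unfolding generates_def by blast
    then have "s' = s(0 := enc_list e (x # xs) @ w)" using 1 run_Star_step.prems by simp
    moreover from this have "s' 0 = enc_list e (x # xs) @ w" by simp
    from run_Star_step.IH(2)[OF run_Star_step.prems(1) this]
    obtain ys where "s'' = s'(0 := enc_list e ys @ w)" by (rule exE)
    ultimately show ?case by auto
  qed auto
  assume "run (Push 0 False ;; Star (c ;; Push 0 True)) s t s'"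
  then obtain t where "run (Star (c ;; Push 0 True)) (s(0 := False # s 0)) t s'" by auto
  from star[OF this refl, of "[]" "s 0"] show "\<exists>x. s' = s(0 := enc_list e x @ s 0)" by auto
next
  fix s :: store and xs
  \<comment> \<open>The induction extends a given run backwards: the state with
    \<open>x # xs\<close> on the stack is preceded by the iteration that generated
    \<open>x\<close>.\<close>
  have star: "run (Star (c ;; Push 0 True)) (s(0 := enc_list e xs @ w)) t s' \<Longrightarrow>
     \<exists>t2 \<le> t + (k + 8) * length (enc_list e xs). run (Star (c ;; Push 0 True)) (s(0 := False # w)) t2 s'" for s t s' w
  proof (induction xs arbitrary: t)
    case Nil
    then show ?case by (intro exI[of _ t]) auto
  next
    case (Cons x xs)
    let ?s = "s(0 := enc_list e xs @ w)"
    obtain t1 where t1: "t1 \<le> k * Suc (length (e x))" "run c ?s t1 (?s(0 := e x @ ?s 0))"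
      using generates_complete[OF assms, of x ?s] by blast
    have "run (c ;; Push 0 True) ?s (Suc (t1 + 1)) ((?s(0 := e x @ ?s 0))(0 := True # (?s(0 := e x @ ?s 0)) 0))"
      by (rule run_Seq[OF t1(2) run_Push])
    moreover have "(?s(0 := e x @ ?s 0))(0 := True # (?s(0 := e x @ ?s 0)) 0) = s(0 := enc_list e (x # xs) @ w)"
      by simp
    ultimately have "run (c ;; Push 0 True) ?s (Suc (t1 + 1)) (s(0 := enc_list e (x # xs) @ w))" by metis
    from Cons.IH[OF run_Star_step[OF this Cons.prems]] obtain t2 where
      "t2 \<le> Suc (Suc (t1 + 1) + t) + (k + 8) * length (enc_list e xs)"
      "run (Star (c ;; Push 0 True)) (s(0 := False # w)) t2 s'" by blast
    moreover from this(1) t1(1) have "t2 \<le> t + (k + 8) * length (enc_list e (x # xs))"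
      by (simp add: algebra_simps)
    ultimately show ?case by blast
  qed
  have "run (Star (c ;; Push 0 True)) (s(0 := enc_list e xs @ s 0)) 1 (s(0 := enc_list e xs @ s 0))"
    by (rule run_Star_stop)
  from star[OF this] obtain t2 where t2: "t2 \<le> 1 + (k + 8) * length (enc_list e xs)"
    "run (Star (c ;; Push 0 True)) (s(0 := False # s 0)) t2 (s(0 := enc_list e xs @ s 0))" by blast
  have "run (Push 0 False ;; Star (c ;; Push 0 True)) s (Suc (1 + t2)) (s(0 := enc_list e xs @ s 0))"
    by (rule run_Seq[OF run_Push t2(2)])
  then show "\<exists>t\<le>(k + 8) * Suc (length (enc_list e xs)).
    run (Push 0 False ;; Star (c ;; Push 0 True)) s t (s(0 := enc_list e xs @ s 0))"
    using t2(1) by (intro exI[of _ "Suc (1 + t2)"]) auto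
qed

instantiation bool :: codable
begin
definition encode_bool :: "bool \<Rightarrow> bool list" where "encode_bool b = [b]"
instance
proof
  have "encode = (\<lambda>b. [b])" by (simp add: encode_bool_def fun_eq_iff)
  then have "parses (Choice (Pop 0 True ;; Push 1 True) (Pop 0 False ;; Push 1 False)) 4 (encode :: bool \<Rightarrow> _)"
    "generates (Choice (Push 0 True) (Push 0 False)) 4 (encode :: bool \<Rightarrow> _)"
    using parses_bit generates_bit by simp_all
  then show "\<exists>c k. parses c k (encode :: bool \<Rightarrow> _)" "\<exists>c k. generates c k (encode :: bool \<Rightarrow> _)"
    by blast+
qed
end

instantiation unit :: codable
begin
definition encode_unit :: "unit \<Rightarrow> bool list" where "encode_unit b = []"
instance
proof
  have "parses Skip 1 (encode :: unit \<Rightarrow> _)"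
    by (auto simp: parses_def encode_unit_def fun_upd_idem intro: exact_mono[OF exact_Skip])
  then show "\<exists>c k. parses c k (encode :: unit \<Rightarrow> _)" by blast
  have "generates Skip 1 (encode :: unit \<Rightarrow> _)"
    by (auto simp: generates_def encode_unit_def intro: run_Skip[simplified])
  then show "\<exists>c k. generates c k (encode :: unit \<Rightarrow> _)" by blast
qed
end

instantiation list :: (codable) codable
begin
definition encode_list :: "'a list \<Rightarrow> bool list" where "encode_list = enc_list encode"
instance
proof
  obtain c k d l where "parses c k (encode :: 'a \<Rightarrow> _)" "generates d l (encode :: 'a \<Rightarrow> _)"
    using parser_exists generator_exists by blast
  from parses_list[OF this(1)] generates_list[OF this(2)]
  show "\<exists>c k. parses c k (encode :: 'a list \<Rightarrow> _)" "\<exists>c k. generates c k (encode :: 'a list \<Rightarrow> _)"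
    unfolding encode_list_def by blast+
qed
end

instantiation prod :: (codable, codable) codable
begin
definition encode_prod :: "'a \<times> 'b \<Rightarrow> bool list" where
  "encode_prod p = encode (fst p) @ encode (snd p)"
instance
proof
  obtain c k where c: "parses c k (encode :: 'a \<Rightarrow> _)" using parser_exists by blast
  obtain d l where d: "parses d l (encode :: 'b \<Rightarrow> _)" using parser_exists by blast
  have "parses (c ;; d) (k + l + 1) (encode :: 'a \<times> 'b \<Rightarrow> _)"
    unfolding parses_def
  proof (intro allI impI)
    fix s :: store and p :: "'a \<times> 'b" and w assume s: "s 0 = encode p @ w"
    obtain x y where p: "p = (x, y)" by (cases p)
    have 1: "exact c s (s(0 := encode y @ w, 1 := rev (encode x) @ s 1)) (k * Suc (code_size x))"
      by (rule parsesD[OF c]) (simp add: s p encode_prod_def)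
    let ?s = "s(0 := encode y @ w, 1 := rev (encode x) @ s 1)"
    have 2: "exact d ?s (?s(0 := w, 1 := rev (encode y) @ ?s 1)) (l * Suc (code_size y))"
      by (rule parsesD[OF d]) simp
    have e: "?s(0 := w, 1 := rev (encode y) @ ?s 1) = s(0 := w, 1 := rev (encode p) @ s 1)"
      by (auto simp: p encode_prod_def)
    show "exact (c ;; d) s (s(0 := w, 1 := rev (encode p) @ s 1)) ((k + l + 1) * Suc (length (encode p)))"
      by (rule exact_mono[OF exact_Seq[OF 1 2[unfolded e]]]) (simp add: p encode_prod_def algebra_simps)
  qed
  then show "\<exists>c k. parses c k (encode :: 'a \<times> 'b \<Rightarrow> _)" by blast
  obtain c k where c: "generates c k (encode :: 'a \<Rightarrow> _)" using generator_exists by blast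
  obtain d l where d: "generates d l (encode :: 'b \<Rightarrow> _)" using generator_exists by blast
  have "generates (d ;; c) (k + l + 1) (encode :: 'a \<times> 'b \<Rightarrow> _)"
    unfolding generates_def
  proof (intro conjI allI impI)
    fix s t s' assume "run (d ;; c) s t s'"
    then obtain t1 t2 s1 where 1: "run d s t1 s1" "run c s1 t2 s'" by blast
    obtain y where "s1 = s(0 := encode (y :: 'b) @ s 0)" using generates_sound[OF d 1(1)] by (rule exE)
    moreover obtain x where "s' = s1(0 := encode (x :: 'a) @ s1 0)" using generates_sound[OF c 1(2)] by (rule exE)
    ultimately show "\<exists>p. s' = s(0 := encode (p :: 'a \<times> 'b) @ s 0)"
      by (intro exI[of _ "(x, y)"]) (simp add: encode_prod_def)
  next
    fix s :: store and p :: "'a \<times> 'b"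
    obtain x y where p: "p = (x, y)" by (cases p)
    let ?s = "s(0 := encode y @ s 0)"
    obtain t1 where 1: "t1 \<le> l * Suc (code_size y)" "run d s t1 ?s" using generates_complete[OF d, of y s] by blast
    obtain t2 where 2: "t2 \<le> k * Suc (code_size x)" "run c ?s t2 (?s(0 := encode x @ ?s 0))"
      using generates_complete[OF c, of x ?s] by blast
    have e: "?s(0 := encode x @ ?s 0) = s(0 := encode p @ s 0)" by (simp add: p encode_prod_def)
    have "run (d ;; c) s (Suc (t1 + t2)) (s(0 := encode p @ s 0))"
      using run_Seq[OF 1(2) 2(2)] unfolding e .
    moreover have "Suc (t1 + t2) \<le> (k + l + 1) * Suc (length (encode p))"
      using 1(1) 2(1) by (simp add: p encode_prod_def algebra_simps)
    ultimately show "\<exists>t\<le>(k + l + 1) * Suc (length (encode p)). run (d ;; c) s t (s(0 := encode p @ s 0))"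
      by (intro exI[of _ "Suc (t1 + t2)"] conjI)
  qed
  then show "\<exists>c k. generates c k (encode :: 'a \<times> 'b \<Rightarrow> _)" by blast
qed
end

text \<open>The leading bit of a positive number is pushed first, so that only canonical codes are generated.\<close>

instantiation nat :: codable
begin
definition encode_nat :: "nat \<Rightarrow> bool list" where "encode_nat = enc_nat"

lemma encode_nat_0: "encode (0 :: nat) = [False]"
  by (simp add: encode_nat_def enc_nat_def bits.simps)

lemma encode_nat_pos: "n > 0 \<Longrightarrow> encode (n :: nat) = True # odd n # encode (n div 2)"
  by (subst encode_nat_def, subst enc_nat_def, subst bits.simps) (simp add: encode_nat_def enc_nat_def)

instance
proof
  have "parses c k (encode :: nat \<Rightarrow> _)" if "parses c k (enc_list (\<lambda>b. [b]))" for c k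
    using that unfolding parses_def encode_nat_def enc_nat_def by blast
  then show "\<exists>c k. parses c k (encode :: nat \<Rightarrow> _)" using parses_list[OF parses_bit] by blast
  let ?B = "Choice (Push 0 True) (Push 0 False) ;; Push 0 True"
  \<comment> \<open>Pushing \<open>False\<close>, \<open>True\<close>, \<open>True\<close> yields
    the code of 1. Each further round adds a lower digit, turning \<open>n\<close> into
    \<open>2 * n\<close> or \<open>2 * n + 1\<close>.\<close>
  let ?G = "Push 0 False ;; Choice Skip (Push 0 True ;; (Push 0 True ;; Star ?B))"
  have "generates ?G 12 (encode :: nat \<Rightarrow> _)"
    unfolding generates_def
  proof (intro conjI allI impI)
    fix s t s'
    have star: "run C s t s' \<Longrightarrow> C = Star ?B \<Longrightarrow> n > 0 \<Longrightarrow> s 0 = encode n @ w \<Longrightarrow>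
        \<exists>m :: nat. s' = s(0 := encode m @ w)" for C s t s' w and n :: nat
    proof (induction arbitrary: n rule: run.induct)
      case (run_Star_stop c s)
      then show ?case by (intro exI[of _ n]) auto
    next
      case (run_Star_step c' s t s' t' s'')
      then obtain x where "s' = s(0 := True # x # s 0)" by auto
      moreover have "encode (2 * n + of_bool x) = True # x # encode n"
        using run_Star_step.prems by (subst encode_nat_pos) auto
      ultimately have s': "s' = s(0 := encode (2 * n + of_bool x) @ w)" using run_Star_step.prems by simp
      then have "s' 0 = encode (2 * n + of_bool x) @ w" by simp
      moreover have "2 * n + of_bool x > 0" using run_Star_step.prems by simp
      ultimately have "\<exists>m :: nat. s'' = s'(0 := encode m @ w)"
        by (intro run_Star_step.IH(2)[OF run_Star_step.prems(1)])
      then obtain m :: nat where "s'' = s'(0 := encode m @ w)" by (rule exE)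
      then show ?case unfolding s' by auto
    qed auto
    assume "run ?G s t s'"
    then consider "s' = s(0 := False # s 0)"
      | t where "run (Star ?B) (s(0 := True # True # False # s 0)) t s'" by fastforce
    then show "\<exists>x :: nat. s' = s(0 := encode x @ s 0)"
    proof cases
      case 1 then show ?thesis by (intro exI[of _ 0]) (simp add: encode_nat_0)
    next
      case 2
      from star[OF 2 refl, of 1 "s 0"] show ?thesis by (simp add: encode_nat_pos encode_nat_0)
    qed
  next
    fix s :: store and n :: nat
    have star: "n > 0 \<Longrightarrow> run (Star ?B) (s(0 := encode n @ w)) t s' \<Longrightarrow>
       \<exists>t2 \<le> t + 6 * length (encode n). run (Star ?B) (s(0 := True # True # False # w)) t2 s'" for s t s' w
    proof (induction n arbitrary: t rule: less_induct)
      case (less n)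
      show ?case
      proof (cases "n = 1")
        case True
        then show ?thesis using less.prems by (intro exI[of _ t]) (auto simp: encode_nat_pos encode_nat_0)
      next
        case False
        then have pos: "n div 2 > 0" using less.prems by auto
        let ?s = "s(0 := encode (n div 2) @ w)"
        have "run (Choice (Push 0 True) (Push 0 False)) ?s 2 (?s(0 := odd n # ?s 0))"
          by (cases "odd n") (use run_ChoiceL[OF run_Push[of 0 True ?s]] run_ChoiceR[OF run_Push[of 0 False ?s]] in \<open>auto simp: eval_nat_numeral\<close>)
        from run_Seq[OF this run_Push[of 0 True]]
        have "run ?B ?s 4 (?s(0 := True # odd n # ?s 0))" by (simp add: eval_nat_numeral)
        moreover have "?s(0 := True # odd n # ?s 0) = s(0 := encode n @ w)"
          using less.prems by (simp add: encode_nat_pos)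
        ultimately have "run ?B ?s 4 (s(0 := encode n @ w))" by metis
        note r = run_Star_step[OF this less.prems(2)]
        have "n div 2 < n" using less.prems(1) by simp
        from less.IH[OF this pos r] obtain t2 where
          "t2 \<le> Suc (4 + t) + 6 * length (encode (n div 2))"
          "run (Star ?B) (s(0 := True # True # False # w)) t2 s'" by (elim exE conjE)
        moreover from this(1) have "t2 \<le> t + 6 * length (encode n)"
          using less.prems(1) by (simp add: encode_nat_pos)
        ultimately show ?thesis by (intro exI[of _ t2] conjI)
      qed
    qed
    show "\<exists>t\<le>12 * Suc (length (encode n)). run ?G s t (s(0 := encode n @ s 0))"
    proof (cases "n = 0")
      case True
      have "run ?G s 4 (s(0 := False # s 0))"
        using run_Seq[OF run_Push[of 0 False s] run_ChoiceL[OF run_Skip]] by (simp add: eval_nat_numeral)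
      then show ?thesis using True by (intro exI[of _ 4]) (auto simp: encode_nat_0)
    next
      case False
      have "run (Star ?B) (s(0 := encode n @ s 0)) 1 (s(0 := encode n @ s 0))"
        by (rule run_Star_stop)
      from star[OF _ this] False obtain t2 where t2: "t2 \<le> 1 + 6 * length (encode n)"
        "run (Star ?B) (s(0 := True # True # False # s 0)) t2 (s(0 := encode n @ s 0))" by auto
      have "run (Push 0 True ;; (Push 0 True ;; Star ?B)) (s(0 := False # s 0)) (t2 + 4) (s(0 := encode n @ s 0))"
        using run_Seq[OF run_Push[of 0 True "s(0 := False # s 0)"] run_Seq[OF run_Push[of 0 True] _]] t2(2)
        by (fastforce simp: eval_nat_numeral)
      from run_Seq[OF run_Push[of 0 False s] run_ChoiceR[OF this]]
      have "run ?G s (t2 + 7) (s(0 := encode n @ s 0))" by (simp add: eval_nat_numeral)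
      then show ?thesis using t2(1) by (intro exI[of _ "t2 + 7"]) auto
    qed
  qed
  then show "\<exists>c k. generates c k (encode :: nat \<Rightarrow> _)" by blast
qed
end

section \<open>Polynomial bounds\<close>

text \<open>The base is at least 2, so constants and sums are absorbed by a larger exponent and a
  single number \<open>k\<close> describes the bound.\<close>

definition poly_bounded :: "('i \<Rightarrow> nat) \<Rightarrow> ('i \<Rightarrow> nat) \<Rightarrow> bool" where
  "poly_bounded f g \<longleftrightarrow> (\<exists>k. \<forall>i. f i \<le> (g i + 2) ^ k)"

lemma poly_boundedI: "(\<And>i. f i \<le> (g i + 2) ^ k) \<Longrightarrow> poly_bounded f g"
  unfolding poly_bounded_def by blast

lemma pb_mono: "poly_bounded f g \<Longrightarrow> (\<And>i. f' i \<le> f i) \<Longrightarrow> poly_bounded f' g"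
  unfolding poly_bounded_def using le_trans by blast

lemma pb_self: "poly_bounded g g"
  by (rule poly_boundedI[of _ _ 1]) simp

lemma pb_le: "(\<And>i. f i \<le> g i) \<Longrightarrow> poly_bounded f g"
  by (rule pb_mono[OF pb_self])

lemma pb_const: "poly_bounded (\<lambda>i. c) g"
proof (rule poly_boundedI[of _ _ c])
  fix i
  have "c \<le> 2 ^ c" by (rule less_imp_le) (rule less_exp)
  also have "\<dots> \<le> (g i + 2) ^ c" by (rule power_mono) auto
  finally show "c \<le> (g i + 2) ^ c" .
qed

lemma pb_mult:
  assumes "poly_bounded f g" "poly_bounded f' g"
  shows "poly_bounded (\<lambda>i. f i * f' i) g"
proof -
  obtain k k' where "\<And>i. f i \<le> (g i + 2) ^ k" "\<And>i. f' i \<le> (g i + 2) ^ k'"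
    using assms unfolding poly_bounded_def by blast
  then have "f i * f' i \<le> (g i + 2) ^ (k + k')" for i
    unfolding power_add by (rule mult_le_mono)
  then show ?thesis by (rule poly_boundedI)
qed

lemma pb_add:
  assumes "poly_bounded f g" "poly_bounded f' g"
  shows "poly_bounded (\<lambda>i. f i + f' i) g"
proof (rule pb_mono)
  have S: "poly_bounded (\<lambda>i. f i + 1) g" if f: "poly_bounded f g" for f
  proof -
    obtain k where k: "\<And>i. f i \<le> (g i + 2) ^ k" using f unfolding poly_bounded_def by blast
    have "f i + 1 \<le> (g i + 2) ^ Suc k" for i
    proof -
      have "f i + 1 \<le> (g i + 2) ^ k + (g i + 2) ^ k"
        using k[of i] by (intro add_mono) auto
      also have "\<dots> \<le> (g i + 2) ^ Suc k" by simp
      finally show ?thesis .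
    qed
    then show ?thesis by (rule poly_boundedI)
  qed
  \<comment> \<open>A sum is at most the product of the successors of its terms, which reduces
    addition to \<open>pb_mult\<close>.\<close>
  show "poly_bounded (\<lambda>i. (f i + 1) * (f' i + 1)) g"
    by (rule pb_mult[OF S[OF assms(1)] S[OF assms(2)]])
qed simp

lemma pb_power: "poly_bounded f g \<Longrightarrow> poly_bounded (\<lambda>i. f i ^ k) g"
proof (induction k)
  case 0 then show ?case using pb_const[of 1] by simp
next
  case (Suc k) then show ?case using pb_mult by simp
qed

lemma pb_trans:
  assumes "poly_bounded f h" "poly_bounded h g"
  shows "poly_bounded f g"
proof -
  obtain k where k: "\<And>i. f i \<le> (h i + 2) ^ k" using assms(1) unfolding poly_bounded_def by blast
  have "poly_bounded (\<lambda>i. (h i + 2) ^ k) g"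
    by (intro pb_power pb_add pb_const assms(2))
  then show ?thesis using k by (rule pb_mono)
qed

lemma pb_compose: "poly_bounded f g \<Longrightarrow> poly_bounded (\<lambda>i. f (h i)) (\<lambda>i. g (h i))"
  unfolding poly_bounded_def by blast

section \<open>Nondeterministic polynomial-time relations\<close>

text \<open>The time may depend on the output because a relation may guess an output much longer
  than its input. Soundness concerns all finished runs, efficiency only one run for each related
  pair.\<close>

definition implements :: "com \<Rightarrow> nat \<Rightarrow> ('a::codable \<Rightarrow> 'b::codable \<Rightarrow> bool) \<Rightarrow> bool" where
  "implements c k R \<longleftrightarrow>
     (\<forall>x t s'. run c (clean (encode x)) t s' \<longrightarrow> (\<exists>y. R x y \<and> s' = clean (encode y))) \<and>
     (\<forall>x y. R x y \<longrightarrow> (\<exists>t \<le> (code_size x + code_size y + 2) ^ k. run c (clean (encode x)) t (clean (encode y))))"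

definition npr :: "('a::codable \<Rightarrow> 'b::codable \<Rightarrow> bool) \<Rightarrow> bool" where
  "npr R \<longleftrightarrow> (\<exists>c k. implements c k R)"

definition small_output :: "('a::codable \<Rightarrow> 'b::codable \<Rightarrow> bool) \<Rightarrow> bool" where
  "small_output R \<longleftrightarrow> (\<exists>k. \<forall>x y. R x y \<longrightarrow> code_size y \<le> (code_size x + 2) ^ k)"

text \<open>Nondeterministic but single-valued computation. The size bound makes such functions
  composable, since running times are measured against the output too.\<close>

definition fp :: "('a::codable \<Rightarrow> 'b::codable) \<Rightarrow> bool" where
  "fp f \<longleftrightarrow> npr (\<lambda>x y. y = f x) \<and> poly_bounded (\<lambda>x. code_size (f x)) code_size"

text \<open>Acceptance as a relation into \<open>unit\<close>, whose code is empty; so predicates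
  are combined by the same closure properties as relations.\<close>

definition np :: "('a::codable \<Rightarrow> bool) \<Rightarrow> bool" where
  "np P \<longleftrightarrow> npr (\<lambda>x (u :: unit). P x)"

lemma implements_sound:
  "implements c k R \<Longrightarrow> run c (clean (encode x)) t s' \<Longrightarrow> \<exists>y. R x y \<and> s' = clean (encode y)"
  unfolding implements_def by blast

lemma implements_complete:
  "implements c k R \<Longrightarrow> R x y \<Longrightarrow> \<exists>t \<le> (code_size x + code_size y + 2) ^ k. run c (clean (encode x)) t (clean (encode y))"
  unfolding implements_def by blast

lemma nprI:
  assumes "\<And>x t s'. run c (clean (encode x)) t s' \<Longrightarrow> \<exists>y. R x y \<and> s' = clean (encode y)"
    and "\<And>x y. R x y \<Longrightarrow> \<exists>t \<le> T (x, y). run c (clean (encode x)) t (clean (encode y))"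
    and "poly_bounded T (\<lambda>(x, y). code_size x + code_size y)"
  shows "npr R"
proof -
  obtain k where k: "\<And>p. T p \<le> ((\<lambda>(x, y). code_size x + code_size y) p + 2) ^ k"
    using assms(3) unfolding poly_bounded_def by blast
  have "\<exists>t \<le> (code_size x + code_size y + 2) ^ k. run c (clean (encode x)) t (clean (encode y))" if R: "R x y" for x y
  proof -
    obtain t where "t \<le> T (x, y)" "run c (clean (encode x)) t (clean (encode y))" using assms(2)[OF R] by blast
    with k[of "(x, y)"] show ?thesis by (intro exI[of _ t]) auto
  qed
  with assms(1) have "implements c k R" unfolding implements_def by simp
  then show ?thesis unfolding npr_def by blast
qed

lemma nprI_exact:
  fixes f :: "'a::codable \<Rightarrow> 'b::codable"
  assumes "\<And>x. exact c (clean (encode x)) (clean (encode (f x))) (T x)"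
    and "poly_bounded T code_size"
  shows "npr (\<lambda>x y. y = f x)"
proof (rule nprI[where c = c and T = "\<lambda>p. T (fst p)"])
  fix x :: 'a and t s' assume "run c (clean (encode x)) t s'"
  then show "\<exists>y. y = f x \<and> s' = clean (encode y)" using exact_runD[OF assms(1)] by simp
next
  fix x y assume "y = f x"
  then show "\<exists>t\<le>T (fst (x, y)). run c (clean (encode x)) t (clean (encode y))"
    using assms(1)[of x] unfolding exact_def by simp
next
  have "poly_bounded (\<lambda>p. code_size (fst p)) (\<lambda>(x :: 'a, y :: 'b). code_size x + code_size y)"
    by (rule pb_le) auto
  with pb_compose[OF assms(2)] show "poly_bounded (\<lambda>p. T (fst p)) (\<lambda>(x :: 'a, y :: 'b). code_size x + code_size y)"
    by (rule pb_trans)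
qed

lemma npr_cong: "npr R \<Longrightarrow> (\<And>x y. R x y \<longleftrightarrow> S x y) \<Longrightarrow> npr S"
  by (subgoal_tac "R = S") (auto simp: fun_eq_iff)

lemma small_outputI:
  assumes "\<And>x y. R x y \<Longrightarrow> code_size y \<le> f x" "poly_bounded f code_size"
  shows "small_output R"
proof -
  obtain k where "\<And>x. f x \<le> (code_size x + 2) ^ k" using assms(2) unfolding poly_bounded_def by blast
  then have "R x y \<Longrightarrow> code_size y \<le> (code_size x + 2) ^ k" for x y using assms(1) le_trans by metis
  then show ?thesis unfolding small_output_def by (intro exI[of _ k] allI impI)
qed

lemma small_output_fp: "fp f \<Longrightarrow> small_output (\<lambda>x y. y = f x)"
  unfolding fp_def by (rule small_outputI[of _ "\<lambda>x. code_size (f x)"]) auto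

lemma small_output_unit: "small_output (\<lambda>x (u :: unit). P x)"
  by (rule small_outputI[of _ "\<lambda>x. 0"]) (auto simp: encode_unit_def intro: pb_const)

lemma fpI: "npr (\<lambda>x y. y = f x) \<Longrightarrow> poly_bounded (\<lambda>x. code_size (f x)) code_size \<Longrightarrow> fp f"
  unfolding fp_def by blast

text \<open>Soundness needs no bound on the intermediate value \<open>y\<close>. For the existence
  of a short run one small value is enough, so \<open>bound\<close> asks for some small
  \<open>y'\<close> that links the same \<open>x\<close> and \<open>z\<close>.\<close>

lemma npr_compose:
  fixes R :: "'a::codable \<Rightarrow> 'b::codable \<Rightarrow> bool" and S :: "'b \<Rightarrow> 'c::codable \<Rightarrow> bool"
  assumes "npr R" "npr S"
    and bound: "\<And>x y z. R x y \<Longrightarrow> S y z \<Longrightarrow> \<exists>y'. R x y' \<and> S y' z \<and> code_size y' \<le> B (x, z)"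
    and B: "poly_bounded B (\<lambda>(x, z). code_size x + code_size z)"
  shows "npr (\<lambda>x z. \<exists>y. R x y \<and> S y z)"
proof -
  obtain c k where c: "implements c k R" using assms(1) unfolding npr_def by blast
  obtain d l where d: "implements d l S" using assms(2) unfolding npr_def by blast
  let ?g = "\<lambda>(x, z). code_size x + code_size z"
  let ?T = "\<lambda>p. Suc ((code_size (fst p) + B p + 2) ^ k + (B p + code_size (snd p) + 2) ^ l)"
  show ?thesis
  proof (rule nprI[where c = "c ;; d" and T = ?T])
    fix x :: 'a and t s' assume "run (c ;; d) (clean (encode x)) t s'"
    then obtain t1 t2 s1 where 1: "run c (clean (encode x)) t1 s1" "run d s1 t2 s'" by blast
    from implements_sound[OF c 1(1)] obtain y where y: "R x y" "s1 = clean (encode y)" by blast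
    from implements_sound[OF d 1(2)[unfolded y(2)]] obtain z where "S y z" "s' = clean (encode z)" by blast
    with y(1) show "\<exists>z. (\<exists>y. R x y \<and> S y z) \<and> s' = clean (encode z)" by (intro exI[of _ z] conjI exI[of _ y])
  next
    fix x :: 'a and z :: 'c assume "\<exists>y. R x y \<and> S y z"
    then obtain y0 where "R x y0" "S y0 z" by blast
    from bound[OF this] obtain y where y: "R x y" "S y z" "code_size y \<le> B (x, z)" by blast
    from implements_complete[OF c y(1)] obtain t1 where t1:
      "t1 \<le> (code_size x + code_size y + 2) ^ k" "run c (clean (encode x)) t1 (clean (encode y))" by blast
    from implements_complete[OF d y(2)] obtain t2 where t2:
      "t2 \<le> (code_size y + code_size z + 2) ^ l" "run d (clean (encode y)) t2 (clean (encode z))" by blast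
    have "(code_size x + code_size y + 2) ^ k \<le> (code_size x + B (x, z) + 2) ^ k"
      "(code_size y + code_size z + 2) ^ l \<le> (B (x, z) + code_size z + 2) ^ l"
      using y(3) by (auto intro: power_mono)
    with t1 t2 have "Suc (t1 + t2) \<le> ?T (x, z)" by simp
    then show "\<exists>t\<le>?T (x, z). run (c ;; d) (clean (encode x)) t (clean (encode z))"
      by (intro exI[of _ "Suc (t1 + t2)"] conjI run_Seq[OF t1(2) t2(2)])
  next
    have 1: "poly_bounded (\<lambda>p. code_size (fst p)) ?g" by (rule pb_le) auto
    have 2: "poly_bounded (\<lambda>p. code_size (snd p)) ?g" by (rule pb_le) auto
    have "poly_bounded (\<lambda>p. 1 + ((code_size (fst p) + B p + 2) ^ k + (B p + code_size (snd p) + 2) ^ l)) ?g"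
      by (intro pb_add pb_const pb_power B 1 2)
    then show "poly_bounded ?T ?g" by simp
  qed
qed

lemma npr_compose_small:
  assumes "npr R" "small_output R" "npr S"
  shows "npr (\<lambda>x z. \<exists>y. R x y \<and> S y z)"
proof -
  obtain k where k: "\<And>x y. R x y \<Longrightarrow> code_size y \<le> (code_size x + 2) ^ k"
    using assms(2) unfolding small_output_def by blast
  show ?thesis
  proof (rule npr_compose[OF assms(1,3), where B = "\<lambda>p. (code_size (fst p) + 2) ^ k"])
    show "poly_bounded (\<lambda>p. (code_size (fst p) + 2) ^ k) (\<lambda>(x, z). code_size x + code_size z)"
      by (intro pb_power pb_add pb_const pb_le) auto
  qed (use k in auto)
qed

lemma npr_fp: "fp f \<Longrightarrow> npr (\<lambda>x y. y = f x)"
  unfolding fp_def by blast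

lemma npr_precompose: "fp f \<Longrightarrow> npr R \<Longrightarrow> npr (\<lambda>x. R (f x))"
  using npr_compose_small[OF npr_fp small_output_fp, of f R] by simp

lemma npr_postcompose: "npr R \<Longrightarrow> small_output R \<Longrightarrow> fp g \<Longrightarrow> npr (\<lambda>x z. \<exists>y. R x y \<and> z = g y)"
  using npr_compose_small[OF _ _ npr_fp] by blast

lemma fp_size: "fp f \<Longrightarrow> poly_bounded (\<lambda>x. code_size (f x)) code_size"
  unfolding fp_def by blast

lemma fp_comp: "fp g \<Longrightarrow> fp f \<Longrightarrow> fp (\<lambda>x. g (f x))"
proof (rule fpI)
  assume fg: "fp g" "fp f"
  from npr_precompose[OF fg(2) npr_fp[OF fg(1)]] show "npr (\<lambda>x y. y = g (f x))" .
  from pb_trans[OF pb_compose[OF fp_size[OF fg(1)]] fp_size[OF fg(2)]]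
  show "poly_bounded (\<lambda>x. code_size (g (f x))) code_size" .
qed

text \<open>Stack 0 is the interface of a subprogram that uses stacks below \<open>K\<close>; the
  next three stacks are storage that it cannot touch.\<close>

definition regs4 :: "nat \<Rightarrow> bool list \<Rightarrow> bool list \<Rightarrow> bool list \<Rightarrow> bool list \<Rightarrow> store" where
  "regs4 K a b c d = (\<lambda>r. if r = 0 then a else if r = K then b else if r = Suc K then c
     else if r = Suc (Suc K) then d else [])"

lemma merge_regs4: "K > 0 \<Longrightarrow> merge K (regs4 K a u v w) (clean []) = clean a"
  "K > 0 \<Longrightarrow> merge K (clean a) (regs4 K b u v w) = regs4 K a u v w"
  by (auto simp: merge_def regs4_def clean_def)

lemma regs4_run_sound:
  assumes c: "implements c k R" and K: "num_regs c \<le> K" "K > 0"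
    and r: "run c (regs4 K (encode x) u v w) t s'"
  shows "\<exists>y. R x y \<and> s' = regs4 K (encode y) u v w"
proof -
  have "run c (clean (encode x)) t (merge K s' (clean []))"
    using run_merge[OF r K(1), of "clean []"] K(2) by (simp add: merge_regs4)
  from implements_sound[OF c this] obtain y where y: "R x y" "merge K s' (clean []) = clean (encode y)" by blast
  have "s' r = regs4 K (encode y) u v w r" for r
  proof (cases "r < K")
    case True
    then show ?thesis using fun_cong[OF y(2), of r] by (simp add: clean_def regs4_def merge_def)
  next
    case False
    then have "s' r = regs4 K (encode x) u v w r" using run_frame[OF r, of r] K by simp
    then show ?thesis using False K by (simp add: regs4_def)
  qed
  with y(1) show ?thesis by (auto simp: fun_eq_iff)
qed

lemma regs4_run_complete:
  assumes c: "implements c k R" and K: "num_regs c \<le> K" "K > 0" and R: "R x y"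
  shows "\<exists>t \<le> (code_size x + code_size y + 2) ^ k. run c (regs4 K (encode x) u v w) t (regs4 K (encode y) u v w)"
proof -
  obtain t where t: "t \<le> (code_size x + code_size y + 2) ^ k" "run c (clean (encode x)) t (clean (encode y))"
    using implements_complete[OF c R] by blast
  have "run c (regs4 K (encode x) u v w) t (regs4 K (encode y) u v w)"
    using run_merge[OF t(2) K(1), of "regs4 K (encode x) u v w"] K(2) by (simp add: merge_regs4)
  with t(1) show ?thesis by (intro exI conjI)
qed

lemma npr_fanout:
  fixes R :: "'a::codable \<Rightarrow> 'b::codable \<Rightarrow> bool" and S :: "'a \<Rightarrow> 'c::codable \<Rightarrow> bool"
  assumes "npr R" "npr S"
  shows "npr (\<lambda>x p. R x (fst p) \<and> S x (snd p))"
proof -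
  obtain c k where c: "implements c k R" using assms(1) unfolding npr_def by blast
  obtain d l where d: "implements d l S" using assms(2) unfolding npr_def by blast
  define K where "K = Suc (max (num_regs c) (num_regs d))"
  have K: "num_regs c \<le> K" "num_regs d \<le> K" "K > 0" by (auto simp: K_def)
  \<comment> \<open>\<open>pre\<close> saves a copy of the input, \<open>mid\<close> stores the
    first result and brings the copy back, and \<open>post\<close> puts the first result in front of
    the second, which gives the code of the pair. Every word is moved an even number of times, so
    the reversals cancel.\<close>
  define pre where "pre = rmove 0 (Suc (Suc K)) ;; rdup (Suc (Suc K)) 0 K"
  define mid where "mid = rmove 0 (Suc K) ;; (rmove K (Suc (Suc K)) ;; rmove (Suc (Suc K)) 0)"
  define post where "post = rmove (Suc K) 0"
  have pre: "exact pre (clean w) (regs4 K w w [] []) (20 * length w + 20)" for w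
  proof -
    have e1: "(clean w)(0 := [], Suc (Suc K) := rev (clean w 0) @ clean w (Suc (Suc K))) = regs4 K [] [] [] (rev w)"
      by (auto simp: clean_def regs4_def)
    let ?s = "regs4 K [] [] [] (rev w)"
    have e2: "?s(Suc (Suc K) := [], 0 := rev (?s (Suc (Suc K))) @ ?s 0, K := rev (?s (Suc (Suc K))) @ ?s K) = regs4 K w w [] []"
      using K by (auto simp: regs4_def)
    have 1: "exact (rmove 0 (Suc (Suc K))) (clean w) ?s (6 * length w + 3)"
      using exact_rmove[of 0 "Suc (Suc K)" "clean w"] unfolding e1 by (simp add: clean_def)
    have 2: "exact (rdup (Suc (Suc K)) 0 K) ?s (regs4 K w w [] []) (8 * length w + 3)"
      using exact_rdup[of "Suc (Suc K)" 0 K ?s] K unfolding e2 by (simp add: regs4_def)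
    show ?thesis unfolding pre_def by (rule exact_mono[OF exact_Seq[OF 1 2]]) simp
  qed
  have mid: "exact mid (regs4 K v w [] []) (regs4 K w [] (rev v) []) (20 * (length v + length w) + 20)" for v w
  proof -
    let ?s0 = "regs4 K v w [] []" and ?s1 = "regs4 K [] w (rev v) []" and ?s2 = "regs4 K [] [] (rev v) (rev w)"
    have e1: "?s0(0 := [], Suc K := rev (?s0 0) @ ?s0 (Suc K)) = ?s1" using K by (auto simp: regs4_def)
    have e2: "?s1(K := [], Suc (Suc K) := rev (?s1 K) @ ?s1 (Suc (Suc K))) = ?s2" using K by (auto simp: regs4_def)
    have e3: "?s2(Suc (Suc K) := [], 0 := rev (?s2 (Suc (Suc K))) @ ?s2 0) = regs4 K w [] (rev v) []"
      using K by (auto simp: regs4_def)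
    have 1: "exact (rmove 0 (Suc K)) ?s0 ?s1 (6 * length v + 3)"
      using exact_rmove[of 0 "Suc K" ?s0] unfolding e1 by (simp add: regs4_def)
    have 2: "exact (rmove K (Suc (Suc K))) ?s1 ?s2 (6 * length w + 3)"
      using exact_rmove[of K "Suc (Suc K)" ?s1] K unfolding e2 by (simp add: regs4_def)
    have 3: "exact (rmove (Suc (Suc K)) 0) ?s2 (regs4 K w [] (rev v) []) (6 * length w + 3)"
      using exact_rmove[of "Suc (Suc K)" 0 ?s2] K unfolding e3 by (simp add: regs4_def)
    show ?thesis unfolding mid_def by (rule exact_mono[OF exact_Seq[OF 1 exact_Seq[OF 2 3]]]) simp
  qed
  have post: "exact post (regs4 K w [] (rev v) []) (clean (v @ w)) (20 * length v + 20)" for v w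
  proof -
    let ?s = "regs4 K w [] (rev v) []"
    have e: "?s(Suc K := [], 0 := rev (?s (Suc K)) @ ?s 0) = clean (v @ w)" using K by (auto simp: regs4_def clean_def)
    show ?thesis using exact_rmove[of "Suc K" 0 ?s] K unfolding e post_def by (simp add: regs4_def exact_mono)
  qed
  let ?P = "pre ;; (c ;; (mid ;; (d ;; post)))"
  let ?g = "\<lambda>(x, p). code_size x + code_size p"
  let ?T = "\<lambda>(x, p). 20 * code_size x + 20 + ((code_size x + code_size (fst p) + 2) ^ k +
      (20 * (code_size (fst p) + code_size x) + 20 + ((code_size x + code_size (snd p) + 2) ^ l +
       (20 * code_size (fst p) + 20))) + 4)"
  show ?thesis
  proof (rule nprI[where c = ?P and T = ?T])
    fix x :: 'a and t s' assume "run ?P (clean (encode x)) t s'"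
    then obtain s1 s2 s3 s4 where r: "\<exists>t. run pre (clean (encode x)) t s1" "\<exists>t. run c s1 t s2"
      "\<exists>t. run mid s2 t s3" "\<exists>t. run d s3 t s4" "\<exists>t. run post s4 t s'" by blast
    have s1: "s1 = regs4 K (encode x) (encode x) [] []" using r(1) exact_runD[OF pre] by blast
    obtain y where y: "R x y" "s2 = regs4 K (encode y) (encode x) [] []"
      using r(2) regs4_run_sound[OF c K(1,3)] unfolding s1 by blast
    have s3: "s3 = regs4 K (encode x) [] (rev (encode y)) []" using r(3) exact_runD[OF mid] unfolding y(2) by blast
    obtain z where z: "S x z" "s4 = regs4 K (encode z) [] (rev (encode y)) []"
      using r(4) regs4_run_sound[OF d K(2,3)] unfolding s3 by blast
    have "s' = clean (encode y @ encode z)" using r(5) exact_runD[OF post] unfolding z(2) by blast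
    then have "s' = clean (encode (y, z))" by (simp add: encode_prod_def)
    then show "\<exists>p. (R x (fst p) \<and> S x (snd p)) \<and> s' = clean (encode p)"
      using y(1) z(1) by (intro exI[of _ "(y, z)"]) auto
  next
    fix x :: 'a and p :: "'b \<times> 'c" assume "R x (fst p) \<and> S x (snd p)"
    moreover obtain y z where p: "p = (y, z)" by (cases p)
    ultimately have yz: "R x y" "S x z" by auto
    obtain t1 where t1: "t1 \<le> 20 * code_size x + 20" "run pre (clean (encode x)) t1 (regs4 K (encode x) (encode x) [] [])"
      by (rule exact_obtain[OF pre])
    obtain t2 where t2: "t2 \<le> (code_size x + code_size y + 2) ^ k"
      "run c (regs4 K (encode x) (encode x) [] []) t2 (regs4 K (encode y) (encode x) [] [])"
      using regs4_run_complete[OF c K(1,3) yz(1)] by blast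
    obtain t3 where t3: "t3 \<le> 20 * (code_size y + code_size x) + 20"
      "run mid (regs4 K (encode y) (encode x) [] []) t3 (regs4 K (encode x) [] (rev (encode y)) [])"
      by (rule exact_obtain[OF mid])
    obtain t4 where t4: "t4 \<le> (code_size x + code_size z + 2) ^ l"
      "run d (regs4 K (encode x) [] (rev (encode y)) []) t4 (regs4 K (encode z) [] (rev (encode y)) [])"
      using regs4_run_complete[OF d K(2,3) yz(2)] by blast
    obtain t5 where t5: "t5 \<le> 20 * code_size y + 20"
      "run post (regs4 K (encode z) [] (rev (encode y)) []) t5 (clean (encode y @ encode z))"
      by (rule exact_obtain[OF post])
    have "encode p = encode y @ encode z" by (simp add: p encode_prod_def)
    with run_Seq[OF t1(2) run_Seq[OF t2(2) run_Seq[OF t3(2) run_Seq[OF t4(2) t5(2)]]]]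
    have "run ?P (clean (encode x)) (Suc (t1 + Suc (t2 + Suc (t3 + Suc (t4 + t5))))) (clean (encode p))" by simp
    moreover have "Suc (t1 + Suc (t2 + Suc (t3 + Suc (t4 + t5)))) \<le> ?T (x, p)"
      using t1(1) t2(1) t3(1) t4(1) t5(1) by (simp add: p)
    ultimately show "\<exists>t\<le>?T (x, p). run ?P (clean (encode x)) t (clean (encode p))"
      by (intro exI conjI)
  next
    have 1: "poly_bounded (\<lambda>p. code_size (fst p)) ?g" by (rule pb_le) auto
    have 2: "poly_bounded (\<lambda>p. code_size (fst (snd p))) ?g" by (rule pb_le) (auto simp: encode_prod_def)
    have 3: "poly_bounded (\<lambda>p. code_size (snd (snd p))) ?g" by (rule pb_le) (auto simp: encode_prod_def)
    show "poly_bounded ?T ?g"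
      unfolding split_beta[of "\<lambda>x p. 20 * code_size x + 20 + ((code_size x + code_size (fst p) + 2) ^ k +
      (20 * (code_size (fst p) + code_size x) + 20 + ((code_size x + code_size (snd p) + 2) ^ l +
       (20 * code_size (fst p) + 20))) + 4)"]
      by (intro pb_add pb_mult pb_const pb_power 1 2 3)
  qed
qed

subsection \<open>Basic functions and predicates\<close>

fun pushes :: "bool list \<Rightarrow> com" where
  "pushes [] = Skip"
| "pushes (b # w) = pushes w ;; Push 0 b"

lemma exact_pushes: "exact (pushes w) (clean v) (clean (w @ v)) (2 * length w + 1)"
proof (induction w)
  case Nil show ?case using exact_Skip[of "clean v"] by simp
next
  case (Cons b w)
  have e: "(clean (w @ v))(0 := b # clean (w @ v) 0) = clean ((b # w) @ v)" by (auto simp: clean_def)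
  from exact_Seq[OF Cons exact_Push[of 0 b "clean (w @ v)"]] show ?case
    unfolding e pushes.simps by (rule exact_mono) simp
qed

lemma fp_prepend:
  assumes "\<And>x. encode (f x) = w @ encode x"
  shows "fp f"
proof (rule fpI)
  show "npr (\<lambda>x y. y = f x)"
    by (rule nprI_exact[OF _ pb_const[of "2 * length w + 1"], where c = "pushes w"]) (simp add: assms exact_pushes[simplified])
  show "poly_bounded (\<lambda>x. code_size (f x)) code_size"
    unfolding assms length_append by (intro pb_add pb_const pb_self)
qed

text \<open>A change of type without a change of code costs nothing. For instance, a number and the
  list of its binary digits have the same code.\<close>

lemma fp_recode: "(\<And>x. encode (f x) = encode x) \<Longrightarrow> fp f"
  by (rule fp_prepend[of _ "[]"]) simp

lemma fp_id: "fp (\<lambda>x. x)"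
  by (rule fp_recode) simp

text \<open>Case distinction on a value whose first bit decides its constructor: removing that bit
  either fails or leaves exactly the code of the components.\<close>

lemma npr_strip:
  fixes R :: "'a::codable \<Rightarrow> 'b::codable \<Rightarrow> bool"
  assumes "\<And>x w. encode x = b # w \<Longrightarrow> \<exists>y. R x y \<and> encode y = w"
    and "\<And>x y. R x y \<Longrightarrow> encode x = b # encode y"
  shows "npr R"
proof (rule nprI[where c = "Pop 0 b" and T = "\<lambda>_. 1"])
  fix x :: 'a and t s' assume "run (Pop 0 b) (clean (encode x)) t s'"
  then obtain w where "clean (encode x) 0 = b # w" and s': "s' = (clean (encode x))(0 := w)" by auto
  then have w: "encode x = b # w" "s' = clean w" by (auto simp: clean_def)
  with assms(1)[OF w(1)] show "\<exists>y. R x y \<and> s' = clean (encode y)" by auto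
next
  fix x :: 'a and y :: 'b assume "R x y"
  note e = assms(2)[OF this]
  have "run (Pop 0 b) (clean (encode x)) 1 ((clean (encode x))(0 := encode y))"
    by (rule run_Pop) (simp add: clean_def e)
  moreover have e': "(clean (encode x))(0 := encode y) = clean (encode y)" by (auto simp: clean_def)
  ultimately have "run (Pop 0 b) (clean (encode x)) 1 (clean (encode y))" unfolding e' by blast
  then show "\<exists>t\<le>1. run (Pop 0 b) (clean (encode x)) t (clean (encode y))" by (intro exI[of _ 1] conjI order_refl)
qed (rule pb_const)

lemma fp_const: "fp (\<lambda>x :: 'a::codable. c :: 'b::codable)"
proof (rule fpI)
  have "exact (clear 0 ;; pushes (encode c)) (clean (encode x)) (clean (encode c)) (6 * code_size x + (2 * code_size c + 10))"
    for x :: 'a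
  proof -
    have e: "(clean (encode x))(0 := []) = clean []" by (auto simp: clean_def)
    have 1: "exact (clear 0) (clean (encode x)) (clean []) (6 * code_size x + 3)"
      using exact_clear[of 0 "clean (encode x)"] unfolding e by (simp add: clean_def)
    have 2: "exact (pushes (encode c)) (clean []) (clean (encode c)) (2 * code_size c + 1)"
      using exact_pushes[of "encode c" "[]"] by simp
    show ?thesis by (rule exact_mono[OF exact_Seq[OF 1 2]]) simp
  qed
  then show "npr (\<lambda>(x :: 'a) y. y = c)" by (rule nprI_exact[where f = "\<lambda>_. c"]) (intro pb_add pb_mult pb_const pb_self)
qed (rule pb_const)

lemma fp_fst_prim: "fp (fst :: 'a::codable \<times> 'b::codable \<Rightarrow> 'a)"
proof (rule fpI)
  obtain c k where c: "parses c k (encode :: 'a \<Rightarrow> _)" using parser_exists by blast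
  have "exact (c ;; (clear 0 ;; rmove 1 0)) (clean (encode p)) (clean (encode (fst p))) (k * (code_size p + 1) + (12 * code_size p + 10))"
    for p :: "'a \<times> 'b"
  proof -
    obtain x y where p: "p = (x, y)" by (cases p)
    let ?s = "clean (encode p)"
    have e: "?s 0 = encode x @ encode y" "?s 1 = []" by (simp_all add: clean_def p encode_prod_def)
    let ?s1 = "?s(0 := encode y, 1 := rev (encode x) @ ?s 1)"
    let ?s2 = "?s1(0 := [])"
    have 1: "exact c ?s ?s1 (k * Suc (code_size x))" by (rule parsesD[OF c]) (simp add: e)
    have 2: "exact (clear 0) ?s1 ?s2 (6 * code_size y + 3)" using exact_clear[of 0 ?s1] by simp
    have 3: "exact (rmove 1 0) ?s2 (?s2(1 := [], 0 := rev (?s2 1) @ ?s2 0)) (6 * code_size x + 3)"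
      using exact_rmove[of 1 0 ?s2] by (simp add: clean_def)
    have "?s2(1 := [], 0 := rev (?s2 1) @ ?s2 0) = clean (encode (fst p))" by (auto simp: clean_def p)
    with exact_Seq[OF 1 exact_Seq[OF 2 3]] show ?thesis
      by (auto simp: p encode_prod_def algebra_simps intro: exact_mono)
  qed
  then show "npr (\<lambda>(p :: 'a \<times> 'b) y. y = fst p)"
    by (rule nprI_exact) (intro pb_add pb_mult pb_const pb_self)
  show "poly_bounded (\<lambda>p. code_size (fst p)) (code_size :: 'a \<times> 'b \<Rightarrow> _)"
    by (rule pb_le) (simp add: encode_prod_def)
qed

lemma fp_snd_prim: "fp (snd :: 'a::codable \<times> 'b::codable \<Rightarrow> 'b)"
proof (rule fpI)
  obtain c k where c: "parses c k (encode :: 'a \<Rightarrow> _)" using parser_exists by blast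
  have "exact (c ;; clear 1) (clean (encode p)) (clean (encode (snd p))) (k * (code_size p + 1) + (12 * code_size p + 10))"
    for p :: "'a \<times> 'b"
  proof -
    obtain x y where p: "p = (x, y)" by (cases p)
    let ?s = "clean (encode p)"
    have e: "?s 0 = encode x @ encode y" "?s 1 = []" by (simp_all add: clean_def p encode_prod_def)
    let ?s1 = "?s(0 := encode y, 1 := rev (encode x) @ ?s 1)"
    have 1: "exact c ?s ?s1 (k * Suc (code_size x))" by (rule parsesD[OF c]) (simp add: e)
    have 2: "exact (clear 1) ?s1 (?s1(1 := [])) (6 * code_size x + 3)" using exact_clear[of 1 ?s1] by (simp add: clean_def)
    have "?s1(1 := []) = clean (encode (snd p))" by (auto simp: clean_def p)
    with exact_Seq[OF 1 2] show ?thesis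
      by (auto simp: p encode_prod_def algebra_simps intro: exact_mono)
  qed
  then show "npr (\<lambda>(p :: 'a \<times> 'b) y. y = snd p)"
    by (rule nprI_exact) (intro pb_add pb_mult pb_const pb_self)
  show "poly_bounded (\<lambda>p. code_size (snd p)) (code_size :: 'a \<times> 'b \<Rightarrow> _)"
    by (rule pb_le) (simp add: encode_prod_def)
qed

lemmas fp_fst = fp_comp[OF fp_fst_prim]
lemmas fp_snd = fp_comp[OF fp_snd_prim]

lemma fp_pair: "fp f \<Longrightarrow> fp g \<Longrightarrow> fp (\<lambda>x. (f x, g x))"
proof (rule fpI)
  assume fg: "fp f" "fp g"
  show "npr (\<lambda>x y. y = (f x, g x))"
    by (rule npr_cong[OF npr_fanout[OF npr_fp[OF fg(1)] npr_fp[OF fg(2)]]]) auto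
  have "poly_bounded (\<lambda>x. code_size (f x) + code_size (g x)) code_size"
    using fg by (intro pb_add fp_size)
  then show "poly_bounded (\<lambda>x. code_size (f x, g x)) code_size" by (simp add: encode_prod_def)
qed

text \<open>All guessed data enter here. The guess is placed in front of the input, and its cost is
  bounded by its own size, hence by the size of the output.\<close>

lemma npr_guess: "npr (\<lambda>x p. snd p = x)"
proof -
  obtain c k where c: "generates c k (encode :: 'b \<Rightarrow> _)" using generator_exists by blast
  have e: "(clean v)(0 := w @ clean v 0) = clean (w @ v)" for v w by (auto simp: clean_def)
  show ?thesis
  proof (rule nprI[where c = c and T = "\<lambda>(x, p). k * (code_size p + 1)"])
    fix x :: 'a and t s' assume "run c (clean (encode x)) t s'"
    from generates_sound[OF c this] obtain y :: 'b where "s' = clean (encode y @ encode x)" unfolding e by (rule exE)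
    then show "\<exists>p :: 'b \<times> 'a. snd p = x \<and> s' = clean (encode p)"
      by (intro exI[of _ "(y, x)"]) (simp add: encode_prod_def)
  next
    fix x :: 'a and p :: "'b \<times> 'a" assume "snd p = x"
    then have p: "encode p = encode (fst p) @ encode x" by (simp add: encode_prod_def)
    from generates_complete[OF c, of "fst p" "clean (encode x)"]
    obtain t where t: "t \<le> k * Suc (code_size (fst p))" "run c (clean (encode x)) t (clean (encode p))"
      unfolding e p by blast
    have "k * Suc (code_size (fst p)) \<le> k * (code_size p + 1)" by (rule mult_le_mono2) (simp add: p)
    with t(1) have "t \<le> k * (code_size p + 1)" by (rule order_trans)
    then have "t \<le> (\<lambda>(x, p). k * (code_size p + 1)) (x, p)" by (simp only: prod.case)
    with t(2) show "\<exists>t\<le>(\<lambda>(x, p). k * (code_size p + 1)) (x, p). run c (clean (encode x)) t (clean (encode p))"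
      by (intro exI[of _ t] conjI)
  next
    have "poly_bounded (\<lambda>i. code_size (snd i)) (\<lambda>i. code_size (fst i) + code_size (snd i))" by (rule pb_le) auto
    then show "poly_bounded (\<lambda>(x, p). k * (code_size p + 1)) (\<lambda>(x, p). code_size x + code_size p)"
      unfolding split_beta by (intro pb_add pb_mult pb_const)
  qed
qed

lemma npr_union:
  fixes R :: "'a::codable \<Rightarrow> 'b::codable \<Rightarrow> bool"
  assumes "npr R" "npr S"
  shows "npr (\<lambda>x y. R x y \<or> S x y)"
proof -
  obtain c k where c: "implements c k R" using assms(1) unfolding npr_def by blast
  obtain d l where d: "implements d l S" using assms(2) unfolding npr_def by blast
  let ?T = "\<lambda>(x, y). (code_size x + code_size y + 2) ^ k + (code_size x + code_size y + 2) ^ l + 1"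
  show ?thesis
  proof (rule nprI[where c = "Choice c d" and T = ?T])
    fix x :: 'a and t s' assume "run (Choice c d) (clean (encode x)) t s'"
    then show "\<exists>y. (R x y \<or> S x y) \<and> s' = clean (encode y)"
      using implements_sound[OF c] implements_sound[OF d] by blast
  next
    fix x :: 'a and y :: 'b assume "R x y \<or> S x y"
    then show "\<exists>t\<le>?T (x, y). run (Choice c d) (clean (encode x)) t (clean (encode y))"
    proof
      assume "R x y"
      from implements_complete[OF c this] obtain t where t: "t \<le> (code_size x + code_size y + 2) ^ k"
        "run c (clean (encode x)) t (clean (encode y))" by blast
      show ?thesis by (intro exI[of _ "Suc t"]) (use t(1) run_ChoiceL[OF t(2)] in auto)
    next
      assume "S x y"
      from implements_complete[OF d this] obtain t where t: "t \<le> (code_size x + code_size y + 2) ^ l"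
        "run d (clean (encode x)) t (clean (encode y))" by blast
      show ?thesis by (intro exI[of _ "Suc t"]) (use t(1) run_ChoiceR[OF t(2)] in auto)
    qed
  next
    show "poly_bounded ?T (\<lambda>(x, y). code_size x + code_size y)"
      unfolding split_beta by (intro pb_add pb_power pb_const pb_self)
  qed
qed

section \<open>Closure properties of predicates, and functions by guess and check\<close>

lemma np_comp: "np P \<Longrightarrow> fp f \<Longrightarrow> np (\<lambda>x. P (f x))"
  unfolding np_def using npr_precompose by blast

lemma npr_guard:
  fixes R :: "'a::codable \<Rightarrow> 'b::codable \<Rightarrow> bool"
  assumes "np P" "npr R" "small_output R"
  shows "npr (\<lambda>x y. P x \<and> R x y)"
proof -
  obtain k where k: "\<And>x y. R x y \<Longrightarrow> code_size y \<le> (code_size x + 2) ^ k"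
    using assms(3) unfolding small_output_def by blast
  have s: "small_output (\<lambda>x (p :: unit \<times> _). P x \<and> R x (snd p))"
    unfolding small_output_def
  proof (intro exI[of _ k] allI impI)
    fix x and p :: "unit \<times> 'b" assume "P x \<and> R x (snd p)"
    then show "code_size p \<le> (code_size x + 2) ^ k"
      using k[of x "snd p"] by (simp add: encode_prod_def encode_unit_def)
  qed
  from npr_postcompose[OF npr_fanout[OF assms(1)[unfolded np_def] assms(2)] s fp_snd_prim]
  show ?thesis by (rule npr_cong) (auto intro: exI[of _ "((), _)"])
qed

lemma np_conj: "np P \<Longrightarrow> np Q \<Longrightarrow> np (\<lambda>x. P x \<and> Q x)"
  using npr_guard[OF _ _ small_output_unit, of P Q] unfolding np_def by blast

lemma np_disj: "np P \<Longrightarrow> np Q \<Longrightarrow> np (\<lambda>x. P x \<or> Q x)"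
  unfolding np_def by (rule npr_union)

text \<open>The witness is guessed. Accepting runs are sound for witnesses of any size; a short run
  needs only one small witness.\<close>

lemma np_ex:
  assumes "np (\<lambda>p. P (fst p) (snd p))"
    and "\<And>x g. P g x \<Longrightarrow> \<exists>g'. P g' x \<and> code_size g' \<le> B x"
    and "poly_bounded B code_size"
  shows "np (\<lambda>x. \<exists>g. P g x)"
proof -
  have "npr (\<lambda>x (u :: unit). \<exists>p. snd p = x \<and> P (fst p) (snd p))"
  proof (rule npr_compose[OF npr_guess assms(1)[unfolded np_def], where B = "\<lambda>i. B (fst i) + code_size (fst i)"])
    fix x y and z :: unit assume "snd y = x" "P (fst y) (snd y)"
    then obtain g where "P g x" "code_size g \<le> B x" using assms(2) by blast
    then show "\<exists>y'. snd y' = x \<and> P (fst y') (snd y') \<and> code_size y' \<le> B (fst (x, z)) + code_size (fst (x, z))"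
      by (intro exI[of _ "(g, x)"]) (simp add: encode_prod_def)
  next
    have 1: "poly_bounded (\<lambda>i. code_size (fst i)) (\<lambda>(x, z). code_size x + code_size z)" by (rule pb_le) auto
    show "poly_bounded (\<lambda>i. B (fst i) + code_size (fst i)) (\<lambda>(x, z :: unit). code_size x + code_size z)"
      by (intro pb_add 1 pb_trans[OF pb_compose[OF assms(3)]])
  qed
  then show ?thesis unfolding np_def by (rule npr_cong) auto
qed

text \<open>The value is guessed, checked and kept. Thus a function of polynomial size needs only a
  test of its graph.\<close>

lemma fp_of_np:
  assumes "np (\<lambda>p. fst p = f (snd p))" "poly_bounded (\<lambda>x. code_size (f x)) code_size"
  shows "fp f"
proof (rule fpI[OF _ assms(2)])
  have s: "small_output (\<lambda>p y. y = fst p)" by (rule small_output_fp[OF fp_fst_prim])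
  have "npr (\<lambda>x y. \<exists>p. snd p = x \<and> (fst p = f (snd p) \<and> y = fst p))"
  proof (rule npr_compose[OF npr_guess npr_guard[OF assms(1) npr_fp[OF fp_fst_prim] s],
      where B = "\<lambda>i. code_size (f (fst i)) + code_size (fst i)"])
    fix x y z assume "snd y = x" "fst y = f (snd y) \<and> z = fst y"
    then show "\<exists>y'. snd y' = x \<and> (fst y' = f (snd y') \<and> z = fst y') \<and>
        code_size y' \<le> code_size (f (fst (x, z))) + code_size (fst (x, z))"
      by (intro exI[of _ y]) (auto simp: encode_prod_def)
  next
    have 1: "poly_bounded (\<lambda>i. code_size (fst i)) (\<lambda>(x, z). code_size x + code_size z)" by (rule pb_le) auto
    show "poly_bounded (\<lambda>i. code_size (f (fst i)) + code_size (fst i)) (\<lambda>(x, z). code_size x + code_size z)"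
      by (intro pb_add 1 pb_trans[OF pb_compose[OF assms(2)]])
  qed
  then show "npr (\<lambda>x y. y = f x)" by (rule npr_cong) (auto intro: exI[of _ "(f _, _)"])
qed

lemma np_bool: "np (\<lambda>b. b)"
  unfolding np_def by (rule npr_strip[of True]) (auto simp: encode_bool_def encode_unit_def)

lemma np_not_bool: "np (\<lambda>b. \<not> b)"
  unfolding np_def by (rule npr_strip[of False]) (auto simp: encode_bool_def encode_unit_def)

lemmas np_if_fp = np_comp[OF np_bool]
lemmas np_not_if_fp = np_comp[OF np_not_bool]

lemma fp_if:
  assumes "fp b" "fp f" "fp g"
  shows "fp (\<lambda>x. if b x then f x else g x)"
proof (rule fpI)
  have "npr (\<lambda>x y. (b x \<and> y = f x) \<or> (\<not> b x \<and> y = g x))"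
    using assms by (intro npr_union npr_guard np_if_fp np_not_if_fp npr_fp small_output_fp)
  then show "npr (\<lambda>x y. y = (if b x then f x else g x))" by (rule npr_cong) auto
  have "poly_bounded (\<lambda>x. code_size (f x) + code_size (g x)) code_size"
    using assms by (intro pb_add fp_size)
  then show "poly_bounded (\<lambda>x. code_size (if b x then f x else g x)) code_size" by (rule pb_mono) auto
qed

text \<open>Acceptance is one-sided, so a Boolean function needs accepting runs for both
  answers.\<close>

lemma fp_decide:
  assumes "np P" "np (\<lambda>x. \<not> P x)"
  shows "fp P"
proof (rule fpI)
  have "npr (\<lambda>x y. (P x \<and> y = True) \<or> (\<not> P x \<and> y = False))"
    using assms by (intro npr_union npr_guard npr_fp small_output_fp fp_const)
  then show "npr (\<lambda>x y. y = P x)" by (rule npr_cong) auto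
  show "poly_bounded (\<lambda>x. code_size (P x)) code_size"
    by (rule pb_mono[OF pb_const[of 1]]) (simp add: encode_bool_def)
qed

lemma fp_cong: "fp f \<Longrightarrow> (\<And>x. f x = g x) \<Longrightarrow> fp g"
  by (subgoal_tac "f = g") (auto simp: fun_eq_iff)

lemma fp_conj: "fp P \<Longrightarrow> fp Q \<Longrightarrow> fp (\<lambda>x. P x \<and> Q x)"
  by (rule fp_cong[OF fp_if[of P Q "\<lambda>_. False"]]) (auto intro: fp_const)

subsection \<open>Lists\<close>

lemma encode_list_simps [simp]:
  "encode ([] :: 'a::codable list) = [False]"
  "encode (x # xs) = True # encode x @ encode xs"
  by (simp_all add: encode_list_def)

lemma fp_Cons: "fp f \<Longrightarrow> fp g \<Longrightarrow> fp (\<lambda>x. f x # g x)"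
proof -
  assume fg: "fp f" "fp g"
  have "fp (\<lambda>p. fst p # snd p :: 'b list)"
    by (rule fp_prepend[of _ "[True]"]) (simp add: encode_prod_def)
  from fp_comp[OF this fp_pair[OF fg]] show ?thesis by simp
qed

lemma npr_uncons: "npr (\<lambda>xs p. xs = fst p # snd p)"
proof (rule npr_strip[of True])
  fix xs :: "'a list" and w assume "encode xs = True # w"
  then show "\<exists>p. xs = fst p # snd p \<and> encode p = w"
    by (cases xs) (auto simp: encode_prod_def intro: exI[of _ "(_, _)"])
qed (auto simp: encode_prod_def)

lemma np_Nil: "np (\<lambda>xs :: 'a::codable list. xs = [])"
  unfolding np_def
proof (rule npr_strip[of False])
  fix xs :: "'a list" and w assume "encode xs = False # w"
  then show "\<exists>u :: unit. xs = [] \<and> encode u = w" by (cases xs) (auto simp: encode_unit_def)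
qed (auto simp: encode_unit_def)

lemma fp_case_list:
  assumes l: "fp l" and g: "fp g" and h: "fp (\<lambda>p. h (fst p) (fst (snd p)) (snd (snd p)))"
  shows "fp (\<lambda>x. case l x of [] \<Rightarrow> g x | y # ys \<Rightarrow> h x y ys)"
proof (rule fpI)
  have s: "small_output (\<lambda>xs p. xs = fst p # snd p)"
    by (rule small_outputI[OF _ pb_self]) (auto simp: encode_prod_def)
  note u = npr_precompose[OF l npr_uncons]
  have su: "small_output (\<lambda>x p. x = fst p \<and> l x = fst (snd p) # snd (snd p))"
    by (rule small_outputI[where f = "\<lambda>x. code_size x + code_size (l x)"])
      (auto simp: encode_prod_def intro: pb_add pb_self fp_size[OF l])
  have f: "npr (\<lambda>x p. x = fst p \<and> l x = fst (snd p) # snd (snd p))"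
    by (rule npr_cong[OF npr_fanout[OF npr_fp[OF fp_id] u]]) auto
  have "npr (\<lambda>x y. (l x = [] \<and> y = g x) \<or>
     (\<exists>p. (x = fst p \<and> l x = fst (snd p) # snd (snd p)) \<and> y = h (fst p) (fst (snd p)) (snd (snd p))))"
    by (intro npr_union npr_guard npr_fp small_output_fp g np_comp[OF np_Nil l] npr_postcompose[OF f su h])
  then show "npr (\<lambda>x y. y = (case l x of [] \<Rightarrow> g x | y # ys \<Rightarrow> h x y ys))"
    by (rule npr_cong) (auto split: list.split)
  have b: "poly_bounded (\<lambda>p. code_size (h (fst p) (fst (snd p)) (snd (snd p)))) code_size" using h by (rule fp_size)
  obtain k where k: "\<And>p. code_size (h (fst p) (fst (snd p)) (snd (snd p))) \<le> (code_size p + 2) ^ k"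
    using b unfolding poly_bounded_def by blast
  have "poly_bounded (\<lambda>x. code_size (g x) + (code_size x + code_size (l x) + 2) ^ k) code_size"
    by (intro pb_add pb_power pb_const pb_self fp_size g l)
  then show "poly_bounded (\<lambda>x. code_size (case l x of [] \<Rightarrow> g x | y # ys \<Rightarrow> h x y ys)) code_size"
  proof (rule pb_mono)
    fix x
    show "code_size (case l x of [] \<Rightarrow> g x | y # ys \<Rightarrow> h x y ys) \<le> code_size (g x) + (code_size x + code_size (l x) + 2) ^ k"
    proof (cases "l x")
      case (Cons y ys)
      have "code_size (h x y ys) \<le> (code_size (x, y, ys) + 2) ^ k" using k[of "(x, y, ys)"] by simp
      also have "\<dots> \<le> (code_size x + code_size (l x) + 2) ^ k"
        by (rule power_mono) (auto simp: encode_prod_def Cons)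
      finally show ?thesis by (simp add: Cons)
    qed simp
  qed
qed

lemma np_not_Nil: "np (\<lambda>xs :: 'a::codable list. xs \<noteq> [])"
proof -
  have "fp (\<lambda>xs :: 'a list. case xs of [] \<Rightarrow> False | y # ys \<Rightarrow> True)"
    by (intro fp_case_list fp_const fp_id)
  from np_if_fp[OF this] show ?thesis
    by (rule back_subst[of np]) (auto simp: fun_eq_iff split: list.split)
qed

subsection \<open>Iteration\<close>

lemma run_Star_path:
  fixes R :: "'a::codable \<Rightarrow> 'a \<Rightarrow> bool"
  assumes c: "implements c k R"
  shows "((\<lambda>a b. R a b \<and> code_size b \<le> B) ^^ n) a b \<Longrightarrow> code_size a \<le> B \<Longrightarrow>
    \<exists>t \<le> n * Suc ((2 * B + 2) ^ k) + 1. run (Star c) (clean (encode a)) t (clean (encode b))"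
proof (induction n arbitrary: a)
  case 0
  then have "b = a" by simp
  then show ?case using run_Star_stop[of c "clean (encode a)"] by (intro exI[of _ 1]) simp
next
  case (Suc n)
  obtain m where m: "R a m" "code_size m \<le> B" "((\<lambda>a b. R a b \<and> code_size b \<le> B) ^^ n) m b"
    using relpowp_Suc_D2[OF Suc.prems(1)] by blast
  from Suc.IH[OF m(3,2)] obtain t where t: "t \<le> n * Suc ((2 * B + 2) ^ k) + 1"
    "run (Star c) (clean (encode m)) t (clean (encode b))" by blast
  from implements_complete[OF c m(1)] obtain t1 where t1: "t1 \<le> (code_size a + code_size m + 2) ^ k"
    "run c (clean (encode a)) t1 (clean (encode m))" by blast
  have "(code_size a + code_size m + 2) ^ k \<le> (2 * B + 2) ^ k"
    using m(2) Suc.prems(2) by (intro power_mono) auto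
  with t1 t(1) have "Suc (t1 + t) \<le> Suc n * Suc ((2 * B + 2) ^ k) + 1" by simp
  with run_Star_step[OF t1(2) t(2)] show ?case by (intro exI conjI)
qed

lemma run_Star_sound:
  fixes R :: "'a::codable \<Rightarrow> 'a \<Rightarrow> bool"
  assumes c: "implements c k R"
  shows "run C s t s' \<Longrightarrow> C = Star c \<Longrightarrow> s = clean (encode a) \<Longrightarrow> \<exists>b. R\<^sup>*\<^sup>* a b \<and> s' = clean (encode b)"
proof (induction arbitrary: a rule: run.induct)
  case (run_Star_stop c' s)
  then show ?case by (intro exI[of _ a]) auto
next
  case (run_Star_step c' s t s' t' s'')
  then have "run c (clean (encode a)) t s'" by simp
  from implements_sound[OF c this] obtain m where m: "R a m" "s' = clean (encode m)" by blast
  from run_Star_step.IH(2)[OF run_Star_step.prems(1) m(2)] obtain b where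
    b: "R\<^sup>*\<^sup>* m b \<and> s'' = clean (encode b)" by (rule exE)
  then show ?case using m(1) by (intro exI[of _ b]) auto
qed auto

text \<open>Reachability allows any number of steps through states of any size. Short runs come from
  \<open>path\<close>: whenever \<open>b\<close> is reachable, some short path of small states leads
  to it.\<close>

lemma npr_star:
  fixes f :: "'a::codable \<Rightarrow> 'b::codable" and R :: "'b \<Rightarrow> 'b \<Rightarrow> bool"
  assumes "fp f" "npr R"
    and path: "\<And>x b. R\<^sup>*\<^sup>* (f x) b \<Longrightarrow> \<exists>n \<le> B (x, b). ((\<lambda>a b'. R a b' \<and> code_size b' \<le> B (x, b)) ^^ n) (f x) b"
    and B: "poly_bounded B (\<lambda>(x, b). code_size x + code_size b)"
  shows "npr (\<lambda>x b. R\<^sup>*\<^sup>* (f x) b)"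
proof -
  obtain c k where c: "implements c k (\<lambda>x y. y = f x)" using npr_fp[OF assms(1)] unfolding npr_def by blast
  obtain d l where d: "implements d l R" using assms(2) unfolding npr_def by blast
  let ?g = "\<lambda>(x, b). code_size x + code_size b"
  let ?B = "\<lambda>p. B p + code_size (f (fst p))"
  let ?T = "\<lambda>p. (code_size (fst p) + code_size (f (fst p)) + 2) ^ k + (B p * ((2 * ?B p + 2) ^ l + 1) + 2)"
  show ?thesis
  proof (rule nprI[where c = "c ;; Star d" and T = ?T])
    fix x :: 'a and t s' assume "run (c ;; Star d) (clean (encode x)) t s'"
    then obtain t1 t2 s1 where 1: "run c (clean (encode x)) t1 s1" "run (Star d) s1 t2 s'" by blast
    from implements_sound[OF c 1(1)] have s1: "s1 = clean (encode (f x))" by blast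
    from run_Star_sound[OF d 1(2) refl s1] show "\<exists>b. R\<^sup>*\<^sup>* (f x) b \<and> s' = clean (encode b)" .
  next
    fix x :: 'a and b :: 'b assume "R\<^sup>*\<^sup>* (f x) b"
    from path[OF this] obtain n where n: "n \<le> B (x, b)" "((\<lambda>a b'. R a b' \<and> code_size b' \<le> B (x, b)) ^^ n) (f x) b"
      by blast
    have "((\<lambda>a b'. R a b' \<and> code_size b' \<le> ?B (x, b)) ^^ n) (f x) b"
      by (rule relpowp_mono[OF _ n(2)]) auto
    from run_Star_path[OF d this] obtain t2 where t2: "t2 \<le> n * Suc ((2 * ?B (x, b) + 2) ^ l) + 1"
      "run (Star d) (clean (encode (f x))) t2 (clean (encode b))" by auto
    from implements_complete[OF c refl] obtain t1 where t1: "t1 \<le> (code_size x + code_size (f x) + 2) ^ k"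
      "run c (clean (encode x)) t1 (clean (encode (f x)))" by blast
    have "n * Suc ((2 * ?B (x, b) + 2) ^ l) \<le> B (x, b) * Suc ((2 * ?B (x, b) + 2) ^ l)"
      using n(1) by (rule mult_le_mono1)
    with t1(1) t2(1) have "Suc (t1 + t2) \<le> ?T (x, b)" by simp
    with run_Seq[OF t1(2) t2(2)] show "\<exists>t\<le>?T (x, b). run (c ;; Star d) (clean (encode x)) t (clean (encode b))" by (intro exI conjI)
  next
    have 1: "poly_bounded (\<lambda>p. code_size (fst p)) ?g" by (rule pb_le) auto
    have 2: "poly_bounded (\<lambda>p. code_size (f (fst p))) ?g"
      by (rule pb_trans[OF pb_compose[OF fp_size[OF assms(1)]] 1])
    show "poly_bounded ?T ?g" by (intro pb_add pb_mult pb_const pb_power 1 2 B)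
  qed
qed

lemma npr_star_decreasing:
  assumes "npr R" "\<And>a b. R a b \<Longrightarrow> code_size b < code_size a"
  shows "npr R\<^sup>*\<^sup>*"
proof (rule npr_star[OF fp_id assms(1), where B = "\<lambda>(x, b). code_size x"])
  fix x b assume "R\<^sup>*\<^sup>* x b"
  then show "\<exists>n\<le>(\<lambda>(x, b). code_size x) (x, b). ((\<lambda>a b'. R a b' \<and> code_size b' \<le> (\<lambda>(x, b). code_size x) (x, b)) ^^ n) x b"
  proof (induction rule: converse_rtranclp_induct)
    case base
    then show ?case by (intro exI[of _ 0]) auto
  next
    case (step y z)
    then obtain n where n: "n \<le> code_size z" "((\<lambda>a b'. R a b' \<and> code_size b' \<le> code_size z) ^^ n) z b" by auto
    note less = assms(2)[OF step(1)]
    have "((\<lambda>a b'. R a b' \<and> code_size b' \<le> code_size y) ^^ n) z b"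
      by (rule relpowp_mono[OF _ n(2)]) (use less in auto)
    then have "((\<lambda>a b'. R a b' \<and> code_size b' \<le> code_size y) ^^ Suc n) y b"
      using step(1) less by (intro relpowp_Suc_I2[of _ y z]) auto
    then show ?case using n(1) less by (intro exI[of _ "Suc n"]) (simp del: relpowp.simps)
  qed
next
  show "poly_bounded (\<lambda>(x, b). code_size x) (\<lambda>(x, b). code_size x + code_size b)" by (rule pb_le) auto
qed

text \<open>The accumulators that occur belong to the prefixes of the list, so \<open>bound\<close>
  speaks of every prefix. The loop state consists of the parameter \<open>x\<close>, the unread rest
  and the accumulator.\<close>

lemma fp_foldl:
  assumes l: "fp l" and a: "fp a" and f: "fp (\<lambda>p. f (fst p) (snd (snd p)) (fst (snd p)))"
    and bound: "\<And>x ys zs. l x = ys @ zs \<Longrightarrow> code_size (foldl (f x) (a x) ys) \<le> B x"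
    and B: "poly_bounded B code_size"
  shows "fp (\<lambda>x. foldl (f x) (a x) (l x))"
proof -
  define R where "R = (\<lambda>s s'. \<exists>y ys. fst (snd s) = y # ys \<and> s' = (fst s, (ys, f (fst s) (snd (snd s)) y)))"
  have "npr R"
  proof -
    let ?g = "\<lambda>s. case fst (snd s) of [] \<Rightarrow> s | y # ys \<Rightarrow> (fst s, (ys, f (fst s) (snd (snd s)) y))"
    have f': "fp (\<lambda>p. f (fst (fst p)) (snd (snd (fst p))) (fst (snd p)))"
      using fp_comp[OF f, of "\<lambda>p. (fst (fst p), (fst (snd p), snd (snd (fst p))))"]
      by (simp add: fp_pair fp_fst fp_snd fp_id)
    have g: "fp ?g"
      by (intro fp_case_list fp_pair fp_fst fp_snd fp_id f')
    have "np (\<lambda>s. fst (snd s) \<noteq> [])"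
    proof -
      note np_not_Nil
      then show ?thesis by (rule np_comp) (intro fp_fst fp_snd fp_id)
    qed
    from npr_guard[OF this npr_fp[OF g] small_output_fp[OF g]] show ?thesis
      by (rule npr_cong) (auto simp: R_def neq_Nil_conv)
  qed
  have reach: "\<exists>ys zs. l x = ys @ zs \<and> b = (x, (zs, foldl (f x) (a x) ys))"
    if "R\<^sup>*\<^sup>* (x, (l x, a x)) b" for x b
    using that
  proof (induction rule: rtranclp_induct)
    case base
    then show ?case by (intro exI[of _ "[]"] exI[of _ "l x"]) auto
  next
    case (step y z)
    then obtain ys zs where 1: "l x = ys @ zs" "y = (x, (zs, foldl (f x) (a x) ys))" by auto
    with step(2) obtain u us where 2: "zs = u # us" "z = (x, (us, f x (foldl (f x) (a x) ys) u))"
      by (auto simp: R_def)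
    show ?case by (rule exI[of _ "ys @ [u]"], rule exI[of _ us]) (simp add: 1 2)
  qed
  have path: "l x = ys @ zs \<Longrightarrow>
      ((\<lambda>a b. R a b \<and> code_size b \<le> code_size x + code_size (l x) + B x) ^^ length ys) (x, (l x, a x)) (x, (zs, foldl (f x) (a x) ys))"
    for x ys zs
  proof (induction ys arbitrary: zs rule: rev_induct)
    case Nil
    then show ?case by simp
  next
    case (snoc u us)
    have suffix: "code_size zs \<le> code_size (us @ zs)" for us zs :: "'b list" by (induction us) auto
    have "R (x, (u # zs, foldl (f x) (a x) us)) (x, (zs, foldl (f x) (a x) (us @ [u])))" by (simp add: R_def)
    moreover have "code_size (x, (zs, foldl (f x) (a x) (us @ [u]))) \<le> code_size x + code_size (l x) + B x"
      using bound[OF snoc.prems] suffix[of zs "us @ [u]"] snoc.prems by (simp add: encode_prod_def)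
    ultimately show ?case using snoc.IH[of "u # zs"] snoc.prems by auto
  qed
  have star: "npr (\<lambda>x b. R\<^sup>*\<^sup>* (x, (l x, a x)) b)"
  proof (rule npr_star[OF _ \<open>npr R\<close>, where B = "\<lambda>i. code_size (fst i) + code_size (l (fst i)) + B (fst i)"])
    show "fp (\<lambda>x. (x, (l x, a x)))" by (intro fp_pair fp_id l a)
    fix x b assume "R\<^sup>*\<^sup>* (x, (l x, a x)) b"
    from reach[OF this] obtain ys zs where b: "l x = ys @ zs" "b = (x, (zs, foldl (f x) (a x) ys))" by blast
    have "length (ys :: 'b list) \<le> code_size (ys @ zs)" for ys zs by (induction ys) auto
    then have "length ys \<le> code_size (l x)" using b(1) by simp
    then show "\<exists>n\<le>code_size (fst (x, b)) + code_size (l (fst (x, b))) + B (fst (x, b)).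
       ((\<lambda>a b'. R a b' \<and> code_size b' \<le> code_size (fst (x, b)) + code_size (l (fst (x, b))) + B (fst (x, b))) ^^ n) (x, (l x, a x)) b"
      using path[OF b(1)] b(2) by (intro exI[of _ "length ys"]) simp
  next
    have 1: "poly_bounded (\<lambda>i. code_size (fst i)) (\<lambda>(x, b). code_size x + code_size b)" by (rule pb_le) auto
    show "poly_bounded (\<lambda>i. code_size (fst i) + code_size (l (fst i)) + B (fst i)) (\<lambda>(x, b). code_size x + code_size b)"
      by (intro pb_add 1 pb_trans[OF pb_compose[OF fp_size[OF l]]] pb_trans[OF pb_compose[OF B]])
  qed
  have so: "small_output (\<lambda>x b. R\<^sup>*\<^sup>* (x, (l x, a x)) b)"
  proof (rule small_outputI)
    fix x b assume "R\<^sup>*\<^sup>* (x, (l x, a x)) b"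
    from reach[OF this] obtain ys zs where b: "l x = ys @ zs" "b = (x, (zs, foldl (f x) (a x) ys))" by blast
    have suffix: "code_size zs \<le> code_size (us @ zs)" for us zs :: "'b list" by (induction us) auto
    show "code_size b \<le> code_size x + code_size (l x) + B x"
      using bound[OF b(1)] suffix[of zs ys] b by (simp add: encode_prod_def)
  qed (intro pb_add pb_self fp_size l B)
  \<comment> \<open>A run may leave the loop at any time; requiring that no element is left discards
    premature results.\<close>
  have last: "npr (\<lambda>b c. fst (snd b) = [] \<and> c = snd (snd b))"
    by (intro npr_guard npr_fp small_output_fp np_comp[OF np_Nil] fp_fst fp_snd fp_id)
  show ?thesis
  proof (rule fpI)
    from npr_compose_small[OF star so last] show "npr (\<lambda>x y. y = foldl (f x) (a x) (l x))"
    proof (rule npr_cong)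
      fix x y
      have "R\<^sup>*\<^sup>* (x, (l x, a x)) (x, ([], foldl (f x) (a x) (l x)))"
        by (rule relpowp_imp_rtranclp[of "length (l x)"], rule relpowp_mono[OF _ path[of x "l x" "[]"]]) auto
      then show "(\<exists>b. R\<^sup>*\<^sup>* (x, (l x, a x)) b \<and> fst (snd b) = [] \<and> y = snd (snd b)) \<longleftrightarrow> y = foldl (f x) (a x) (l x)"
        using reach[of x] by fastforce
    qed
    show "poly_bounded (\<lambda>x. code_size (foldl (f x) (a x) (l x))) code_size"
      by (rule pb_mono[OF B]) (rule bound, simp)
  qed
qed

lemmas fp_intros = fp_pair fp_fst fp_snd fp_id fp_const fp_Cons fp_if fp_conj

subsection \<open>Binary arithmetic\<close>

lemma code_size_0: "code_size (0 :: nat) = 1"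
  by (simp add: encode_nat_0)

lemma code_size_pos: "n > 0 \<Longrightarrow> code_size (n :: nat) = code_size (n div 2) + 2"
  by (simp add: encode_nat_pos)

lemma code_size_bool [simp]: "code_size (b :: bool) = 1"
  by (simp add: encode_bool_def)

lemma code_size_unit [simp]: "code_size (u :: unit) = 0"
  by (simp add: encode_unit_def)

lemma code_size_prod [simp]: "code_size (x, y) = code_size x + code_size y"
  by (simp add: encode_prod_def)

text \<open>Each binary digit occupies two bits, a continuation mark and the digit itself, and the
  end mark one more.\<close>

lemma code_size_nat_le: "n < 2 ^ k \<Longrightarrow> code_size (n :: nat) \<le> 2 * k + 1"
proof (induction k arbitrary: n)
  case 0
  then show ?case by (simp add: code_size_0)
next
  case (Suc k)
  show ?case
  proof (cases "n = 0")
    case False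
    have "n div 2 < 2 ^ k" using Suc.prems by auto
    from Suc.IH[OF this] show ?thesis using False by (simp add: code_size_pos)
  qed (simp add: code_size_0)
qed

lemma less_power_code_size: "(n :: nat) < 2 ^ code_size n"
proof (induction n rule: less_induct)
  case (less n)
  show ?case
  proof (cases "n = 0")
    case False
    then have "n div 2 < 2 ^ code_size (n div 2)" using less[of "n div 2"] by simp
    then have "n < 2 * 2 ^ code_size (n div 2)" by linarith
    also have "\<dots> \<le> 2 ^ code_size n" using False by (simp add: code_size_pos)
    finally show ?thesis .
  qed (simp add: code_size_0)
qed

lemma code_size_nat_mono: "m \<le> n \<Longrightarrow> code_size (m :: nat) \<le> code_size n"
proof (induction n arbitrary: m rule: less_induct)
  case (less n)
  show ?case
  proof (cases "m = 0")
    case True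
    then show ?thesis by (cases "n = 0") (auto simp: code_size_0 code_size_pos)
  next
    case False
    then have "n > 0" using less.prems by simp
    have "code_size (m div 2) \<le> code_size (n div 2)"
      by (rule less.IH) (use \<open>n > 0\<close> less.prems div_le_mono in auto)
    then show ?thesis using False \<open>n > 0\<close> by (simp add: code_size_pos)
  qed
qed

lemma code_size_add: "code_size (a + b :: nat) \<le> 2 * (code_size a + code_size b) + 1"
proof (rule code_size_nat_le)
  have "a < 2 ^ code_size a" "b < 2 ^ code_size b" by (rule less_power_code_size)+
  then have "Suc a \<le> 2 ^ code_size a" "Suc b \<le> 2 ^ code_size b" by auto
  from mult_le_mono[OF this] show "a + b < 2 ^ (code_size a + code_size b)"
    by (simp add: power_add)
qed

lemma code_size_mult: "code_size (a * b :: nat) \<le> 2 * (code_size a + code_size b) + 1"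
proof (rule code_size_nat_le)
  have "a < 2 ^ code_size a" "b < 2 ^ code_size b" by (rule less_power_code_size)+
  then show "a * b < 2 ^ (code_size a + code_size b)"
    unfolding power_add by (intro mult_strict_mono) auto
qed

text \<open>Without its first mark, the code of a positive number is literally the code of the pair
  of its last digit and its half.\<close>

lemma npr_halve: "npr (\<lambda>(n :: nat) p. n > 0 \<and> p = (odd n, n div 2))"
proof (rule npr_strip[of True])
  fix n :: nat and w assume "encode n = True # w"
  then show "\<exists>p. (n > 0 \<and> p = (odd n, n div 2)) \<and> encode p = w"
    by (cases "n = 0") (auto simp: encode_nat_0 encode_nat_pos encode_prod_def encode_bool_def)
qed (auto simp: encode_nat_pos encode_prod_def encode_bool_def)

lemma np_zero: "np (\<lambda>n :: nat. n = 0)"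
  unfolding np_def
proof (rule npr_strip[of False])
  fix n :: nat and w assume "encode n = False # w"
  then show "\<exists>u :: unit. n = 0 \<and> encode u = w"
    by (cases "n = 0") (auto simp: encode_nat_0 encode_nat_pos encode_unit_def)
qed (auto simp: encode_nat_0 encode_unit_def)

lemma small_output_halve: "small_output (\<lambda>(n :: nat) p. n > 0 \<and> p = (odd n, n div 2))"
  by (rule small_outputI[OF _ pb_self]) (auto simp: code_size_pos)

lemma np_pos: "np (\<lambda>n :: nat. n \<noteq> 0)"
proof -
  have "npr (\<lambda>(n :: nat) (u :: unit). \<exists>p. (n > 0 \<and> p = (odd n, n div 2)) \<and> u = ())"
    by (rule npr_postcompose[OF npr_halve small_output_halve fp_const])
  then show ?thesis unfolding np_def by (rule npr_cong) auto
qed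

lemma fp_halve_prim: "fp (\<lambda>n :: nat. (odd n, n div 2))"
proof (rule fpI)
  have "npr (\<lambda>(n :: nat) p. (n = 0 \<and> p = (False, 0)) \<or> (n > 0 \<and> p = (odd n, n div 2)))"
    by (intro npr_union npr_halve npr_guard np_zero npr_fp small_output_fp fp_const)
  then show "npr (\<lambda>(n :: nat) p. p = (odd n, n div 2))" by (rule npr_cong) auto
  show "poly_bounded (\<lambda>n. code_size (odd n, n div 2)) (code_size :: nat \<Rightarrow> _)"
    by (rule pb_mono[OF pb_add[OF pb_const[of 1] pb_self]]) (simp add: code_size_nat_mono)
qed

lemma fp_odd: "fp f \<Longrightarrow> fp (\<lambda>x. odd (f x :: nat))"
  using fp_fst[OF fp_comp[OF fp_halve_prim]] by simp

lemma fp_half: "fp f \<Longrightarrow> fp (\<lambda>x. f x div 2 :: nat)"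
  using fp_snd[OF fp_comp[OF fp_halve_prim]] by simp

lemma fp_not: "fp P \<Longrightarrow> fp (\<lambda>x. \<not> P x)"
  by (rule fp_cong[OF fp_if[of P "\<lambda>_. False" "\<lambda>_. True"]]) (auto intro: fp_const)

lemma fp_disj: "fp P \<Longrightarrow> fp Q \<Longrightarrow> fp (\<lambda>x. P x \<or> Q x)"
  by (rule fp_cong[OF fp_if[of P "\<lambda>_. True" Q]]) (auto intro: fp_const)

lemma fp_bool_eq: "fp P \<Longrightarrow> fp Q \<Longrightarrow> fp (\<lambda>x. P x = (Q x :: bool))"
  by (rule fp_cong[OF fp_if[of P Q "\<lambda>x. \<not> Q x"]]) (auto intro: fp_not)

text \<open>One step of carry propagation on \<open>(carry, x, y, z)\<close>, checking a bit of \<open>z = x + y + carry\<close>.\<close>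

definition add_step :: "bool \<times> nat \<times> nat \<times> nat \<Rightarrow> bool \<times> nat \<times> nat \<times> nat \<Rightarrow> bool" where
  "add_step s s' \<longleftrightarrow>
     (fst (snd s) \<noteq> 0 \<or> fst (snd (snd s)) \<noteq> 0 \<or> snd (snd (snd s)) \<noteq> 0) \<and>
     odd (snd (snd (snd s))) = (odd (fst (snd s)) = (odd (fst (snd (snd s))) = fst s)) \<and>
     s' = ((odd (fst (snd s)) \<and> odd (fst (snd (snd s)))) \<or> (fst s \<and> (odd (fst (snd s)) \<or> odd (fst (snd (snd s))))),
           (fst (snd s) div 2, (fst (snd (snd s)) div 2, snd (snd (snd s)) div 2)))"

lemma add_step_correct:
  "add_step (c, x, y, z) (c', x', y', z') \<Longrightarrow> of_bool c' + x' + y' = z' \<longleftrightarrow> of_bool c + x + y = z"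
  unfolding add_step_def by (cases c; cases "odd x"; cases "odd y"; auto elim!: oddE evenE)

lemma add_step_exists:
  assumes "of_bool c + x + y = z" "z \<noteq> 0"
  shows "\<exists>c'. add_step (c, x, y, z) (c', x div 2, y div 2, z div 2)"
proof -
  have "odd z = (odd x = (odd y = c))" using assms(1) by (auto split: if_splits)
  then show ?thesis using assms(2) unfolding add_step_def by auto
qed

text \<open>Each step preserves the truth value of the equation, so reaching the zero state
  certifies it. Conversely, a true equation with \<open>z\<close> nonzero always admits a step, and
  \<open>z = 0\<close> forces the other entries to vanish.\<close>

lemma add_steps_iff: "add_step\<^sup>*\<^sup>* s (False, 0, 0, 0) \<longleftrightarrow> of_bool (fst s) + fst (snd s) + fst (snd (snd s)) = snd (snd (snd s))"
proof
  assume "add_step\<^sup>*\<^sup>* s (False, 0, 0, 0)"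
  then show "of_bool (fst s) + fst (snd s) + fst (snd (snd s)) = snd (snd (snd s))"
  proof (induction rule: converse_rtranclp_induct)
    case (step s s')
    then show ?case
      using add_step_correct[of "fst s" "fst (snd s)" "fst (snd (snd s))" "snd (snd (snd s))"
          "fst s'" "fst (snd s')" "fst (snd (snd s'))" "snd (snd (snd s'))"] by simp
  qed simp
next
  have "of_bool c + x + y = z \<Longrightarrow> add_step\<^sup>*\<^sup>* (c, x, y, z) (False, 0, 0, 0)" for c x y z
  proof (induction z arbitrary: c x y rule: less_induct)
    case (less z)
    show ?case
    proof (cases "z = 0")
      case True
      then show ?thesis using less.prems by (cases c) auto
    next
      case False
      from add_step_exists[OF less.prems False] obtain c' where
        s: "add_step (c, x, y, z) (c', x div 2, y div 2, z div 2)" by blast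
      have "add_step\<^sup>*\<^sup>* (c', x div 2, y div 2, z div 2) (False, 0, 0, 0)"
        by (rule less.IH) (use False add_step_correct[OF s] less.prems in auto)
      with s show ?thesis by (rule converse_rtranclp_into_rtranclp)
    qed
  qed
  moreover assume "of_bool (fst s) + fst (snd s) + fst (snd (snd s)) = snd (snd (snd s))"
  ultimately show "add_step\<^sup>*\<^sup>* s (False, 0, 0, 0)" by (metis prod.collapse)
qed

lemma np_add_prim: "np (\<lambda>p. fst p + fst (snd p) = (snd (snd p) :: nat))"
proof -
  have step: "npr add_step"
  proof -
    let ?f = "\<lambda>s. ((odd (fst (snd s)) \<and> odd (fst (snd (snd s)))) \<or> (fst s \<and> (odd (fst (snd s)) \<or> odd (fst (snd (snd s))))),
           (fst (snd s) div 2, (fst (snd (snd s)) div 2, snd (snd (snd s)) div 2)))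
           :: bool \<times> nat \<times> nat \<times> nat"
    have f: "fp ?f" by (intro fp_intros fp_odd fp_half fp_disj)
    have par: "np (\<lambda>s :: bool \<times> nat \<times> nat \<times> nat. odd (snd (snd (snd s))) = (odd (fst (snd s)) = (odd (fst (snd (snd s))) = fst s)))"
      by (intro np_if_fp fp_bool_eq fp_odd fp_intros)
    have nz: "np (\<lambda>s :: bool \<times> nat \<times> nat \<times> nat. fst (snd s) \<noteq> 0 \<or> fst (snd (snd s)) \<noteq> 0 \<or> snd (snd (snd s)) \<noteq> 0)"
      by (intro np_disj np_comp[OF np_pos] fp_intros)
    have "npr (\<lambda>s s'. ((fst (snd s) \<noteq> 0 \<or> fst (snd (snd s)) \<noteq> 0 \<or> snd (snd (snd s)) \<noteq> 0) \<and>
       odd (snd (snd (snd s))) = (odd (fst (snd s)) = (odd (fst (snd (snd s))) = fst s))) \<and> s' = ?f s)"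
      by (rule npr_guard[OF np_conj[OF nz par] npr_fp[OF f] small_output_fp[OF f]])
    then show ?thesis by (rule npr_cong) (auto simp: add_step_def)
  qed
  have "npr add_step\<^sup>*\<^sup>*"
  proof (rule npr_star_decreasing[OF step])
    have le: "code_size (n div 2) \<le> code_size n" for n :: nat by (rule code_size_nat_mono) simp
    have less: "n > 0 \<Longrightarrow> code_size (n div 2) < code_size n" for n :: nat by (simp add: code_size_pos)
    fix s s' assume "add_step s s'"
    moreover obtain c x y z where s: "s = (c, x, y, z)" by (cases s)
    ultimately have "x > 0 \<or> y > 0 \<or> z > 0" "s' = (fst s', x div 2, y div 2, z div 2)"
      by (auto simp: add_step_def)
    moreover obtain c' where "fst s' = c'" by blast
    ultimately show "code_size s' < code_size s"
      using le[of x] le[of y] le[of z] less[of x] less[of y] less[of z] s by auto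
  qed
  moreover have "np (\<lambda>s :: bool \<times> nat \<times> nat \<times> nat. s = (False, 0, 0, 0))"
  proof -
    have "np (\<lambda>s :: bool \<times> nat \<times> nat \<times> nat. \<not> fst s \<and> fst (snd s) = 0 \<and> fst (snd (snd s)) = 0 \<and> snd (snd (snd s)) = 0)"
      by (intro np_conj np_comp[OF np_zero] np_not_if_fp fp_intros)
    then show ?thesis by (rule back_subst[of np]) (auto simp: fun_eq_iff prod_eq_iff)
  qed
  ultimately have "npr (\<lambda>s (u :: unit). \<exists>s'. add_step\<^sup>*\<^sup>* s s' \<and> s' = (False, 0, 0, 0))"
    unfolding np_def
    by (rule npr_compose[where B = "\<lambda>_. code_size (False, 0 :: nat, 0 :: nat, 0 :: nat)"]) (auto intro: pb_const)
  then have "np (\<lambda>s :: bool \<times> nat \<times> nat \<times> nat. of_bool (fst s) + fst (snd s) + fst (snd (snd s)) = snd (snd (snd s)))"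
    unfolding np_def by (rule npr_cong) (metis add_steps_iff)
  then have "np (\<lambda>p :: nat \<times> nat \<times> nat. (\<lambda>s. of_bool (fst s) + fst (snd s) + fst (snd (snd s)) = snd (snd (snd s))) (False, p))"
    by (rule np_comp) (intro fp_intros)
  then show ?thesis by simp
qed

lemma np_add: "fp f \<Longrightarrow> fp g \<Longrightarrow> fp h \<Longrightarrow> np (\<lambda>x. f x + g x = (h x :: nat))"
  using np_comp[OF np_add_prim, of "\<lambda>x. (f x, (g x, h x))"] by (simp add: fp_pair)

lemma fp_add:
  assumes "fp f" "fp g"
  shows "fp (\<lambda>x. f x + g x :: nat)"
proof -
  have "fp (\<lambda>p. fst p + snd p :: nat)"
  proof (rule fp_of_np)
    have "np (\<lambda>q. fst (snd q) + snd (snd q) = (fst q :: nat))"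
      by (intro np_add fp_intros)
    then show "np (\<lambda>q :: nat \<times> nat \<times> nat. fst q = fst (snd q) + snd (snd q))"
      by (rule back_subst[of np]) auto
    show "poly_bounded (\<lambda>p. code_size (fst p + snd p)) (code_size :: nat \<times> nat \<Rightarrow> nat)"
    proof (rule pb_mono)
      show "poly_bounded (\<lambda>p. 2 * code_size p + 1) (code_size :: nat \<times> nat \<Rightarrow> nat)"
        by (intro pb_add pb_mult pb_const pb_self)
      show "code_size (fst p + snd p) \<le> 2 * code_size p + 1" for p :: "nat \<times> nat"
        using code_size_add[of "fst p" "snd p"] by (cases p) simp
    qed
  qed
  from fp_comp[OF this fp_pair[OF assms]] show ?thesis by simp
qed

lemma np_nat_eq: "fp f \<Longrightarrow> fp g \<Longrightarrow> np (\<lambda>x. f x = (g x :: nat))"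
  using np_add[of f "\<lambda>_. 0" g] by (simp add: fp_const)

lemma np_nat_less:
  assumes "fp f" "fp g"
  shows "np (\<lambda>x. f x < (g x :: nat))"
proof -
  have "np (\<lambda>p. \<exists>d. fst p + 1 + d = (snd p :: nat))"
  proof (rule np_ex[where B = code_size])
    show "np (\<lambda>p. fst (snd p) + 1 + fst p = (snd (snd p) :: nat))"
      by (intro np_add fp_add fp_intros)
    fix x :: "nat \<times> nat" and d assume "fst x + 1 + d = snd x"
    moreover from this have "d \<le> snd x" by simp
    from code_size_nat_mono[OF this] have "code_size d \<le> code_size x" by (cases x) auto
    ultimately show "\<exists>d. fst x + 1 + d = snd x \<and> code_size d \<le> code_size x" by blast
  qed (rule pb_self)
  then have "np (\<lambda>x. (\<lambda>p. \<exists>d. fst p + 1 + d = (snd p :: nat)) (f x, g x))"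
    by (rule np_comp) (intro fp_pair assms)
  moreover have "(\<exists>d. a + 1 + d = b) = (a < b)" for a b :: nat
    by (auto intro: exI[of _ "b - a - 1"])
  ultimately show ?thesis by simp
qed

text \<open>The answer that two numbers differ is certified by their order.\<close>

lemma fp_nat_eq: "fp f \<Longrightarrow> fp g \<Longrightarrow> fp (\<lambda>x. f x = (g x :: nat))"
proof (rule fp_decide)
  assume fg: "fp f" "fp g"
  show "np (\<lambda>x. f x = g x)" by (rule np_nat_eq[OF fg])
  have "np (\<lambda>x. f x < g x \<or> g x < f x)" using fg by (intro np_disj np_nat_less)
  then show "np (\<lambda>x. f x \<noteq> g x)" by (rule back_subst[of np]) (auto simp: fun_eq_iff)
qed

lemma fp_pred:
  assumes "fp f"
  shows "fp (\<lambda>x. f x - 1 :: nat)"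
proof -
  have "fp (\<lambda>n :: nat. n - 1)"
  proof (rule fp_of_np)
    have "np (\<lambda>p. (snd p = 0 \<and> fst p = 0) \<or> fst p + 1 = (snd p :: nat))"
      by (intro np_disj np_conj np_nat_eq np_add fp_intros)
    then show "np (\<lambda>p. fst p = snd p - (1 :: nat))" by (rule back_subst[of np]) (auto simp: fun_eq_iff)
    show "poly_bounded (\<lambda>n :: nat. code_size (n - 1)) code_size"
      by (rule pb_le) (rule code_size_nat_mono, simp)
  qed
  from fp_comp[OF this assms] show ?thesis by simp
qed

lemma code_size_append: "code_size (xs @ ys) + 1 = code_size xs + code_size (ys :: 'a::codable list)"
  by (induction xs) auto

lemma code_size_rev [simp]: "code_size (rev xs) = code_size (xs :: 'a::codable list)"
proof (induction xs)
  case (Cons x xs)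
  then show ?case using code_size_append[of "rev xs" "[x]"] by simp
qed simp

lemma foldl_snoc: "foldl (\<lambda>acc y. g y # acc) acc xs = rev (map g xs) @ acc"
  by (induction xs arbitrary: acc) auto

lemma fp_rev:
  assumes "fp l"
  shows "fp (\<lambda>x. rev (l x))"
proof -
  have "fp (\<lambda>x. foldl ((\<lambda>_ acc y. y # acc) x) [] (l x))"
  proof (rule fp_foldl[where f = "\<lambda>_ acc y. y # acc", OF assms fp_const])
    fix x ys zs assume "l x = ys @ zs"
    then show "code_size (foldl (\<lambda>acc y. y # acc) [] ys) \<le> code_size (l x)"
      using code_size_append[of ys zs] by (cases zs) (auto simp: foldl_snoc[of "\<lambda>y. y", simplified])
  qed (intro fp_intros fp_size assms)+
  then show ?thesis by (simp add: foldl_snoc[of "\<lambda>y. y", simplified])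
qed

section \<open>Multiplication, remainder and modular powers by binary digits\<close>

lemma fp_bits: "fp f \<Longrightarrow> fp (\<lambda>x. bits (f x))"
proof -
  have "encode (bits n) = encode n" for n
    by (simp add: encode_list_def encode_nat_def enc_nat_def encode_bool_def[abs_def])
  then have "fp bits" by (rule fp_recode)
  then show "fp f \<Longrightarrow> fp (\<lambda>x. bits (f x))" by (rule fp_comp)
qed

lemma bits_0 [simp]: "bits 0 = []"
  by (subst bits.simps) simp

lemma bits_pos: "n > 0 \<Longrightarrow> bits n = odd n # bits (n div 2)"
  by (subst bits.simps) simp

text \<open>Horner's scheme, with the most significant digit first.\<close>

definition mult_by_bits :: "nat \<Rightarrow> bool list \<Rightarrow> nat" where
  "mult_by_bits y = foldl (\<lambda>a b. a + a + (if b then y else 0)) 0"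

lemma mult_by_bits: "mult_by_bits y (rev (bits x)) = x * y"
proof (induction x rule: less_induct)
  case (less x)
  show ?case
  proof (cases "x = 0")
    case False
    have x: "x = 2 * (x div 2) + of_bool (odd x)" by (cases "odd x") auto
    have "mult_by_bits y (rev (bits x)) = 2 * (x div 2 * y) + (if odd x then y else 0)"
      using less[of "x div 2"] False by (simp add: mult_by_bits_def bits_pos)
    also have "\<dots> = (2 * (x div 2) + of_bool (odd x)) * y" by (simp add: algebra_simps)
    finally show ?thesis using x by simp
  qed (simp add: mult_by_bits_def)
qed

text \<open>Horner values never decrease, so the final product bounds all accumulators.\<close>

lemma mult_by_bits_prefix: "mult_by_bits y bs \<le> mult_by_bits y (bs @ cs)"
proof -
  have "a \<le> foldl (\<lambda>a b. a + a + (if b then y else 0)) a cs" for a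
  proof (induction cs arbitrary: a)
    case (Cons c cs)
    have "a \<le> a + a + (if c then y else 0)" by simp
    also have "\<dots> \<le> foldl (\<lambda>a b. a + a + (if b then y else 0)) (a + a + (if c then y else 0)) cs" by (rule Cons)
    finally show ?case by simp
  qed simp
  then show ?thesis by (simp add: mult_by_bits_def)
qed

lemma fp_mult:
  assumes "fp f" "fp g"
  shows "fp (\<lambda>x. f x * g x :: nat)"
proof -
  have "fp (\<lambda>p. foldl ((\<lambda>p a b. a + a + (if b then snd p else 0)) p) (0 :: nat) (rev (bits (fst p))))"
  proof (rule fp_foldl[where B = "\<lambda>p. 2 * code_size p + 1" and f = "\<lambda>p a b. a + a + (if b then snd p else 0)"])
    fix p :: "nat \<times> nat" and ys zs assume "rev (bits (fst p)) = ys @ zs"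
    with mult_by_bits_prefix[of "snd p" ys zs] mult_by_bits[of "snd p" "fst p"]
    have "mult_by_bits (snd p) ys \<le> fst p * snd p" by simp
    then have "code_size (mult_by_bits (snd p) ys) \<le> code_size (fst p * snd p)" by (rule code_size_nat_mono)
    also have "\<dots> \<le> 2 * code_size p + 1" using code_size_mult[of "fst p" "snd p"] by (cases p) simp
    finally show "code_size (foldl (\<lambda>a b. a + a + (if b then snd p else 0)) 0 ys) \<le> 2 * code_size p + 1"
      by (simp add: mult_by_bits_def)
  qed (intro fp_rev fp_bits fp_intros fp_add pb_add pb_mult pb_const pb_self)+
  then have "fp (\<lambda>p :: nat \<times> nat. fst p * snd p)"
    by (rule fp_cong) (use mult_by_bits in \<open>simp add: mult_by_bits_def\<close>)
  from fp_comp[OF this fp_pair[OF assms]] show ?thesis by simp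
qed

text \<open>The quotient is guessed. It is at most the dividend, hence small.\<close>

lemma fp_mod:
  assumes "fp f" "fp g"
  shows "fp (\<lambda>x. f x mod g x :: nat)"
proof -
  have "fp (\<lambda>p. fst p mod snd p :: nat)"
  proof (rule fp_of_np)
    have "np (\<lambda>r. \<exists>q. q * snd (snd r) + fst r = (fst (snd r) :: nat) \<and> fst r < snd (snd r))"
    proof (rule np_ex[where B = code_size])
      show "np (\<lambda>p. fst p * snd (snd (snd p)) + fst (snd p) = (fst (snd (snd p)) :: nat) \<and> fst (snd p) < snd (snd (snd p)))"
        by (intro np_conj np_add np_nat_less fp_mult fp_intros)
      fix r :: "nat \<times> nat \<times> nat" and q
      assume a: "q * snd (snd r) + fst r = fst (snd r) \<and> fst r < snd (snd r)"
      then have "q * 1 \<le> q * snd (snd r)" by (intro mult_le_mono2) auto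
      with a have "q \<le> fst (snd r)" by linarith
      from code_size_nat_mono[OF this] have "code_size q \<le> code_size r" by (cases r) auto
      with a show "\<exists>q. (q * snd (snd r) + fst r = fst (snd r) \<and> fst r < snd (snd r)) \<and> code_size q \<le> code_size r" by blast
    qed (rule pb_self)
    \<comment> \<open>For modulus 0 the convention \<open>b mod 0 = b\<close> has to be reproduced
      separately.\<close>
    then have "np (\<lambda>r. (snd (snd r) = 0 \<and> fst r = (fst (snd r) :: nat)) \<or>
        (\<exists>q. q * snd (snd r) + fst r = (fst (snd r) :: nat) \<and> fst r < snd (snd r)))"
      by (intro np_disj np_conj np_nat_eq fp_intros)
    then show "np (\<lambda>r. fst r = fst (snd r) mod (snd (snd r) :: nat))"
    proof (rule back_subst[of np], intro ext)
      fix r :: "nat \<times> nat \<times> nat"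
      obtain a b m where r: "r = (a, b, m)" by (cases r)
      have "a = b mod m \<longleftrightarrow> (m = 0 \<and> a = b) \<or> (\<exists>q. q * m + a = b \<and> a < m)"
      proof (cases "m = 0")
        case False
        have "b div m * m + b mod m = b" by simp
        then show ?thesis using False by (auto intro!: exI[of _ "b div m"])
      qed auto
      then show "(snd (snd r) = 0 \<and> fst r = fst (snd r) \<or> (\<exists>q. q * snd (snd r) + fst r = fst (snd r) \<and> fst r < snd (snd r))) =
        (fst r = fst (snd r) mod snd (snd r))" by (simp add: r)
    qed
    show "poly_bounded (\<lambda>p. code_size (fst p mod snd p)) (code_size :: nat \<times> nat \<Rightarrow> nat)"
    proof (rule pb_le)
      fix p :: "nat \<times> nat"
      have "code_size (fst p mod snd p) \<le> code_size (fst p)" by (rule code_size_nat_mono) simp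
      then show "code_size (fst p mod snd p) \<le> code_size p" by (cases p) simp
    qed
  qed
  from fp_comp[OF this fp_pair[OF assms]] show ?thesis by simp
qed

text \<open>The modulus is \<open>N + 2\<close>, so that it is at least 2 for every \<open>N\<close>.\<close>

definition power_mod :: "nat \<Rightarrow> nat \<Rightarrow> nat \<Rightarrow> nat" where
  "power_mod N x e = foldl (\<lambda>a b. a * a * (if b then x else 1) mod (N + 2)) 1 (rev (bits e))"

text \<open>The last digit folded is the lowest one, so a fold step matches halving the exponent.
  The start value 1 is already reduced because the modulus is at least 2.\<close>

lemma power_mod: "power_mod N x e = x ^ e mod (N + 2)"
proof (induction e rule: less_induct)
  case (less e)
  show ?case
  proof (cases "e = 0")
    case False
    let ?h = "e div 2"
    have e: "e = 2 * ?h + of_bool (odd e)" by (cases "odd e") auto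
    have "power_mod N x e = (x ^ ?h mod (N + 2)) * (x ^ ?h mod (N + 2)) * (if odd e then x else 1) mod (N + 2)"
      using less[of ?h] False by (simp add: power_mod_def bits_pos)
    also have "\<dots> = x ^ ?h * x ^ ?h * (if odd e then x else 1) mod (N + 2)"
      by (metis mod_mult_left_eq mod_mult_eq)
    also have "x ^ ?h * x ^ ?h * (if odd e then x else 1) = x ^ (2 * ?h + of_bool (odd e))"
      by (simp add: power_add power_mult power2_eq_square flip: power_mult_distrib)
    finally show ?thesis using e by simp
  qed (simp add: power_mod_def)
qed

lemma fp_power_mod:
  assumes "fp n" "fp f" "fp g"
  shows "fp (\<lambda>x. power_mod (n x) (f x) (g x))"
  unfolding power_mod_def
proof (rule fp_foldl[where B = "\<lambda>x. code_size (n x + 2)" and f = "\<lambda>x a b. a * a * (if b then f x else 1) mod (n x + 2)"])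
  show "fp (\<lambda>p. snd (snd p) * snd (snd p) * (if fst (snd p) then f (fst p) else 1) mod (n (fst p) + 2))"
    by (intro fp_mod fp_mult fp_add fp_intros fp_comp[OF assms(1)] fp_comp[OF assms(2)])
  fix x ys zs
  have "foldl (\<lambda>a b. a * a * (if b then f x else 1) mod (n x + 2)) a ys \<le> n x + 2" if "a \<le> n x + 2" for a
    using that by (induction ys arbitrary: a) auto
  then show "code_size (foldl (\<lambda>a b. a * a * (if b then f x else 1) mod (n x + 2)) 1 ys) \<le> code_size (n x + 2)"
    by (intro code_size_nat_mono) auto
qed (intro fp_rev fp_bits fp_const assms fp_size fp_add)+

subsection \<open>List functions\<close>

lemma length_le_code_size: "length xs \<le> code_size (xs :: 'a::codable list)"
  by (induction xs) auto

lemma code_size_list_le: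
  "(\<And>y. y \<in> set ys \<Longrightarrow> code_size (y :: 'a::codable) \<le> b) \<Longrightarrow> code_size ys \<le> 1 + length ys * (1 + b)"
proof (induction ys)
  case (Cons y ys)
  then have "code_size y \<le> b" "code_size ys \<le> 1 + length ys * (1 + b)" by simp_all
  then show ?case by simp
qed simp

lemma code_size_member: "y \<in> set ys \<Longrightarrow> code_size (y :: 'a::codable) \<le> code_size ys"
  by (induction ys) auto

lemma fp_map:
  assumes g: "fp (\<lambda>p. g (fst p) (snd p))" and l: "fp l"
  shows "fp (\<lambda>x. map (g x) (l x))"
proof -
  obtain k where k: "\<And>p. code_size (g (fst p) (snd p)) \<le> (code_size p + 2) ^ k"
    using fp_size[OF g] unfolding poly_bounded_def by blast
  let ?B = "\<lambda>x. 1 + code_size (l x) * (1 + (code_size x + code_size (l x) + 2) ^ k)"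
  have "fp (\<lambda>x. foldl ((\<lambda>x acc y. g x y # acc) x) [] (l x))"
  proof (rule fp_foldl[where B = ?B and f = "\<lambda>x acc y. g x y # acc", OF l fp_const])
    show "fp (\<lambda>p. g (fst p) (fst (snd p)) # snd (snd p))"
      using fp_Cons[OF fp_comp[OF g, of "\<lambda>p. (fst p, fst (snd p))"] fp_snd[OF fp_snd[OF fp_id]]]
      by (simp add: fp_intros)
    fix x ys zs assume l: "l x = ys @ zs"
    have "code_size (map (g x) ys) \<le> 1 + length (map (g x) ys) * (1 + (code_size x + code_size (l x) + 2) ^ k)"
    proof (rule code_size_list_le)
      fix z assume "z \<in> set (map (g x) ys)"
      then obtain y where y: "y \<in> set (l x)" "z = g x y" using l by auto
      have "code_size (g x y) \<le> (code_size (x, y) + 2) ^ k" using k[of "(x, y)"] by simp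
      also have "\<dots> \<le> (code_size x + code_size (l x) + 2) ^ k"
        by (rule power_mono) (use code_size_member[OF y(1)] in auto)
      finally show "code_size z \<le> (code_size x + code_size (l x) + 2) ^ k" by (simp add: y(2))
    qed
    also have "\<dots> \<le> ?B x"
      using length_le_code_size[of "l x"] l by (intro add_mono mult_le_mono) auto
    finally show "code_size (foldl (\<lambda>acc y. g x y # acc) [] ys) \<le> ?B x" by (simp add: foldl_snoc)
  qed (intro pb_add pb_mult pb_const pb_power pb_self fp_size l)
  from fp_rev[OF this] show ?thesis by (simp add: foldl_snoc)
qed

lemma fp_length:
  assumes "fp l"
  shows "fp (\<lambda>x. length (l x))"
proof -
  have len: "foldl (\<lambda>n _. Suc n) a ys = a + length ys" for a :: nat and ys :: "'b list"
    by (induction ys arbitrary: a) auto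
  have "fp (\<lambda>x. foldl ((\<lambda>_ n _. n + 1) x) (0 :: nat) (l x))"
  proof (rule fp_foldl[where f = "\<lambda>_ n _. n + 1" and B = "\<lambda>x. 2 * code_size (l x) + 1", OF assms fp_const])
    fix x ys zs assume l: "l x = ys @ zs"
    have "length ys < 2 ^ length ys" by (rule less_exp)
    from code_size_nat_le[OF this] show "code_size (foldl (\<lambda>n _. n + 1) (0 :: nat) ys) \<le> 2 * code_size (l x) + 1"
      using length_le_code_size[of "l x"] l by (simp add: len)
  qed (intro fp_intros fp_add pb_add pb_mult pb_const fp_size assms)+
  then show ?thesis by (simp add: len)
qed

lemma fp_list_all:
  assumes "fp (\<lambda>p. P (fst p) (snd p))" "fp l"
  shows "fp (\<lambda>x. list_all (P x) (l x))"
proof -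
  have all: "foldl (\<lambda>a y. a \<and> P x y) a ys = (a \<and> list_all (P x) ys)" for a ys x
    by (induction ys arbitrary: a) auto
  have "fp (\<lambda>x. foldl ((\<lambda>x a y. a \<and> P x y) x) True (l x))"
  proof (rule fp_foldl[where f = "\<lambda>x a y. a \<and> P x y" and B = "\<lambda>_. 1", OF assms(2) fp_const])
    show "fp (\<lambda>p. snd (snd p) \<and> P (fst p) (fst (snd p)))"
      using fp_conj[OF fp_snd[OF fp_snd[OF fp_id]] fp_comp[OF assms(1), of "\<lambda>p. (fst p, fst (snd p))"]]
      by (simp add: fp_intros)
  qed (auto intro: pb_const)
  then show ?thesis by (simp add: all)
qed

text \<open>The condition also sees the tail of \<open>ys\<close> behind the current entry; in this
  way a single pass reaches all matrix entries on one side of the diagonal. A longer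
  \<open>ys\<close> is tolerated, a shorter one is not.\<close>

fun all_pairs :: "('a \<Rightarrow> 'b \<Rightarrow> 'b list \<Rightarrow> bool) \<Rightarrow> 'a list \<Rightarrow> 'b list \<Rightarrow> bool" where
  "all_pairs c [] ys = True"
| "all_pairs c (x # xs) [] = False"
| "all_pairs c (x # xs) (y # ys) = (c x y ys \<and> all_pairs c xs ys)"

lemma all_pairs_iff:
  "all_pairs c xs ys \<longleftrightarrow> length xs \<le> length ys \<and> (\<forall>i<length xs. c (xs ! i) (ys ! i) (drop (Suc i) ys))"
proof (induction c xs ys rule: all_pairs.induct)
  case (3 c x xs y ys)
  then show ?case by (auto simp: less_Suc_eq_0_disj)
qed auto

lemma fp_all_pairs:
  assumes c: "fp (\<lambda>p. c (fst p) (fst (snd p)) (fst (snd (snd p))) (snd (snd (snd p))))"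
    and xs: "fp xs" and ys: "fp ys"
  shows "fp (\<lambda>z. all_pairs (c z) (xs z) (ys z))"
proof -
  let ?step = "\<lambda>z s x. case snd s of [] \<Rightarrow> (False, []) | y # ys \<Rightarrow> (fst s \<and> c z x y ys, ys)"
  have all: "fst (foldl (?step z) (a, us) vs) = (a \<and> all_pairs (c z) vs us)" for a us vs z
  proof (induction vs arbitrary: a us)
    case (Cons v vs)
    have f: "fst (foldl (?step z) (False, us) vs) = False" for us using Cons[of False] by simp
    show ?case by (cases us) (simp_all add: Cons)
  qed simp
  have size: "code_size (foldl (?step z) (a, us) vs) \<le> code_size us + 1" for a us vs z
  proof (induction vs arbitrary: a us)
    case (Cons v vs)
    show ?case
    proof (cases us)
      case Nil
      then show ?thesis using Cons[of False "[]"] by simp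
    next
      case (Cons u us')
      then show ?thesis using Cons.IH[of "a \<and> c z v u us'" us'] by simp
    qed
  qed simp
  have "fp (\<lambda>z. foldl (?step z) (True, ys z) (xs z))"
  proof (rule fp_foldl[where f = ?step and B = "\<lambda>z. code_size (ys z) + 1", OF xs])
    have "fp (\<lambda>q. c (fst (fst q)) (fst (snd (fst q))) (fst (snd q)) (snd (snd q)))"
      using fp_comp[OF c, of "\<lambda>q. (fst (fst q), (fst (snd (fst q)), (fst (snd q), snd (snd q))))"]
      by (simp add: fp_intros)
    then show "fp (\<lambda>p. ?step (fst p) (snd (snd p)) (fst (snd p)))"
      by (intro fp_case_list fp_intros)
    show "code_size (foldl (?step z) (True, ys z) us) \<le> code_size (ys z) + 1" for z us by (rule size)
  qed (intro fp_intros ys pb_add pb_const fp_size)+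
  from fp_fst[OF this] show ?thesis by (simp add: all)
qed

text \<open>Index sets become bit masks, which are lists of codable values and can be
  guessed.\<close>

fun select :: "bool list \<Rightarrow> 'a list \<Rightarrow> 'a list" where
  "select w [] = []"
| "select [] (x # xs) = []"
| "select (b # w) (x # xs) = (if b then x # select w xs else select w xs)"

lemma select_eq_nths: "select w xs = nths xs {i. i < length w \<and> w ! i}"
proof (induction w xs rule: select.induct)
  case (3 b w x xs)
  have "{j. Suc j \<in> {i. i < length (b # w) \<and> (b # w) ! i}} = {i. i < length w \<and> w ! i}" by auto
  then show ?case using 3 by (auto simp: nths_Cons)
qed auto

lemma fp_select:
  assumes w: "fp w" and xs: "fp xs"
  shows "fp (\<lambda>z. select (w z) (xs z))"
proof -
  let ?step = "\<lambda>s x. case fst s of [] \<Rightarrow> ([], snd s) | b # w \<Rightarrow> (w, if b then x # snd s else snd s)"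
  have sel: "snd (foldl ?step (u, acc) vs) = rev (select u vs) @ acc" for u acc and vs :: "'b list"
  proof (induction vs arbitrary: u acc)
    case (Cons v vs)
    have "rev (select [] vs) = []" by (cases vs) auto
    then show ?case by (cases u) (simp_all add: Cons)
  qed simp
  have size: "code_size (foldl ?step (u, acc) vs) + 1 \<le> code_size u + code_size acc + code_size vs"
    for u acc and vs :: "'b list"
  proof (induction vs arbitrary: u acc)
    case (Cons v vs)
    show ?case
    proof (cases u)
      case Nil
      then show ?thesis using Cons[of "[]" acc] by simp
    next
      case (Cons b u')
      then show ?thesis using Cons.IH[of u' acc] Cons.IH[of u' "v # acc"] by (cases b) auto
    qed
  qed simp
  have "fp (\<lambda>z. foldl ((\<lambda>_. ?step) z) (w z, []) (xs z))"
  proof (rule fp_foldl[where f = "\<lambda>_. ?step" and B = "\<lambda>z. code_size (w z) + 1 + code_size (xs z)", OF xs])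
    show "fp (\<lambda>p. ?step (snd (snd p)) (fst (snd p)))"
      by (intro fp_case_list fp_intros)
    fix z us vs assume "xs z = us @ vs"
    then have "code_size us \<le> code_size (xs z)" using code_size_append[of us vs] by (cases vs) auto
    then show "code_size (foldl ?step (w z, []) us) \<le> code_size (w z) + 1 + code_size (xs z)"
      using size[of "w z" "[]" us] by simp
  qed (intro fp_case_list fp_intros w pb_add pb_const fp_size xs)+
  from fp_rev[OF fp_snd[OF this]] show ?thesis by (simp add: sel)
qed

section \<open>The verifier\<close>

text \<open>The program guesses \<open>g\<close> itself and then runs the nondeterministic
  \<open>chk\<close>. The certificate of the machine records all choices of this run, so
  \<open>g\<close> is only a part of it.\<close>

theorem promise_NP_if_fp:
  fixes chk :: "'g::codable \<times> 'x::codable \<Rightarrow> bool" and input :: "'i \<Rightarrow> 'x"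
  assumes "fp chk"
    and enc: "\<And>I. e I = encode (input I)"
    and sound: "\<And>I g. P I \<Longrightarrow> chk (g, input I) \<Longrightarrow> Y I"
    and complete: "\<And>I. P I \<Longrightarrow> Y I \<Longrightarrow> \<exists>g. chk (g, input I) \<and> code_size g \<le> (code_size (input I) + 2) ^ k"
  shows "promise_NP e P Y"
proof -
  obtain c i where c: "implements c i (\<lambda>(x :: 'x) (p :: 'g \<times> 'x). snd p = x)"
    using npr_guess unfolding npr_def by blast
  obtain d j where d: "implements d j (\<lambda>p (u :: unit). chk p)"
    using np_if_fp[OF assms(1)] unfolding np_def npr_def by blast
  let ?G = "\<lambda>n. (n + 2) ^ k"
  let ?T = "\<lambda>n. Suc ((n + (?G n + n) + 2) ^ i + (?G n + n + 2) ^ j)"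
  have "poly_bounded (\<lambda>n. 1 + ((n + (?G n + n) + 2) ^ i + (?G n + n + 2) ^ j)) (\<lambda>n. n)"
    by (intro pb_add pb_power pb_const pb_self)
  then obtain l where l: "\<And>n. ?T n \<le> (n + 2) ^ l" unfolding poly_bounded_def by auto
  show ?thesis
  proof (rule promise_NP_if_run[where c = "c ;; d" and k = l])
    fix I t s' assume P: "P I" and r: "run (c ;; d) (clean (e I)) t s'"
    then obtain t1 t2 s1 where 1: "run c (clean (encode (input I))) t1 s1" "run d s1 t2 s'" unfolding enc by blast
    from implements_sound[OF c 1(1)] obtain p :: "'g \<times> 'x" where p: "snd p = input I" "s1 = clean (encode p)" by blast
    from implements_sound[OF d 1(2)[unfolded p(2)]] have "chk p" by blast
    then have "chk (fst p, input I)" using p(1) by (metis prod.collapse)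
    then show "Y I" by (rule sound[OF P])
  next
    fix I assume "P I" "Y I"
    from complete[OF this] obtain g where g: "chk (g, input I)" "code_size g \<le> ?G (code_size (input I))" by blast
    let ?x = "input I"
    have "snd (g, ?x) = ?x" by simp
    from implements_complete[OF c this] obtain t1 where t1: "t1 \<le> (code_size ?x + code_size (g, ?x) + 2) ^ i"
      "run c (clean (encode ?x)) t1 (clean (encode (g, ?x)))" by blast
    from implements_complete[OF d g(1), of "()"] obtain t2 where t2: "t2 \<le> (code_size (g, ?x) + code_size () + 2) ^ j"
      "run d (clean (encode (g, ?x))) t2 (clean (encode ()))" by blast
    have "(code_size ?x + code_size (g, ?x) + 2) ^ i \<le> (code_size ?x + (?G (code_size ?x) + code_size ?x) + 2) ^ i"
      "(code_size (g, ?x) + code_size () + 2) ^ j \<le> (?G (code_size ?x) + code_size ?x + 2) ^ j"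
      using g(2) by (auto intro!: power_mono)
    with t1(1) t2(1) have "Suc (t1 + t2) \<le> ?T (code_size ?x)" by linarith
    also have "\<dots> \<le> (code_size ?x + 2) ^ l" by (rule l)
    finally have "Suc (t1 + t2) \<le> (length (e I) + 2) ^ l" by (simp add: enc)
    moreover have "run (c ;; d) (clean (e I)) (Suc (t1 + t2)) (clean (encode ()))"
      unfolding enc by (rule run_Seq[OF t1(2) t2(2)])
    ultimately show "\<exists>t s'. t \<le> (length (e I) + 2) ^ l \<and> run (c ;; d) (clean (e I)) t s'" by (intro exI conjI)
  qed
qed

type_synonym rat_code = "(bool \<times> nat) \<times> (bool \<times> nat)"

text \<open>
  \<open>residue N c\<close> is the numerator times the \<open>N\<close>-th power of the denominator. If \<open>N + 2\<close> is prime
  then this power is the inverse by Fermat's theorem; in general \<open>unit_denominator\<close> tests it.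
\<close>

definition residue :: "nat \<Rightarrow> rat_code \<Rightarrow> nat" where
  "residue N c = snd (fst c) * (if fst (fst c) then N + 1 else 1) * power_mod N (snd (snd c)) N mod (N + 2)"

definition unit_denominator :: "nat \<Rightarrow> rat_code \<Rightarrow> bool" where
  "unit_denominator N c \<longleftrightarrow> snd (snd c) * power_mod N (snd (snd c)) N mod (N + 2) = 1"

definition head :: "nat list \<Rightarrow> nat" where
  "head xs = (case xs of [] \<Rightarrow> 0 | x # _ \<Rightarrow> x)"

text \<open>
  Multiplies the dual number \<open>a + b \<epsilon>\<close> by \<open>(head P + head V \<epsilon>) ^ e\<close>. Thus the directional derivative
  along \<open>V\<close> of a monomial at \<open>P\<close> is computed with polynomially many operations.
\<close>

definition dual_step :: "nat \<Rightarrow> (nat list \<times> nat list) \<times> nat \<times> nat \<Rightarrow> nat \<Rightarrow> (nat list \<times> nat list) \<times> nat \<times> nat" where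
  "dual_step N s e =
     ((tl (fst (fst s)), tl (snd (fst s))),
      (fst (snd s) * power_mod N (head (fst (fst s))) e mod (N + 2),
       (snd (snd s) * power_mod N (head (fst (fst s))) e +
        fst (snd s) * (e * power_mod N (head (fst (fst s))) (e - 1) * head (snd (fst s)))) mod (N + 2)))"

text \<open>The product starts with the dual number 1; the derivative is the epsilon part of the
  result.\<close>

definition deriv_monomial :: "nat \<Rightarrow> nat list \<Rightarrow> nat list \<Rightarrow> nat list \<Rightarrow> nat" where
  "deriv_monomial N P V e = snd (snd (foldl (dual_step N) ((P, V), (1, 0)) e))"

definition deriv_poly :: "nat \<Rightarrow> nat list \<Rightarrow> nat list \<Rightarrow> (rat_code \<times> nat list) list \<Rightarrow> nat" where
  "deriv_poly N P V f = foldl (\<lambda>a t. (a + residue N (fst t) * deriv_monomial N P V (snd t)) mod (N + 2)) 0 f"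

text \<open>Rows belong to polynomials, columns to vectors. Only the diagonal and the entries to its
  right are tested: the determinant of a lower triangular matrix does not depend on the
  others.\<close>

definition triangular :: "nat \<Rightarrow> nat list \<Rightarrow> (rat_code \<times> nat list) list list \<Rightarrow> nat list list \<Rightarrow> bool" where
  "triangular N P G Vs \<longleftrightarrow>
     all_pairs (\<lambda>g v vs. deriv_poly N P v g = 1 \<and> list_all (\<lambda>v. deriv_poly N P v g = 0) vs) G Vs"

text \<open>The length test makes the mask a selection of \<open>n\<close> polynomials. That
  exponent vectors and points have length \<open>n\<close> is left to the promise.\<close>

definition check :: "nat \<Rightarrow> bool list \<Rightarrow> nat list list list \<Rightarrow> nat \<Rightarrow> (rat_code \<times> nat list) list list \<Rightarrow> rat_code list list \<Rightarrow> bool" where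
  "check N w Us n F pts \<longleftrightarrow>
     length (select w F) = n \<and>
     list_all (\<lambda>f. list_all (\<lambda>t. unit_denominator N (fst t)) f) (select w F) \<and>
     all_pairs (\<lambda>p U _. list_all (\<lambda>c. unit_denominator N c) p \<and>
       triangular N (map (\<lambda>c. residue N c) p) (select w F) U) pts Us"

section \<open>Polynomial-time computability of the check\<close>

lemma fp_residue: "fp n \<Longrightarrow> fp c \<Longrightarrow> fp (\<lambda>x. residue (n x) (c x))"
  unfolding residue_def by (intro fp_mod fp_mult fp_add fp_power_mod fp_intros)

lemma fp_unit_denominator: "fp n \<Longrightarrow> fp c \<Longrightarrow> fp (\<lambda>x. unit_denominator (n x) (c x))"
  unfolding unit_denominator_def by (intro fp_nat_eq fp_mod fp_mult fp_add fp_power_mod fp_intros)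

lemma fp_head: "fp l \<Longrightarrow> fp (\<lambda>x. head (l x))"
  unfolding head_def by (intro fp_case_list fp_intros)

lemma fp_tl: "fp l \<Longrightarrow> fp (\<lambda>x. tl (l x))"
proof -
  assume "fp l"
  then have "fp (\<lambda>x. case l x of [] \<Rightarrow> [] | y # ys \<Rightarrow> ys)" by (intro fp_case_list fp_intros)
  then show ?thesis by (rule fp_cong) (simp split: list.split)
qed

lemma code_size_tl: "code_size (tl xs) \<le> code_size (xs :: 'a::codable list)"
  by (cases xs) auto

text \<open>The two lists only get shorter, and both numbers are reduced in each step.\<close>

lemma dual_steps_size:
  assumes "a \<le> N + 2" "b \<le> N + 2"
  shows "code_size (foldl (dual_step N) ((P, V), (a, b)) e) \<le> code_size P + code_size V + 2 * code_size (N + 2)"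
  using assms
proof (induction e arbitrary: P V a b)
  case Nil
  then show ?case using code_size_nat_mono[of a "N + 2"] code_size_nat_mono[of b "N + 2"] by simp
next
  case (Cons x e)
  have m: "k mod (N + 2) \<le> N + 2" for k by (rule less_imp_le) simp
  obtain a' b' where "dual_step N ((P, V), (a, b)) x = ((tl P, tl V), (a' mod (N + 2), b' mod (N + 2)))"
    unfolding dual_step_def fst_conv snd_conv by blast
  then have "code_size (foldl (dual_step N) ((P, V), (a, b)) (x # e)) \<le> code_size (tl P) + code_size (tl V) + 2 * code_size (N + 2)"
    unfolding foldl.simps using Cons.IH[OF m m] by (simp only:)
  then show ?case using code_size_tl[of P] code_size_tl[of V] by linarith
qed

lemma fp_deriv_monomial:
  assumes "fp n" "fp P" "fp V" "fp e"
  shows "fp (\<lambda>x. deriv_monomial (n x) (P x) (V x) (e x))"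
proof -
  have "fp (\<lambda>x. foldl (dual_step (n x)) ((P x, V x), (1, 0)) (e x))"
  proof (rule fp_foldl[where f = "\<lambda>x. dual_step (n x)" and
      B = "\<lambda>x. code_size (P x) + code_size (V x) + 2 * code_size (n x + 2)", OF assms(4)])
    show "fp (\<lambda>p. dual_step (n (fst p)) (snd (snd p)) (fst (snd p)))"
      unfolding dual_step_def
      by (intro fp_intros fp_tl fp_head fp_mod fp_add fp_mult fp_power_mod fp_pred fp_comp[OF assms(1)])
  qed (intro fp_intros assms dual_steps_size pb_add pb_mult pb_const fp_size fp_add; simp)+
  from fp_snd[OF fp_snd[OF this]] show ?thesis unfolding deriv_monomial_def .
qed

lemma fp_deriv_poly:
  assumes "fp n" "fp P" "fp V" "fp f"
  shows "fp (\<lambda>x. deriv_poly (n x) (P x) (V x) (f x))"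
  unfolding deriv_poly_def
proof (rule fp_foldl[where B = "\<lambda>x. code_size (n x + 2)" and
    f = "\<lambda>x a t. (a + residue (n x) (fst t) * deriv_monomial (n x) (P x) (V x) (snd t)) mod (n x + 2)", OF assms(4) fp_const])
  show "fp (\<lambda>p. (snd (snd p) + residue (n (fst p)) (fst (fst (snd p))) *
      deriv_monomial (n (fst p)) (P (fst p)) (V (fst p)) (snd (fst (snd p)))) mod (n (fst p) + 2))"
    by (intro fp_mod fp_add fp_mult fp_residue fp_deriv_monomial fp_comp[OF assms(1)] fp_comp[OF assms(2)] fp_comp[OF assms(3)] fp_intros)
  fix x ys
  have "foldl (\<lambda>a t. (a + residue (n x) (fst t) * deriv_monomial (n x) (P x) (V x) (snd t)) mod (n x + 2)) a ys \<le> n x + 2"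
    if "a \<le> n x + 2" for a
    using that by (induction ys arbitrary: a) (auto intro: less_imp_le)
  then show "code_size (foldl (\<lambda>a t. (a + residue (n x) (fst t) * deriv_monomial (n x) (P x) (V x) (snd t)) mod (n x + 2)) 0 ys) \<le> code_size (n x + 2)"
    by (intro code_size_nat_mono) auto
qed (intro fp_size fp_add assms fp_const)

lemma fp_triangular:
  assumes "fp n" "fp P" "fp G" "fp Vs"
  shows "fp (\<lambda>x. triangular (n x) (P x) (G x) (Vs x))"
  unfolding triangular_def
  by (intro fp_all_pairs fp_conj fp_nat_eq fp_list_all fp_deriv_poly assms
      fp_comp[OF assms(1)] fp_comp[OF assms(2)] fp_fst fp_snd fp_id fp_const)

lemma fp_check:
  "fp (\<lambda>z. check (fst (fst z)) (fst (snd (fst z))) (snd (snd (fst z))) (fst (snd z)) (fst (snd (snd z))) (snd (snd (snd z))))"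
  unfolding check_def
  by (intro fp_conj fp_nat_eq fp_length fp_list_all fp_all_pairs fp_unit_denominator fp_triangular fp_map fp_residue fp_select
      fp_fst fp_snd fp_id)

section \<open>Small primes\<close>

text \<open>
  Leibniz' harmonic triangle: the numbers \<open>1 / ((n + 1) binom(n, m))\<close> are integer combinations of
  \<open>1, 1/2, ..., 1/(n + 1)\<close>.
\<close>

lemma binomial_dvd_common_multiple:
  fixes D :: nat
  assumes "\<And>k. 1 \<le> k \<Longrightarrow> k \<le> Suc n \<Longrightarrow> k dvd D" "m \<le> n"
  shows "Suc n * (n choose m) dvd D"
  using assms
proof (induction n arbitrary: m)
  case 0
  then show ?case by simp
next
  case (Suc n)
  note IH = Suc.IH and all = Suc.prems(1)
  from Suc.prems(2) show ?case
  proof (induction m)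
    case 0
    then show ?case using all[of "Suc (Suc n)"] by simp
  next
    case (Suc m)
    then have m: "m \<le> n" by simp
    have "Suc (Suc n) * (Suc n choose m) dvd D" using Suc by simp
    then obtain a where a: "D = Suc (Suc n) * (Suc n choose m) * a" by (elim dvdE)
    have "Suc n * (n choose m) dvd D"
      using all by (intro IH m) auto
    then obtain b where b: "D = Suc n * (n choose m) * b" by (elim dvdE)
    define X where "X = int (Suc n) * int (n choose m)"
    define C1 where "C1 = int (Suc n choose m)"
    define C2 where "C2 = int (Suc n choose Suc m)"
    have "(Suc n - m) * (Suc n choose m) = Suc n * (n choose m)"
      using binomial_absorb_comp[of "Suc n" m] by simp
    then have "int (Suc n - m) * int (Suc n choose m) = int (Suc n) * int (n choose m)"
      by (simp only: of_nat_mult[symmetric])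
    moreover have "int (Suc n - m) = int n + 1 - int m" using m by simp
    ultimately have C1: "(int n + 1 - int m) * C1 = X"
      unfolding C1_def X_def by (simp only:)
    have "Suc n * (n choose m) = (Suc n choose Suc m) * Suc m" by (rule Suc_times_binomial_eq)
    then have "X = int (Suc n choose Suc m) * int (Suc m)"
      unfolding X_def by (simp only: of_nat_mult[symmetric])
    then have C2: "X = C2 * (int m + 1)" by (simp only: C2_def of_nat_Suc add.commute)
    have Da: "int D = (int n + 2) * C1 * int a"
      using arg_cong[OF a, of int] by (simp only: of_nat_mult C1_def) simp
    have Db: "int D = X * int b"
      using arg_cong[OF b, of int] by (simp only: of_nat_mult X_def)
    \<comment> \<open>Since \<open>b = D / X\<close> and \<open>a = D / ((n + 2) * C1)\<close>, the
      identity \<open>D = (n + 2) * C2 * (b - a)\<close> is the subtraction rule of the harmonic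
      triangle. Multiplying it by \<open>m + 1\<close> lets \<open>C2\<close> be replaced by
      \<open>X\<close>; the factor is cancelled at the end.\<close>
    have "(int m + 1) * ((int n + 2) * C2 * (int b - int a)) = (int n + 2) * (C2 * (int m + 1) * int b) - (int n + 2) * (C2 * (int m + 1)) * int a"
      by (simp add: algebra_simps)
    also have "\<dots> = (int n + 2) * (X * int b) - (int n + 2) * ((int n + 1 - int m) * C1) * int a"
      unfolding C2[symmetric] C1 by (rule refl)
    also have "\<dots> = (int n + 2) * (X * int b) - (int n + 1 - int m) * ((int n + 2) * C1 * int a)"
      by (simp add: algebra_simps)
    also have "\<dots> = (int m + 1) * int D" unfolding Da[symmetric] Db[symmetric] by (simp add: algebra_simps)
    finally have "int D = (int n + 2) * C2 * (int b - int a)" by simp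
    moreover have "int (Suc (Suc n) * (Suc n choose Suc m)) = (int n + 2) * C2"
      by (simp only: of_nat_mult C2_def) simp
    ultimately have "int (Suc (Suc n) * (Suc n choose Suc m)) dvd int D" by (simp only: dvd_triv_left)
    then show ?case by (simp only: int_dvd_int_iff)
  qed
qed

text \<open>If all primes below \<open>2 ^ k\<close> divided \<open>X\<close>, then every
  \<open>N\<close> up to \<open>2 * m + 1\<close> would divide \<open>X ^ k\<close>, because prime
  multiplicities in \<open>N < 2 ^ k\<close> are below \<open>k\<close>. By the harmonic triangle,
  \<open>2 * m + 1\<close> times the central binomial coefficient would divide \<open>X ^ k\<close>
  too, so \<open>2 ^ m <= 2 ^ (h * k)\<close>, contrary to \<open>h * k < m\<close>. This takes the
  place of Chebyshev's bounds.\<close>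

lemma exists_small_prime_not_dvd:
  fixes X :: nat
  assumes X: "0 < X" "X \<le> 2 ^ h" and m: "h * k < m" "2 * m + 1 < 2 ^ k"
  shows "\<exists>q. prime q \<and> q < 2 ^ k \<and> \<not> q dvd X"
proof (rule ccontr)
  assume "\<not> ?thesis"
  then have all: "\<And>q. prime q \<Longrightarrow> q < 2 ^ k \<Longrightarrow> q dvd X" by blast
  have "N dvd X ^ k" if N: "1 \<le> N" "N \<le> Suc (2 * m)" for N
  proof (rule multiplicity_le_imp_dvd)
    show "N \<noteq> 0" using N by simp
    fix p :: nat assume p: "prime p"
    show "multiplicity p N \<le> multiplicity p (X ^ k)"
    proof (cases "p dvd N")
      case True
      then have "p \<le> N" using N by (intro dvd_imp_le) auto
      then have "p dvd X" using p m N by (intro all) auto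
      then have "multiplicity p X \<ge> 1" using X p by (simp add: Suc_le_eq prime_multiplicity_gt_zero_iff)
      then have "k \<le> k * multiplicity p X" by simp
      also have "\<dots> = multiplicity p (X ^ k)" using X p by (simp add: prime_elem_multiplicity_power_distrib)
      finally have 1: "k \<le> multiplicity p (X ^ k)" .
      have "(2 :: nat) ^ multiplicity p N \<le> p ^ multiplicity p N" using prime_ge_2_nat[OF p] by (rule power_mono) simp
      also have "\<dots> \<le> N" using multiplicity_dvd[of p N] N by (intro dvd_imp_le) auto
      also have "\<dots> < 2 ^ k" using m N by simp
      finally have "multiplicity p N < k" by simp
      with 1 show ?thesis by simp
    qed (simp add: not_dvd_imp_multiplicity_0)
  qed
  then have "Suc (2 * m) * (2 * m choose m) dvd X ^ k"
    by (intro binomial_dvd_common_multiple) auto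
  then have "Suc (2 * m) * (2 * m choose m) \<le> X ^ k" using X by (intro dvd_imp_le) auto
  moreover have "(2 :: nat) ^ m \<le> (2 * m choose m)"
  proof -
    have "(real (2 * m) / real m) ^ m \<le> real (2 * m choose m)"
      using binomial_ge_n_over_k_pow_k[of m "2 * m", where 'a = real] by simp
    moreover have "real (2 * m) / real m = 2" using m by (simp add: field_simps)
    ultimately have "real (2 ^ m) \<le> real (2 * m choose m)" by simp
    then show ?thesis by (simp only: of_nat_le_iff)
  qed
  moreover have "(2 * m choose m) \<le> Suc (2 * m) * (2 * m choose m)" by simp
  ultimately have "2 ^ m \<le> X ^ k" by linarith
  also have "\<dots> \<le> (2 ^ h) ^ k" using X(2) by (rule power_mono) simp
  also have "\<dots> = 2 ^ (h * k)" by (simp add: power_mult)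
  also have "\<dots> < 2 ^ m" using m(1) by simp
  finally show False by simp
qed

text \<open>A prime that does not divide the product divides no factor. The product is at most 2 to
  the power \<open>2 ^ (g + c)\<close>.\<close>

lemma exists_prime_not_dvd_list:
  fixes xs :: "nat list"
  assumes xs: "\<And>x. x \<in> set xs \<Longrightarrow> 0 < x \<and> x \<le> 2 ^ (2 ^ g)" and len: "length xs \<le> 2 ^ c"
  shows "\<exists>q. prime q \<and> q < 2 ^ (2 * (g + c) + 10) \<and> (\<forall>x\<in>set xs. \<not> q dvd x)"
proof -
  let ?g = "g + c"
  have pos: "0 < prod_list xs" using xs by (induction xs) auto
  have "prod_list xs \<le> (2 ^ (2 ^ g)) ^ length xs"
    using xs by (induction xs) (auto intro!: mult_le_mono)
  also have "\<dots> = 2 ^ (2 ^ g * length xs)" by (simp add: power_mult)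
  also have "\<dots> \<le> 2 ^ (2 ^ g * 2 ^ c)" using len by (intro power_increasing mult_le_mono) auto
  finally have le: "prod_list xs \<le> 2 ^ (2 ^ ?g)" by (simp add: power_add)
  have "\<exists>q. prime q \<and> q < 2 ^ (2 * ?g + 10) \<and> \<not> q dvd prod_list xs"
  \<comment> \<open>The choice is \<open>k = 2 * ?g + 10\<close> and
    \<open>m = 2 ^ (2 * ?g + 8)\<close>. Then \<open>h * k < m\<close> because
    \<open>2 * ?g + 10 < 2 ^ 8 * 2 ^ ?g\<close>, and the two spare bits in \<open>k\<close> give
    \<open>2 * m + 1 < 2 ^ k\<close>.\<close>
  proof (rule exists_small_prime_not_dvd[OF pos le])
    have lin: "2 * x + 10 < 256 * y" if "x < y" for x y :: nat using that by linarith
    have "2 * ?g + 10 < 256 * 2 ^ ?g" by (rule lin) (rule less_exp)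
    then have "2 ^ ?g * (2 * ?g + 10) < 2 ^ ?g * (2 ^ 8 * 2 ^ ?g)" by (intro mult_strict_left_mono) simp_all
    also have "\<dots> = 2 ^ (?g + (8 + ?g))" by (simp only: power_add)
    also have "?g + (8 + ?g) = 2 * ?g + 8" by simp
    finally show "2 ^ ?g * (2 * ?g + 10) < (2 :: nat) ^ (2 * ?g + 8)" .
    have "(1 :: nat) \<le> 2 ^ (2 * ?g + 8)" by simp
    then have "2 * 2 ^ (2 * ?g + 8) + 1 < 2 * 2 ^ (2 * ?g + 8) + 2 * (2 :: nat) ^ (2 * ?g + 8)" by linarith
    also have "\<dots> = 2 ^ Suc (Suc (2 * ?g + 8))" by (simp only: power_Suc)
    also have "Suc (Suc (2 * ?g + 8)) = 2 * ?g + 10" by simp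
    finally show "2 * 2 ^ (2 * ?g + 8) + 1 < (2 :: nat) ^ (2 * ?g + 10)" .
  qed
  then obtain q where q: "prime q" "q < 2 ^ (2 * ?g + 10)" "\<not> q dvd prod_list xs" by blast
  have "x dvd prod_list xs" if "x \<in> set xs" for x
    using that by (induction xs) auto
  then have "\<forall>x\<in>set xs. \<not> q dvd x" using q(3) dvd_trans by blast
  with q show ?thesis by blast
qed

section \<open>Heights of rational numbers\<close>

text \<open>The fraction need not be reduced. So products and sums are estimated by multiplying
  denominators, without any cancellation.\<close>

definition height_le :: "rat \<Rightarrow> nat \<Rightarrow> bool" where
  "height_le x h \<longleftrightarrow> (\<exists>a b :: int. 0 < b \<and> x * of_int b = of_int a \<and> \<bar>a\<bar> \<le> 2 ^ h \<and> b \<le> 2 ^ h)"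

lemma height_le_mono: "height_le x h \<Longrightarrow> h \<le> h' \<Longrightarrow> height_le x h'"
proof -
  assume "height_le x h" "h \<le> h'"
  moreover from this(2) have "(2 :: int) ^ h \<le> 2 ^ h'" by simp
  ultimately show ?thesis unfolding height_le_def by (meson order_trans)
qed

lemma height_le_of_int: "\<bar>a\<bar> \<le> 2 ^ h \<Longrightarrow> height_le (of_int a) h"
  unfolding height_le_def by (intro exI[of _ a] exI[of _ 1]) auto

lemma height_le_mult:
  assumes "height_le x h" "height_le y h'"
  shows "height_le (x * y) (h + h')"
proof -
  obtain a b where 1: "0 < b" "x * of_int b = of_int a" "\<bar>a\<bar> \<le> 2 ^ h" "b \<le> (2 :: int) ^ h"
    using assms(1) unfolding height_le_def by blast
  obtain c d where 2: "0 < d" "y * of_int d = of_int c" "\<bar>c\<bar> \<le> 2 ^ h'" "d \<le> (2 :: int) ^ h'"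
    using assms(2) unfolding height_le_def by blast
  have "x * y * of_int (b * d) = (x * of_int b) * (y * of_int d)" by simp
  also have "\<dots> = of_int (a * c)" unfolding 1(2) 2(2) by simp
  finally show ?thesis unfolding height_le_def
    using 1 2 by (intro exI[of _ "a * c"] exI[of _ "b * d"]) (auto simp: abs_mult power_add intro!: mult_mono)
qed

lemma height_le_add:
  assumes "height_le x h" "height_le y h'"
  shows "height_le (x + y) (h + h' + 1)"
proof -
  obtain a b where 1: "0 < b" "x * of_int b = of_int a" "\<bar>a\<bar> \<le> 2 ^ h" "b \<le> (2 :: int) ^ h"
    using assms(1) unfolding height_le_def by blast
  obtain c d where 2: "0 < d" "y * of_int d = of_int c" "\<bar>c\<bar> \<le> 2 ^ h'" "d \<le> (2 :: int) ^ h'"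
    using assms(2) unfolding height_le_def by blast
  have "(x + y) * of_int (b * d) = (x * of_int b) * of_int d + (y * of_int d) * of_int b" by (simp add: algebra_simps)
  also have "\<dots> = of_int (a * d + c * b)" unfolding 1(2) 2(2) by simp
  finally have e: "(x + y) * of_int (b * d) = of_int (a * d + c * b)" .
  have "\<bar>a * d\<bar> \<le> 2 ^ h * 2 ^ h'" "\<bar>c * b\<bar> \<le> 2 ^ h' * 2 ^ h"
    unfolding abs_mult using 1 2 by (auto intro!: mult_mono)
  then have "\<bar>a * d\<bar> + \<bar>c * b\<bar> \<le> 2 ^ h * 2 ^ h' + 2 ^ h' * 2 ^ h" by (rule add_mono)
  with abs_triangle_ineq have "\<bar>a * d + c * b\<bar> \<le> 2 ^ h * 2 ^ h' + 2 ^ h' * 2 ^ h" by (rule order_trans)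
  also have "\<dots> = 2 ^ (h + h' + 1)" by (simp add: power_add)
  finally have "\<bar>a * d + c * b\<bar> \<le> 2 ^ (h + h' + 1)" .
  moreover have "b * d \<le> 2 ^ h * 2 ^ h'" using 1 2 by (intro mult_mono) auto
  then have "b * d \<le> 2 ^ (h + h' + 1)"
    by (rule order_trans) (simp add: power_add)
  moreover have "0 < b * d" using 1 2 by simp
  ultimately show ?thesis using e unfolding height_le_def by blast
qed

lemma height_le_prod:
  "finite S \<Longrightarrow> (\<And>i. i \<in> S \<Longrightarrow> height_le (f i) h) \<Longrightarrow> height_le (prod f S) (card S * h)"
proof (induction S rule: finite_induct)
  case empty
  then show ?case using height_le_of_int[of 1 0] by simp
next
  case (insert x S)
  then have "height_le (f x * prod f S) (h + card S * h)" by (intro height_le_mult) auto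
  then show ?case using insert by simp
qed

lemma height_le_sum:
  "finite S \<Longrightarrow> (\<And>i. i \<in> S \<Longrightarrow> height_le (f i) h) \<Longrightarrow> height_le (sum f S) (card S * (h + 1))"
proof (induction S rule: finite_induct)
  case empty
  then show ?case using height_le_of_int[of 0 0] by simp
next
  case (insert x S)
  then have "height_le (f x + sum f S) (h + card S * (h + 1) + 1)" by (intro height_le_add) auto
  then show ?case using insert by (simp add: algebra_simps)
qed

lemma height_le_power: "height_le x h \<Longrightarrow> height_le (x ^ e) (e * h)"
  using height_le_prod[of "{..<e}" "\<lambda>_. x" h] by simp

text \<open>Exponents up to \<open>2 ^ L\<close> make heights exponential in \<open>L\<close>: each
  power has height at most \<open>2 ^ L * L <= 2 ^ (2 * L)\<close>, and there are at most
  \<open>2 ^ L\<close> factors.\<close>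

lemma height_le_monomial:
  fixes n :: nat
  assumes x: "\<And>j. j < n \<Longrightarrow> height_le (x j) L" and e: "\<And>j. j < n \<Longrightarrow> e j \<le> 2 ^ L" and n: "n \<le> 2 ^ L"
  shows "height_le (\<Prod>j<n. x j ^ e j) (2 ^ (3 * L))"
proof -
  have pow: "height_le (x j ^ e j) (2 ^ (2 * L))" if "j < n" for j
  proof (rule height_le_mono[OF height_le_power[OF x[OF that]]])
    have "e j * L \<le> 2 ^ L * 2 ^ L" by (intro mult_le_mono e that less_imp_le[OF less_exp])
    then show "e j * L \<le> 2 ^ (2 * L)" by (simp add: mult_2 power_add)
  qed
  have "height_le (\<Prod>j<n. x j ^ e j) (card {..<n} * 2 ^ (2 * L))"
    by (rule height_le_prod) (use pow in auto)
  moreover have "card {..<n} * 2 ^ (2 * L) \<le> 2 ^ (3 * L)"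
  proof -
    have "n * 2 ^ (2 * L) \<le> 2 ^ L * 2 ^ (2 * L)" using n by (intro mult_le_mono) auto
    also have "\<dots> = 2 ^ (L + 2 * L)" by (simp only: power_add)
    also have "L + 2 * L = 3 * L" by simp
    finally show ?thesis by simp
  qed
  ultimately show ?thesis by (rule height_le_mono)
qed

lemma height_le_term:
  assumes "height_le c L" "k \<le> 2 ^ L" "height_le m (2 ^ (3 * L))"
  shows "height_le (c * of_nat k * m) (2 ^ (3 * L + 2))"
proof (rule height_le_mono)
  have "height_le (of_nat k) L" 
  proof -
    have "int k \<le> int (2 ^ L)" using assms(2) by (simp only: of_nat_le_iff)
    then show ?thesis using height_le_of_int[of "int k" L] by simp
  qed
  from height_le_mult[OF height_le_mult[OF assms(1) this] assms(3)]
  show "height_le (c * of_nat k * m) (L + L + 2 ^ (3 * L))" .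
  have "L \<le> 2 ^ L" by (rule less_imp_le[OF less_exp])
  also have "(2 :: nat) ^ L \<le> 2 ^ (3 * L)" by simp
  finally show "L + L + 2 ^ (3 * L) \<le> 2 ^ (3 * L + 2)" by simp
qed

lemma height_le_entry:
  fixes T :: nat
  assumes "\<And>i. i < T \<Longrightarrow> height_le (f i) (2 ^ (3 * L + 2))" "T \<le> 2 ^ L"
  shows "height_le (\<Sum>i<T. f i) (2 ^ (4 * L + 3))"
proof (rule height_le_mono)
  show "height_le (\<Sum>i<T. f i) (card {..<T} * (2 ^ (3 * L + 2) + 1))"
    by (rule height_le_sum) (use assms(1) in auto)
  have "T * (2 ^ (3 * L + 2) + 1) \<le> 2 ^ L * (2 ^ (3 * L + 2) + 2 ^ (3 * L + 2))"
    using assms(2) by (intro mult_le_mono) auto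
  also have "\<dots> = 2 ^ (L + Suc (3 * L + 2))" by (simp only: power_add power_Suc mult_2)
  also have "L + Suc (3 * L + 2) = 4 * L + 3" by simp
  finally show "card {..<T} * (2 ^ (3 * L + 2) + 1) \<le> 2 ^ (4 * L + 3)" by simp
qed

text \<open>Leibniz' formula has at most \<open>2 ^ (L * L)\<close> summands, each a product of at
  most \<open>2 ^ L\<close> entries and hence of height at most \<open>2 ^ (5 * L + 3)\<close>.
  Addition costs one more per summand, which at most doubles the bound.\<close>

lemma height_le_det:
  fixes A :: "rat mat"
  assumes A: "A \<in> carrier_mat n n" and n: "n \<le> L"
    and entries: "\<And>i j. i < n \<Longrightarrow> j < n \<Longrightarrow> height_le (A $$ (i, j)) (2 ^ (4 * L + 3))"
  shows "height_le (det A) (2 ^ (L * L + 5 * L + 4))"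
proof (rule height_le_mono)
  let ?P = "{p. p permutes {0..<n}}"
  have nL: "n \<le> 2 ^ L" using n less_imp_le[OF less_exp] by (rule order_trans)
  have summand: "height_le (signof p * (\<Prod>i = 0..<n. A $$ (i, p i))) (2 ^ (5 * L + 3))" if p: "p \<in> ?P" for p
  proof (rule height_le_mono)
    have "height_le (signof p) 0"
      using height_le_of_int[of 1 0] height_le_of_int[of "-1" 0] by (simp add: sign_def)
    moreover have "height_le (\<Prod>i = 0..<n. A $$ (i, p i)) (card {0..<n} * 2 ^ (4 * L + 3))"
      using p by (intro height_le_prod entries) (auto dest: permutes_in_image[of p "{0..<n}"])
    ultimately show "height_le (signof p * (\<Prod>i = 0..<n. A $$ (i, p i))) (0 + card {0..<n} * 2 ^ (4 * L + 3))"
      by (rule height_le_mult)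
    have "n * 2 ^ (4 * L + 3) \<le> 2 ^ L * 2 ^ (4 * L + 3)" using nL by (intro mult_le_mono) auto
    also have "\<dots> = 2 ^ (L + (4 * L + 3))" by (simp only: power_add)
    also have "L + (4 * L + 3) = 5 * L + 3" by simp
    finally show "0 + card {0..<n} * 2 ^ (4 * L + 3) \<le> 2 ^ (5 * L + 3)" by simp
  qed
  have "finite ?P" by (rule finite_permutations) simp
  then show "height_le (det A) (card ?P * (2 ^ (5 * L + 3) + 1))"
    unfolding det_def'[OF A] by (rule height_le_sum) (rule summand)
  have "card ?P = fact n" by (rule card_permutations) auto
  also have "\<dots> \<le> n ^ n" using fact_le_power[of n, where 'a = nat] by simp
  also have "\<dots> \<le> (2 ^ L) ^ n" using nL by (intro power_mono) auto
  also have "\<dots> \<le> (2 ^ L) ^ L" using n by (intro power_increasing) auto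
  also have "\<dots> = 2 ^ (L * L)" by (simp add: power_mult)
  finally have "card ?P * (2 ^ (5 * L + 3) + 1) \<le> 2 ^ (L * L) * (2 ^ (5 * L + 3) + 2 ^ (5 * L + 3))"
    by (intro mult_le_mono) auto
  also have "\<dots> = 2 ^ (L * L + Suc (5 * L + 3))" by (simp only: power_add power_Suc mult_2)
  also have "L * L + Suc (5 * L + 3) = L * L + 5 * L + 4" by simp
  finally show "card ?P * (2 ^ (5 * L + 3) + 1) \<le> 2 ^ (L * L + 5 * L + 4)" .
qed

section \<open>Residues of rational numbers\<close>

text \<open>Signs and absolute values are arranged so that the generic code of pairs agrees bit for
  bit with \<open>enc_rat\<close>.\<close>

definition rat_code :: "rat \<Rightarrow> rat_code" where
  "rat_code r = (case quotient_of r of (a, b) \<Rightarrow> ((a < 0, nat \<bar>a\<bar>), (b < 0, nat \<bar>b\<bar>)))"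

text \<open>Reduction modulo \<open>M\<close> of rationals whose denominator is a unit, as a
  relation: \<open>r\<close> is any integer in the residue class, and the fraction need not be
  reduced. It respects the ring operations, hence determinants.\<close>

definition has_residue :: "int \<Rightarrow> rat \<Rightarrow> int \<Rightarrow> bool" where
  "has_residue M x r \<longleftrightarrow> (\<exists>a b :: int. coprime b M \<and> x * of_int b = of_int a \<and> [a = r * b] (mod M))"

lemma has_residue_of_int: "has_residue M (of_int a) a"
  unfolding has_residue_def by (intro exI[of _ a] exI[of _ 1]) auto

lemma has_residue_add:
  assumes "has_residue M x r" "has_residue M y s"
  shows "has_residue M (x + y) (r + s)"
proof -
  obtain a b where 1: "coprime b M" "x * of_int b = of_int a" "[a = r * b] (mod M)"
    using assms(1) unfolding has_residue_def by blast
  obtain c d where 2: "coprime d M" "y * of_int d = of_int c" "[c = s * d] (mod M)"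
    using assms(2) unfolding has_residue_def by blast
  have "(x + y) * of_int (b * d) = (x * of_int b) * of_int d + (y * of_int d) * of_int b" by (simp add: algebra_simps)
  also have "\<dots> = of_int (a * d + c * b)" unfolding 1(2) 2(2) by simp
  finally have e: "(x + y) * of_int (b * d) = of_int (a * d + c * b)" .
  have "[a * d + c * b = (r * b) * d + (s * d) * b] (mod M)"
    by (intro cong_add cong_scalar_right 1 2)
  then have "[a * d + c * b = (r + s) * (b * d)] (mod M)" by (simp add: algebra_simps)
  with e 1(1) 2(1) show ?thesis unfolding has_residue_def
    by (intro exI[of _ "a * d + c * b"] exI[of _ "b * d"]) auto
qed

lemma has_residue_mult:
  assumes "has_residue M x r" "has_residue M y s"
  shows "has_residue M (x * y) (r * s)"
proof -
  obtain a b where 1: "coprime b M" "x * of_int b = of_int a" "[a = r * b] (mod M)"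
    using assms(1) unfolding has_residue_def by blast
  obtain c d where 2: "coprime d M" "y * of_int d = of_int c" "[c = s * d] (mod M)"
    using assms(2) unfolding has_residue_def by blast
  have "x * y * of_int (b * d) = (x * of_int b) * (y * of_int d)" by simp
  also have "\<dots> = of_int (a * c)" unfolding 1(2) 2(2) by simp
  finally have e: "x * y * of_int (b * d) = of_int (a * c)" .
  have "[a * c = (r * b) * (s * d)] (mod M)" by (intro cong_mult 1 2)
  then have "[a * c = (r * s) * (b * d)] (mod M)" by (simp add: ac_simps)
  with e 1(1) 2(1) show ?thesis unfolding has_residue_def
    by (intro exI[of _ "a * c"] exI[of _ "b * d"]) auto
qed

lemma has_residue_of_nat: "has_residue M (of_nat k) (int k)"
  using has_residue_of_int[of M "int k"] by simp

lemma has_residue_power: "has_residue M x r \<Longrightarrow> has_residue M (x ^ e) (r ^ e)"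
proof (induction e)
  case 0
  then show ?case using has_residue_of_int[of M 1] by simp
next
  case (Suc e)
  then show ?case by (simp add: has_residue_mult)
qed

lemma has_residue_prod:
  "(\<And>i. i \<in> S \<Longrightarrow> has_residue M (f i) (g i)) \<Longrightarrow> has_residue M (prod f S) (prod g S)"
proof (induction S rule: infinite_finite_induct)
  case (insert x S)
  then show ?case by (simp add: has_residue_mult)
qed (use has_residue_of_int[of M 1] in simp_all)

lemma has_residue_sum:
  "(\<And>i. i \<in> S \<Longrightarrow> has_residue M (f i) (g i)) \<Longrightarrow> has_residue M (sum f S) (sum g S)"
proof (induction S rule: infinite_finite_induct)
  case (insert x S)
  then show ?case by (simp add: has_residue_add)
qed (use has_residue_of_int[of M 0] in simp_all)

lemma has_residue_sum_list:
  "(\<And>t. t \<in> set ts \<Longrightarrow> has_residue M (f t) (g t)) \<Longrightarrow> has_residue M (sum_list (map f ts)) (sum_list (map g ts))"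
proof (induction ts)
  case (Cons t ts)
  then show ?case by (simp add: has_residue_add)
qed (use has_residue_of_int[of M 0] in simp)

text \<open>A fraction equal to 0 has numerator 0, and the unit denominator cancels. This is what
  rules out a vanishing determinant in the soundness proof.\<close>

lemma has_residue_0: "has_residue M 0 r \<Longrightarrow> [r = 0] (mod M)"
proof -
  assume "has_residue M 0 r"
  then obtain b where b: "coprime b M" "[0 = r * b] (mod M)" unfolding has_residue_def by auto
  from cong_sym[OF b(2)] have "M dvd r * b" by (simp only: cong_0_iff)
  then have "M dvd r" using b(1) by (simp add: coprime_dvd_mult_left_iff coprime_commute)
  then show ?thesis by (simp add: cong_0_iff)
qed

lemma has_residue_det:
  assumes "A \<in> carrier_mat n n" "B \<in> carrier_mat n n"
    and "\<And>i j. i < n \<Longrightarrow> j < n \<Longrightarrow> has_residue M (A $$ (i, j)) (B $$ (i, j))"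
  shows "has_residue M (det A) (det B)"
  unfolding det_def'[OF assms(1)] det_def'[OF assms(2)]
proof (intro has_residue_sum has_residue_mult has_residue_prod)
  fix p assume p: "p \<in> {p. p permutes {0..<n}}"
  show "has_residue M (signof p) (signof p)"
    using has_residue_of_int[of M 1] has_residue_of_int[of M "-1"] by (simp add: sign_def)
  show "has_residue M (A $$ (i, p i)) (B $$ (i, p i))" if "i \<in> {0..<n}" for i
    using p that by (intro assms(3)) (auto dest: permutes_in_image[of p "{0..<n}" i])
qed

lemma det_cong:
  fixes A B :: "int mat"
  assumes "A \<in> carrier_mat n n" "B \<in> carrier_mat n n"
    and "\<And>i j. i < n \<Longrightarrow> j < n \<Longrightarrow> [A $$ (i, j) = B $$ (i, j)] (mod M)"
  shows "[det A = det B] (mod M)"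
  unfolding det_def'[OF assms(1)] det_def'[OF assms(2)]
proof (intro cong_sum cong_mult cong_prod cong_refl)
  fix p i assume p: "p \<in> {p. p permutes {0..<n}}" "i \<in> {0..<n}"
  then show "[A $$ (i, p i) = B $$ (i, p i)] (mod M)"
    by (intro assms(3)) (auto dest: permutes_in_image[of p "{0..<n}" i])
qed

lemma has_residue_residue:
  assumes "unit_denominator N (rat_code c)"
  shows "has_residue (int N + 2) c (int (residue N (rat_code c)))"
proof -
  obtain a b where ab: "quotient_of c = (a, b)" by (cases "quotient_of c")
  then have b: "b > 0" using quotient_of_denom_pos by blast
  have c: "c = of_int a / of_int b" using ab by (rule quotient_of_div)
  let ?M = "int N + 2"
  define \<beta> where "\<beta> = int (power_mod N (nat b) N)"
  have "nat b * power_mod N (nat b) N mod (N + 2) = 1"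
    using assms b by (simp add: unit_denominator_def rat_code_def ab)
  then have "[int (nat b * power_mod N (nat b) N) = int 1] (mod int (N + 2))"
    unfolding cong_int_iff by (simp add: cong_def)
  then have unit: "[b * \<beta> = 1] (mod ?M)" using b by (simp add: \<beta>_def add.commute)
  then have cop: "coprime b ?M" by (auto simp: coprime_iff_invertible_int)
  have "int (residue N (rat_code c)) = int (nat \<bar>a\<bar>) * (if a < 0 then int N + 1 else 1) * \<beta> mod ?M"
    by (simp add: residue_def rat_code_def ab \<beta>_def zmod_int b[THEN less_imp_le] add.commute)
  then have "[int (residue N (rat_code c)) = int (nat \<bar>a\<bar>) * (if a < 0 then int N + 1 else 1) * \<beta>] (mod ?M)"
    by (simp add: cong_def)
  also have "[int (nat \<bar>a\<bar>) * (if a < 0 then int N + 1 else 1) * \<beta> = a * \<beta>] (mod ?M)"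
  proof (intro cong_scalar_right)
    show "[int (nat \<bar>a\<bar>) * (if a < 0 then int N + 1 else 1) = a] (mod ?M)"
    proof (cases "a < 0")
      case True
      \<comment> \<open>\<open>N + 1\<close> is -1 modulo \<open>N + 2\<close>; this factor in
        \<open>residue\<close> restores the sign without negative numbers.\<close>
      have "- a * (int N + 1) - a = - a * (int N + 2)" by (simp add: algebra_simps)
      then have "?M dvd - a * (int N + 1) - a" by simp
      with True show ?thesis by (simp add: cong_iff_dvd_diff)
    qed simp
  qed
  finally have r: "[int (residue N (rat_code c)) = a * \<beta>] (mod ?M)" .
  have "[int (residue N (rat_code c)) * b = a * \<beta> * b] (mod ?M)" by (rule cong_scalar_right[OF r])
  also have "a * \<beta> * b = a * (b * \<beta>)" by simp
  also have "[a * (b * \<beta>) = a * 1] (mod ?M)" by (rule cong_scalar_left[OF unit])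
  finally have "[a = int (residue N (rat_code c)) * b] (mod ?M)" by (simp add: cong_sym)
  moreover have "c * of_int b = of_int a" using b c by simp
  ultimately show ?thesis unfolding has_residue_def using cop by blast
qed

lemma unit_denominator_prime:
  assumes q: "prime q" "q = N + 2" and c: "\<not> q dvd snd (snd (rat_code c))"
  shows "unit_denominator N (rat_code c)"
proof -
  let ?b = "snd (snd (rat_code c))"
  have "[?b ^ (q - 1) = 1] (mod q)" by (rule fermat_theorem[OF q(1) c])
  moreover have "?b ^ (q - 1) = ?b * ?b ^ N" using q(2) by simp
  ultimately have "?b * ?b ^ N mod (N + 2) = 1" using q(2) by (simp add: cong_def)
  then show ?thesis by (simp add: unit_denominator_def power_mod mod_mult_right_eq)
qed

section \<open>Derivatives of sparse polynomials\<close>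

fun monomial_value :: "nat list \<Rightarrow> nat list \<Rightarrow> nat" where
  "monomial_value P [] = 1"
| "monomial_value P (x # e) = head P ^ x * monomial_value (tl P) e"

fun monomial_deriv :: "nat list \<Rightarrow> nat list \<Rightarrow> nat list \<Rightarrow> nat" where
  "monomial_deriv P V [] = 0"
| "monomial_deriv P V (x # e) =
     x * head P ^ (x - 1) * head V * monomial_value (tl P) e + head P ^ x * monomial_deriv (tl P) (tl V) e"

text \<open>Padding by 0 agrees with \<open>head\<close> and \<open>tl\<close> on exhausted lists,
  so certificate vectors of any length have a meaning.\<close>

definition coord :: "nat list \<Rightarrow> nat \<Rightarrow> nat" where
  "coord P j = (if j < length P then P ! j else 0)"

lemma head_coord: "head P = coord P 0"
  by (cases P) (auto simp: head_def coord_def)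

lemma coord_tl: "coord (tl P) j = coord P (Suc j)"
  by (cases P) (auto simp: coord_def)

lemma monomial_value_eq: "monomial_value P e = (\<Prod>j<length e. coord P j ^ (e ! j))"
proof (induction e arbitrary: P)
  case (Cons x e)
  then show ?case by (simp add: prod.lessThan_Suc_shift head_coord coord_tl del: prod.lessThan_Suc)
qed simp

text \<open>Unfolds the recursive product rule into the formal partial derivatives of
  \<open>partial_deriv\<close>. The truncated \<open>e ! k - 1\<close> is harmless, as it comes with
  the factor \<open>e ! k\<close>.\<close>

lemma monomial_deriv_eq:
  "monomial_deriv P V e = (\<Sum>k<length e. e ! k * (\<Prod>j<length e. coord P j ^ (e[k := e ! k - 1] ! j)) * coord V k)"
proof (induction e arbitrary: P V)
  case (Cons x e)
  have "(\<Sum>k<length (x # e). (x # e) ! k * (\<Prod>j<length (x # e). coord P j ^ ((x # e)[k := (x # e) ! k - 1] ! j)) * coord V k)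
    = x * (coord P 0 ^ (x - 1) * (\<Prod>j<length e. coord P (Suc j) ^ (e ! j))) * coord V 0 +
      (\<Sum>k<length e. e ! k * (coord P 0 ^ x * (\<Prod>j<length e. coord P (Suc j) ^ (e[k := e ! k - 1] ! j))) * coord V (Suc k))"
    by (simp add: prod.lessThan_Suc_shift sum.lessThan_Suc_shift del: prod.lessThan_Suc sum.lessThan_Suc)
  also have "\<dots> = monomial_deriv P V (x # e)"
    unfolding monomial_deriv.simps monomial_value_eq Cons coord_tl head_coord
    by (simp add: sum_distrib_left ac_simps)
  finally show ?case by simp
qed simp

text \<open>With \<open>v\<close> and \<open>d\<close> for the value and derivative of the monomial,
  this is the dual number product \<open>(a + b eps) * (v + d eps) = a v + (b v + a d) eps\<close>.
  The induction needs arbitrary starting values \<open>a\<close> and \<open>b\<close>.\<close>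

lemma dual_steps_cong:
  "[fst (snd (foldl (dual_step N) ((P, V), (a, b)) e)) = a * monomial_value P e] (mod (N + 2)) \<and>
   [snd (snd (foldl (dual_step N) ((P, V), (a, b)) e)) = b * monomial_value P e + a * monomial_deriv P V e] (mod (N + 2))"
proof (induction e arbitrary: P V a b)
  case (Cons x e)
  let ?M = "N + 2" and ?h = "head P"
  define a' where "a' = a * power_mod N ?h x mod ?M"
  define b' where "b' = (b * power_mod N ?h x + a * (x * power_mod N ?h (x - 1) * head V)) mod ?M"
  have pm: "[power_mod N ?h k = ?h ^ k] (mod ?M)" for k by (simp add: power_mod cong_def)
  have step: "dual_step N ((P, V), (a, b)) x = ((tl P, tl V), (a', b'))"
    by (simp add: dual_step_def a'_def b'_def)
  have a': "[a' = a * ?h ^ x] (mod ?M)"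
    unfolding a'_def cong_mod_left by (intro cong_mult cong_refl pm)
  have b': "[b' = b * ?h ^ x + a * (x * ?h ^ (x - 1) * head V)] (mod ?M)"
    unfolding b'_def cong_mod_left by (intro cong_add cong_mult cong_refl pm)
  have f: "foldl (dual_step N) ((P, V), (a, b)) (x # e) = foldl (dual_step N) ((tl P, tl V), (a', b')) e"
    by (simp only: foldl.simps step)
  note IH = Cons.IH[of "tl P" "tl V" a' b']
  have "[fst (snd (foldl (dual_step N) ((P, V), (a, b)) (x # e))) = a * ?h ^ x * monomial_value (tl P) e] (mod ?M)"
    unfolding f using IH[THEN conjunct1] cong_scalar_right[OF a'] by (rule cong_trans)
  moreover have "[snd (snd (foldl (dual_step N) ((P, V), (a, b)) (x # e))) =
     (b * ?h ^ x + a * (x * ?h ^ (x - 1) * head V)) * monomial_value (tl P) e + a * ?h ^ x * monomial_deriv (tl P) (tl V) e] (mod ?M)"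
    unfolding f using IH[THEN conjunct2] cong_add[OF cong_scalar_right[OF b'] cong_scalar_right[OF a']] by (rule cong_trans)
  ultimately show ?case by (simp add: algebra_simps)
qed simp

lemma deriv_monomial_cong: "[deriv_monomial N P V e = monomial_deriv P V e] (mod (N + 2))"
  using dual_steps_cong[of N P V 1 0 e] by (simp add: deriv_monomial_def)

lemma deriv_poly_cong:
  "[deriv_poly N P V f = (\<Sum>t\<leftarrow>f. residue N (fst t) * monomial_deriv P V (snd t))] (mod (N + 2))"
proof -
  have "[foldl (\<lambda>a t. (a + residue N (fst t) * deriv_monomial N P V (snd t)) mod (N + 2)) a f
     = a + (\<Sum>t\<leftarrow>f. residue N (fst t) * monomial_deriv P V (snd t))] (mod (N + 2))" for a
  proof (induction f arbitrary: a)
    case (Cons t f)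
    let ?a = "(a + residue N (fst t) * deriv_monomial N P V (snd t)) mod (N + 2)"
    have "[?a = a + residue N (fst t) * monomial_deriv P V (snd t)] (mod (N + 2))"
      unfolding cong_mod_left by (intro cong_add cong_mult cong_refl deriv_monomial_cong)
    from cong_trans[OF Cons.IH[of ?a] cong_add[OF this cong_refl]] show ?case by (simp add: add.assoc)
  qed simp
  from this[of 0] show ?thesis by (simp add: deriv_poly_def)
qed

lemma deriv_poly_less: "deriv_poly N P V f < N + 2"
proof -
  have "foldl (\<lambda>a t. (a + residue N (fst t) * deriv_monomial N P V (snd t)) mod (N + 2)) a f < N + 2"
    if "a < N + 2" for a
    using that by (induction f arbitrary: a) (auto simp del: add_2_eq_Suc')
  then show ?thesis by (simp add: deriv_poly_def)
qed

section \<open>Partial derivatives over the rationals and their residues\<close>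

definition code_poly :: "sparse_poly \<Rightarrow> (rat_code \<times> nat list) list" where
  "code_poly f = map (\<lambda>(c, e). (rat_code c, e)) f"

text \<open>At rational points the complex Jacobian matrix has rational entries; these have heights
  and residues. \<open>int_deriv\<close> is the same formula on residues.\<close>

definition rat_deriv :: "sparse_poly \<Rightarrow> nat \<Rightarrow> rat list \<Rightarrow> rat" where
  "rat_deriv f k p = (\<Sum>t\<leftarrow>f. fst t * of_nat (snd t ! k) * (\<Prod>j<length (snd t). p ! j ^ ((snd t)[k := snd t ! k - 1] ! j)))"

definition int_deriv :: "nat \<Rightarrow> sparse_poly \<Rightarrow> nat \<Rightarrow> nat list \<Rightarrow> int" where
  "int_deriv N f k P = (\<Sum>t\<leftarrow>f. int (residue N (rat_code (fst t))) * int (snd t ! k) *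
     (\<Prod>j<length (snd t). int (coord P j) ^ ((snd t)[k := snd t ! k - 1] ! j)))"

lemma eval_partial_deriv:
  assumes "\<And>t. t \<in> set f \<Longrightarrow> length (snd t) \<le> length p"
  shows "eval_sparse (partial_deriv k f) (map of_rat p) = of_rat (rat_deriv f k p)"
  using assms
proof (induction f)
  case (Cons t f)
  obtain c e where t: "t = (c, e)" by (cases t)
  have "(\<Prod>j<length e. map of_rat p ! j ^ (e[k := e ! k - 1] ! j)) = (of_rat (\<Prod>j<length e. p ! j ^ (e[k := e ! k - 1] ! j)) :: complex)"
    unfolding of_rat_hom.hom_prod
    by (rule prod.cong) (use Cons.prems[of t] t in \<open>auto simp: of_rat_power\<close>)
  then have "eval_sparse (partial_deriv k [t]) (map of_rat p) = of_rat (rat_deriv [t] k p)"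
    by (simp add: t eval_sparse_def partial_deriv_def rat_deriv_def of_rat_mult)
  with Cons show ?case
    by (simp add: eval_sparse_def partial_deriv_def rat_deriv_def of_rat_add)
qed (simp add: eval_sparse_def partial_deriv_def rat_deriv_def)

lemma has_residue_deriv:
  assumes exps: "\<And>t. t \<in> set f \<Longrightarrow> length (snd t) \<le> length p"
    and coeffs: "\<And>t. t \<in> set f \<Longrightarrow> unit_denominator N (rat_code (fst t))"
    and coords: "\<And>c. c \<in> set p \<Longrightarrow> unit_denominator N (rat_code c)"
  shows "has_residue (int N + 2) (rat_deriv f k p) (int_deriv N f k (map (\<lambda>c. residue N (rat_code c)) p))"
  unfolding rat_deriv_def int_deriv_def
proof (intro has_residue_sum_list has_residue_mult has_residue_prod has_residue_power has_residue_of_nat)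
  fix t assume t: "t \<in> set f"
  show "has_residue (int N + 2) (fst t) (int (residue N (rat_code (fst t))))"
    by (rule has_residue_residue[OF coeffs[OF t]])
  fix j assume "j \<in> {..<length (snd t)}"
  then have "j < length p" using exps[OF t] by simp
  then show "has_residue (int N + 2) (p ! j) (int (coord (map (\<lambda>c. residue N (rat_code c)) p) j))"
    using has_residue_residue[OF coords[of "p ! j"]] by (simp add: coord_def)
qed

text \<open>The derivative along \<open>V\<close> is the gradient applied to \<open>V\<close>. So
  the check evaluates entries of a matrix product without computing the Jacobian matrix.\<close>

lemma deriv_poly_int_cong:
  assumes "\<And>t. t \<in> set f \<Longrightarrow> length (snd t) = n"
  shows "[int (deriv_poly N P V (code_poly f)) = (\<Sum>k<n. int_deriv N f k P * int (coord V k))] (mod (int N + 2))"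
proof -
  have "int (\<Sum>t\<leftarrow>code_poly f. residue N (fst t) * monomial_deriv P V (snd t)) = (\<Sum>k<n. int_deriv N f k P * int (coord V k))"
    using assms
  proof (induction f)
    case Nil
    then show ?case by (simp add: code_poly_def int_deriv_def)
  next
    case (Cons t f)
    obtain c e where t: "t = (c, e)" by (cases t)
    have e: "length e = n" using Cons.prems[of t] t by simp
    have "int (residue N (rat_code c) * monomial_deriv P V e) =
       (\<Sum>k<n. int (residue N (rat_code c)) * int (e ! k) * (\<Prod>j<length e. int (coord P j) ^ (e[k := e ! k - 1] ! j)) * int (coord V k))"
      unfolding monomial_deriv_eq e by (simp add: sum_distrib_left ac_simps)
    moreover have "(\<Sum>k<n. int_deriv N (t # f) k P * int (coord V k)) =
       (\<Sum>k<n. int (residue N (rat_code c)) * int (e ! k) * (\<Prod>j<length e. int (coord P j) ^ (e[k := e ! k - 1] ! j)) * int (coord V k))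
       + (\<Sum>k<n. int_deriv N f k P * int (coord V k))"
      unfolding sum.distrib[symmetric] by (rule sum.cong) (simp_all add: int_deriv_def t algebra_simps)
    ultimately show ?case using Cons by (simp add: code_poly_def t)
  qed
  moreover have "[int (deriv_poly N P V (code_poly f)) = int (\<Sum>t\<leftarrow>code_poly f. residue N (fst t) * monomial_deriv P V (snd t))] (mod int (N + 2))"
    unfolding cong_int_iff by (rule deriv_poly_cong)
  ultimately show ?thesis by (simp add: add.commute)
qed

section \<open>Modular certificates for nonzero Jacobian determinants\<close>

definition rat_jacobian :: "nat \<Rightarrow> sparse_poly list \<Rightarrow> rat list \<Rightarrow> rat mat" where
  "rat_jacobian n G p = mat n n (\<lambda>(i, k). rat_deriv (G ! i) k p)"

definition int_jacobian :: "nat \<Rightarrow> nat \<Rightarrow> sparse_poly list \<Rightarrow> nat list \<Rightarrow> int mat" where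
  "int_jacobian N n G P = mat n n (\<lambda>(i, k). int_deriv N (G ! i) k P)"

lemma jacobian_carrier [simp]: "rat_jacobian n G p \<in> carrier_mat n n" "int_jacobian N n G P \<in> carrier_mat n n"
  by (auto simp: rat_jacobian_def int_jacobian_def)

lemma det_jacobian:
  assumes "length G = n" "length p = n" and "\<And>f t. f \<in> set G \<Longrightarrow> t \<in> set f \<Longrightarrow> length (snd t) = n"
  shows "det (jacobian n G (map of_rat p)) = of_rat (det (rat_jacobian n G p))"
proof -
  have "jacobian n G (map of_rat p) = map_mat of_rat (rat_jacobian n G p)"
  proof (rule eq_matI)
    fix i j assume "i < dim_row (map_mat of_rat (rat_jacobian n G p))" "j < dim_col (map_mat of_rat (rat_jacobian n G p))"
    then have ij: "i < n" "j < n" by (auto simp: rat_jacobian_def)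
    have "G ! i \<in> set G" using ij assms(1) by simp
    from assms(3)[OF this] have "t \<in> set (G ! i) \<Longrightarrow> length (snd t) \<le> length p" for t using assms(2) by auto
    from eval_partial_deriv[OF this] show "jacobian n G (map of_rat p) $$ (i, j) = map_mat of_rat (rat_jacobian n G p) $$ (i, j)"
      using ij assms(1) by (simp add: jacobian_def rat_jacobian_def)
  qed (auto simp: jacobian_def rat_jacobian_def assms(1))
  then show ?thesis by (simp add: of_rat_hom.hom_det)
qed

definition columns :: "nat \<Rightarrow> nat list list \<Rightarrow> int mat" where
  "columns n U = mat n n (\<lambda>(k, j). int (coord (U ! j) k))"

lemma jacobian_times_columns:
  assumes "i < n" "j < n" "length G = n" and exps: "\<And>f t. f \<in> set G \<Longrightarrow> t \<in> set f \<Longrightarrow> length (snd t) = n"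
  shows "[int (deriv_poly N P (U ! j) (code_poly (G ! i))) = (int_jacobian N n G P * columns n U) $$ (i, j)] (mod (int N + 2))"
proof -
  have "G ! i \<in> set G" using assms by simp
  from deriv_poly_int_cong[OF exps[OF this], where N = N and P = P and V = "U ! j"]
  have "[int (deriv_poly N P (U ! j) (code_poly (G ! i))) = (\<Sum>k<n. int_deriv N (G ! i) k P * int (coord (U ! j) k))] (mod (int N + 2))" .
  moreover have "(int_jacobian N n G P * columns n U) $$ (i, j) = (\<Sum>k<n. int_deriv N (G ! i) k P * int (coord (U ! j) k))"
    using assms by (simp add: int_jacobian_def columns_def scalar_prod_def lessThan_atLeast0)
  ultimately show ?thesis by simp
qed

lemma has_residue_det_jacobian:
  assumes G: "length G = n" and p: "length p = n"
    and exps: "\<And>f t. f \<in> set G \<Longrightarrow> t \<in> set f \<Longrightarrow> length (snd t) = n"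
    and coeffs: "\<And>f t. f \<in> set G \<Longrightarrow> t \<in> set f \<Longrightarrow> unit_denominator N (rat_code (fst t))"
    and coords: "\<And>c. c \<in> set p \<Longrightarrow> unit_denominator N (rat_code c)"
  shows "has_residue (int N + 2) (det (rat_jacobian n G p))
    (det (int_jacobian N n G (map (\<lambda>c. residue N (rat_code c)) p)))"
proof (rule has_residue_det)
  fix i j assume ij: "i < n" "j < n"
  then have Gi: "G ! i \<in> set G" using G by simp
  have "has_residue (int N + 2) (rat_deriv (G ! i) j p) (int_deriv N (G ! i) j (map (\<lambda>c. residue N (rat_code c)) p))"
    by (rule has_residue_deriv) (use exps[OF Gi] coeffs[OF Gi] coords p in auto)
  then show "has_residue (int N + 2) (rat_jacobian n G p $$ (i, j))
      (int_jacobian N n G (map (\<lambda>c. residue N (rat_code c)) p) $$ (i, j))"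
    using ij by (simp add: rat_jacobian_def int_jacobian_def)
qed simp_all

text \<open>The Jacobian matrix of residues times the matrix of vectors is congruent to a matrix of
  determinant 1. A vanishing rational determinant would make the determinant of the first factor
  congruent to 0.\<close>

lemma triangular_sound:
  assumes G: "length G = n" and p: "length p = n"
    and exps: "\<And>f t. f \<in> set G \<Longrightarrow> t \<in> set f \<Longrightarrow> length (snd t) = n"
    and coeffs: "\<And>f t. f \<in> set G \<Longrightarrow> t \<in> set f \<Longrightarrow> unit_denominator N (rat_code (fst t))"
    and coords: "\<And>c. c \<in> set p \<Longrightarrow> unit_denominator N (rat_code c)"
    and tri: "triangular N (map (\<lambda>c. residue N (rat_code c)) p) (map code_poly G) U"
  shows "det (jacobian n G (map of_rat p)) \<noteq> 0"
proof
  let ?M = "int N + 2" and ?P = "map (\<lambda>c. residue N (rat_code c)) p"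
  let ?R = "int_jacobian N n G ?P" and ?V = "columns n U"
  have V: "?V \<in> carrier_mat n n" by (simp add: columns_def)
  assume "det (jacobian n G (map of_rat p)) = 0"
  then have zero: "det (rat_jacobian n G p) = 0" by (simp add: det_jacobian[OF G p exps])
  have "has_residue ?M (det (rat_jacobian n G p)) (det ?R)"
    by (rule has_residue_det_jacobian[OF G p exps coeffs coords])
  then have R0: "[det ?R = 0] (mod ?M)" unfolding zero by (rule has_residue_0)
  \<comment> \<open>The entries below the diagonal, which are not tested, are copied from the
    product; so \<open>T\<close> is exactly triangular and still congruent to it.\<close>
  define T where "T = mat n n (\<lambda>(i, j). if i < j then 0 else if i = j then 1 else (?R * ?V) $$ (i, j))"
  have T: "T \<in> carrier_mat n n" by (simp add: T_def)
  have "[det (?R * ?V) = det T] (mod ?M)"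
  proof (rule det_cong)
    fix i j assume ij: "i < n" "j < n"
    note ent = jacobian_times_columns[OF ij G exps, where N = N and P = ?P and U = U]
    have tri_i: "n \<le> length U" "deriv_poly N ?P (U ! i) (code_poly (G ! i)) = 1"
      "\<And>v. v \<in> set (drop (Suc i) U) \<Longrightarrow> deriv_poly N ?P v (code_poly (G ! i)) = 0"
      using tri ij(1) G unfolding triangular_def all_pairs_iff by (auto simp: list_all_iff)
    consider "i < j" | "i = j" | "j < i" by linarith
    then show "[(?R * ?V) $$ (i, j) = T $$ (i, j)] (mod ?M)"
    proof cases
      case 1
      have "U ! j = drop (Suc i) U ! (j - Suc i)" using 1 tri_i(1) ij by simp
      moreover have "j - Suc i < length (drop (Suc i) U)" using 1 tri_i(1) ij by simp
      ultimately have "U ! j \<in> set (drop (Suc i) U)" by (metis nth_mem)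
      from tri_i(3)[OF this] ent 1 ij show ?thesis by (simp add: T_def cong_sym)
    next
      case 2
      with tri_i(2) ent ij show ?thesis by (simp add: T_def cong_sym)
    next
      case 3
      then show ?thesis using ij by (simp add: T_def)
    qed
  qed (use mult_carrier_mat[OF jacobian_carrier(2) V] T in auto)
  moreover have "det T = 1"
  proof -
    have "det T = prod_list (diag_mat T)" by (rule det_lower_triangular[OF _ T]) (simp add: T_def)
    also have "diag_mat T = map (\<lambda>i. 1) [0..<n]" by (simp add: diag_mat_def T_def)
    also have "prod_list \<dots> = 1" by (induction n) auto
    finally show ?thesis .
  qed
  moreover have "det (?R * ?V) = det ?R * det ?V" by (rule det_mult[OF _ V]) simp
  ultimately have "[det ?R * det ?V = 1] (mod ?M)" by simp
  moreover have "[det ?R * det ?V = 0 * det ?V] (mod ?M)" by (rule cong_scalar_right[OF R0])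
  ultimately have "[1 = 0 * det ?V] (mod ?M)" using cong_sym cong_trans by blast
  \<comment> \<open>The modulus is at least 2, so 1 is not congruent to 0.\<close>
  then show False by (simp add: cong_def)
qed

text \<open>For a prime modulus not dividing the numerator \<open>a\<close>, the determinant of the
  residue matrix is invertible. The inverse matrix then satisfies more than the triangular
  condition.\<close>

lemma triangular_complete:
  assumes G: "length G = n" and p: "length p = n"
    and exps: "\<And>f t. f \<in> set G \<Longrightarrow> t \<in> set f \<Longrightarrow> length (snd t) = n"
    and coeffs: "\<And>f t. f \<in> set G \<Longrightarrow> t \<in> set f \<Longrightarrow> unit_denominator N (rat_code (fst t))"
    and coords: "\<And>c. c \<in> set p \<Longrightarrow> unit_denominator N (rat_code c)"
    and q: "prime (int N + 2)"
    and det: "det (rat_jacobian n G p) * of_int b = of_int a" "\<not> int N + 2 dvd a"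
  shows "\<exists>U. triangular N (map (\<lambda>c. residue N (rat_code c)) p) (map code_poly G) U \<and>
     length U = n \<and> (\<forall>v\<in>set U. length v = n \<and> (\<forall>x\<in>set v. x < N + 2))"
proof -
  let ?M = "int N + 2" and ?P = "map (\<lambda>c. residue N (rat_code c)) p"
  let ?R = "int_jacobian N n G ?P"
  have "has_residue ?M (det (rat_jacobian n G p)) (det ?R)"
    by (rule has_residue_det_jacobian[OF G p exps coeffs coords])
  then obtain \<alpha> \<beta> where ab: "coprime \<beta> ?M" "det (rat_jacobian n G p) * of_int \<beta> = of_int \<alpha>" "[\<alpha> = det ?R * \<beta>] (mod ?M)"
    unfolding has_residue_def by blast
  have "\<not> ?M dvd det ?R"
  proof
    assume "?M dvd det ?R"
    then have "?M dvd \<alpha>" using cong_dvd_iff[OF ab(3)] by simp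
    \<comment> \<open>Both \<open>\<alpha> / \<beta>\<close> and \<open>a / b\<close> represent the
      determinant. Cross-multiplication moves the divisibility from \<open>\<alpha>\<close> to
      \<open>a\<close>, because \<open>\<beta>\<close> is a unit.\<close>
    have "(of_int (\<alpha> * b) :: rat) = of_int (a * \<beta>)"
      unfolding of_int_mult ab(2)[symmetric] det(1)[symmetric] by simp
    then have "\<alpha> * b = a * \<beta>" by (simp only: of_int_eq_iff)
    then have "?M dvd a * \<beta>" using \<open>?M dvd \<alpha>\<close> by (metis dvd_mult2)
    then have "?M dvd a" using ab(1) by (simp add: coprime_dvd_mult_left_iff coprime_commute)
    with det(2) show False by blast
  qed
  then have "coprime (det ?R) ?M" using q by (metis coprime_commute prime_imp_coprime)
  then obtain d where d: "[det ?R * d = 1] (mod ?M)" using coprime_iff_invertible_int by blast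
  \<comment> \<open>The columns of the inverse modulo \<open>?M\<close>, which is \<open>d\<close>
    times the adjugate. They are reduced below \<open>?M\<close> so that the certificate stays
    short.\<close>
  define U where "U = map (\<lambda>j. map (\<lambda>k. nat (d * adj_mat ?R $$ (k, j) mod ?M)) [0..<n]) [0..<n]"
  have adj: "adj_mat ?R \<in> carrier_mat n n" "?R * adj_mat ?R = det ?R \<cdot>\<^sub>m 1\<^sub>m n"
    by (rule adj_mat, simp)+
  have col: "[columns n U $$ (k, j) = d * adj_mat ?R $$ (k, j)] (mod ?M)" if "k < n" "j < n" for k j
    using that by (simp add: columns_def U_def coord_def)
  have prod: "[(?R * columns n U) $$ (i, j) = (if i = j then 1 else 0)] (mod ?M)" if ij: "i < n" "j < n" for i j
  proof -
    have "(?R * columns n U) $$ (i, j) = (\<Sum>k<n. ?R $$ (i, k) * columns n U $$ (k, j))"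
      using ij by (simp add: int_jacobian_def columns_def scalar_prod_def lessThan_atLeast0)
    also have "[\<dots> = (\<Sum>k<n. ?R $$ (i, k) * (d * adj_mat ?R $$ (k, j)))] (mod ?M)"
      by (intro cong_sum cong_mult cong_refl col) (use ij in auto)
    also have "(\<Sum>k<n. ?R $$ (i, k) * (d * adj_mat ?R $$ (k, j))) = d * (\<Sum>k<n. ?R $$ (i, k) * adj_mat ?R $$ (k, j))"
      by (simp add: sum_distrib_left ac_simps)
    also have "(\<Sum>k<n. ?R $$ (i, k) * adj_mat ?R $$ (k, j)) = (?R * adj_mat ?R) $$ (i, j)"
      using ij adj(1) by (simp add: int_jacobian_def scalar_prod_def lessThan_atLeast0)
    also have "d * (?R * adj_mat ?R) $$ (i, j) = det ?R * d * (if i = j then 1 else 0)"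
      using ij unfolding adj(2) by simp
    also have "[det ?R * d * (if i = j then 1 else 0) = 1 * (if i = j then 1 else 0)] (mod ?M)"
      by (rule cong_scalar_right[OF d])
    finally show ?thesis by simp
  qed
  have val: "deriv_poly N ?P (U ! j) (code_poly (G ! i)) = (if i = j then 1 else 0)" if ij: "i < n" "j < n" for i j
  proof -
    have "[int (deriv_poly N ?P (U ! j) (code_poly (G ! i))) = (if i = j then 1 else 0)] (mod ?M)"
      by (rule cong_trans[OF jacobian_times_columns[OF ij G exps] prod[OF ij]])
    moreover have "0 \<le> int (deriv_poly N ?P (U ! j) (code_poly (G ! i)))" "int (deriv_poly N ?P (U ! j) (code_poly (G ! i))) < ?M"
      using deriv_poly_less[of N ?P "U ! j" "code_poly (G ! i)"] by auto
    \<comment> \<open>Both sides lie between 0 and \<open>?M - 1\<close>, so the congruence is the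
      equality that \<open>triangular\<close> demands.\<close>
    ultimately have "int (deriv_poly N ?P (U ! j) (code_poly (G ! i))) = (if i = j then 1 else 0)"
      by (simp add: cong_def split: if_splits)
    then show ?thesis by (simp split: if_splits)
  qed
  have len: "length U = n" by (simp add: U_def)
  have "triangular N ?P (map code_poly G) U"
    unfolding triangular_def all_pairs_iff
  proof (intro conjI allI impI)
    fix i assume "i < length (map code_poly G)"
    then have i: "i < n" using G by simp
    then show "deriv_poly N ?P (U ! i) (map code_poly G ! i) = 1" using val[OF i i] G by simp
    show "list_all (\<lambda>v. deriv_poly N ?P v (map code_poly G ! i) = 0) (drop (Suc i) U)"
      unfolding list_all_length
    proof (intro allI impI)
      fix m assume "m < length (drop (Suc i) U)"
      then have m: "Suc i + m < n" "drop (Suc i) U ! m = U ! (Suc i + m)" using len by auto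
      show "deriv_poly N ?P (drop (Suc i) U ! m) (map code_poly G ! i) = 0"
        using val[OF i m(1)] i G m(2) by simp
    qed
  qed (use len G in auto)
  moreover have "\<forall>v\<in>set U. length v = n \<and> (\<forall>x\<in>set v. x < N + 2)"
  proof (intro ballI conjI)
    fix v assume "v \<in> set U"
    then obtain j where v: "v = map (\<lambda>k. nat (d * adj_mat ?R $$ (k, j) mod ?M)) [0..<n]" by (auto simp: U_def)
    then show "length v = n" by simp
    fix x assume "x \<in> set v"
    then obtain y where x: "x = nat (y mod ?M)" using v by auto
    have "y mod ?M < ?M" by simp
    then show "x < N + 2" unfolding x by linarith
  qed
  ultimately show ?thesis using len by blast
qed

section \<open>Instances\<close>

type_synonym lss_code = "nat \<times> (rat_code \<times> nat list) list list \<times> rat_code list list"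

definition lss_code :: "lss_instance \<Rightarrow> lss_code" where
  "lss_code I = (num_vars I, map code_poly (system I), map (map rat_code) (points I))"

lemma enc_list_map: "enc_list e (map f xs) = enc_list (\<lambda>x. e (f x)) xs"
  by (induction xs) auto

lemma encode_Pair: "encode (x, y) = encode x @ encode y"
  by (simp add: encode_prod_def)

lemma encode_rat_code: "encode (rat_code r) = enc_rat r"
  by (simp add: rat_code_def enc_rat_def enc_int_def encode_prod_def encode_bool_def encode_nat_def split: prod.split)

text \<open>The generic code of nested pairs and lists is literally the encoding of instances, so
  the input word can be processed as a codable value.\<close>

lemma enc_lss_eq: "enc_lss I = encode (lss_code I)"
proof -
  have "encode (case t of (c, e) \<Rightarrow> (rat_code c, e)) = (case t of (c, e) \<Rightarrow> enc_rat c @ enc_list enc_nat e)" for t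
    by (cases t) (simp add: encode_Pair encode_rat_code encode_list_def encode_nat_def[abs_def])
  then have "encode (code_poly f) = enc_sparse_poly f" for f
    by (simp add: code_poly_def enc_sparse_poly_def encode_list_def enc_list_map)
  then show ?thesis
    by (simp add: lss_code_def enc_lss_def encode_Pair encode_list_def enc_list_map encode_rat_code encode_nat_def)
qed

section \<open>Soundness of the check\<close>

lemma select_map: "select w (map f xs) = map f (select w xs)"
  by (induction w xs rule: select.induct) auto

text \<open>The guessed mask may be longer than the system; surplus indices select nothing.\<close>

lemma nths_restrict: "nths xs A = nths xs {i \<in> A. i < length xs}"
  unfolding nths_def by (rule arg_cong[of _ _ "map fst"], rule filter_cong) (auto simp: set_zip)

lemma promise_points:
  assumes "lss_promise I"
  shows "p \<in> set (points I) \<Longrightarrow> map of_rat p \<in> zero_set (num_vars I) (system I)"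
    and "p \<in> set (points I) \<Longrightarrow> length p = num_vars I"
    and "points I \<noteq> []"
proof -
  have z: "zero_set (num_vars I) (system I) = map of_rat ` set (points I)" "zero_set (num_vars I) (system I) \<noteq> {}"
    using assms unfolding lss_promise_def by auto
  show 1: "map of_rat p \<in> zero_set (num_vars I) (system I)" if "p \<in> set (points I)" for p
    unfolding z(1) using that by (rule imageI)
  show "length p = num_vars I" if "p \<in> set (points I)"
    using 1[OF that] by (simp add: zero_set_def)
  show "points I \<noteq> []" using z by auto
qed

lemma check_sound:
  assumes promise: "lss_promise I"
    and chk: "check N w Us (num_vars I) (map code_poly (system I)) (map (map rat_code) (points I))"
  shows "lss_yes I"
proof -
  let ?n = "num_vars I" and ?F = "system I"
  define A where "A = {i \<in> {i. i < length w \<and> w ! i}. i < length ?F}"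
  define G where "G = nths ?F A"
  have sel: "select w ?F = G"
    unfolding G_def A_def select_eq_nths by (rule nths_restrict)
  have exps: "length (snd t) = ?n" if "f \<in> set ?F" "t \<in> set f" for f t
    using promise that unfolding lss_promise_def by fastforce
  have GF: "set G \<subseteq> set ?F" unfolding G_def by (rule set_nths_subset)
  have len: "length G = ?n"
    and units: "\<And>f t. f \<in> set G \<Longrightarrow> t \<in> set (code_poly f) \<Longrightarrow> unit_denominator N (fst t)"
    and pts: "all_pairs (\<lambda>p U _. list_all (\<lambda>c. unit_denominator N c) p \<and>
       triangular N (map (\<lambda>c. residue N c) p) (map code_poly G) U) (map (map rat_code) (points I)) Us"
    using chk unfolding check_def select_map sel by (auto simp: list_all_iff)
  have coeffs: "unit_denominator N (rat_code (fst t))" if "f \<in> set G" "t \<in> set f" for f t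
  proof -
    have "(rat_code (fst t), snd t) \<in> set (code_poly f)" using that(2) by (force simp: code_poly_def)
    from units[OF that(1) this] show ?thesis by simp
  qed
  have sub: "A \<subseteq> {..<length ?F}" by (auto simp: A_def)
  have "card A = length G"
    unfolding G_def length_nths by (rule arg_cong[of _ _ card]) (use sub in auto)
  then have "selection ?n ?F A" using sub len by (simp add: selection_def)
  moreover have "strongly_valid ?n ?F A"
    unfolding strongly_valid_def
  proof
    fix z assume "z \<in> zero_set ?n ?F"
    \<comment> \<open>Here the promise is decisive: every complex zero is one of the listed rational
      points, and each of these has been tested.\<close>
    then have "z \<in> map of_rat ` set (points I)" using promise unfolding lss_promise_def by simp
    then obtain p where p: "p \<in> set (points I)" "z = map of_rat p" by blast
    then obtain i where i: "i < length (points I)" "p = points I ! i" by (metis in_set_conv_nth)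
    have "list_all (\<lambda>c. unit_denominator N c) (map rat_code p)"
      "triangular N (map (\<lambda>c. residue N (rat_code c)) p) (map code_poly G) (Us ! i)"
      using pts i unfolding all_pairs_iff by (auto simp: o_def)
    then show "det (jacobian ?n (nths ?F A) z) \<noteq> 0"
      unfolding p(2) G_def[symmetric]
      by (intro triangular_sound[OF len promise_points(2)[OF promise p(1)]])
        (use exps coeffs GF in \<open>auto simp: list_all_iff\<close>)
  qed
  ultimately show ?thesis unfolding lss_yes_def by blast
qed

section \<open>Completeness of the check\<close>

lemma length_concat_le: "length (concat xss) \<le> code_size (xss :: 'a::codable list list)"
proof (induction xss)
  case (Cons xs xss)
  then show ?case using length_le_code_size[of xs] by simp
qed simp

lemma height_le_rat_code:
  assumes "code_size (rat_code c) \<le> L"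
  shows "height_le c L"
proof -
  obtain a b where ab: "quotient_of c = (a, b)" by (cases "quotient_of c")
  then have b: "b > 0" "c = of_int a / of_int b" using quotient_of_denom_pos quotient_of_div by blast+
  have "code_size (nat \<bar>a\<bar>) \<le> L" "code_size (nat \<bar>b\<bar>) \<le> L"
    using assms by (auto simp: rat_code_def ab)
  then have "nat \<bar>a\<bar> < 2 ^ L" "nat \<bar>b\<bar> < 2 ^ L"
    using less_power_code_size by (meson less_le_trans one_le_numeral power_increasing)+
  then have "\<bar>a\<bar> < 2 ^ L" "b < 2 ^ L" using b(1) by (auto simp: nat_less_iff)
  then show ?thesis unfolding height_le_def using b by (intro exI[of _ a] exI[of _ b]) auto
qed

text \<open>A number of code size at most \<open>L\<close> is below \<open>2 ^ L\<close>. So the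
  single parameter \<open>L\<close> bounds the heights of coefficients and coordinates, the
  exponents and the number of terms.\<close>

lemma height_le_rat_deriv:
  assumes len: "length p = n" and n: "n \<le> L" and k: "k < n"
    and exps: "\<And>t. t \<in> set f \<Longrightarrow> length (snd t) = n"
    and f: "code_size (code_poly f) \<le> L" and p: "code_size (map rat_code p) \<le> L"
  shows "height_le (rat_deriv f k p) (2 ^ (4 * L + 3))"
proof -
  have L: "L \<le> 2 ^ L" by (rule less_imp_le[OF less_exp])
  have "height_le (fst t * of_nat (snd t ! k) * (\<Prod>j<length (snd t). p ! j ^ ((snd t)[k := snd t ! k - 1] ! j))) (2 ^ (3 * L + 2))"
    if t: "t \<in> set f" for t
  proof -
    obtain c e where ce: "t = (c, e)" by (cases t)
    have "(rat_code c, e) \<in> set (code_poly f)" using t by (force simp: code_poly_def ce)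
    from code_size_member[OF this] f have "code_size (rat_code c) \<le> L" "code_size e \<le> L" by simp_all
    have le: "length e = n" using exps[OF t] ce by simp
    have ej: "e ! j \<le> 2 ^ L" if "j < n" for j
    proof -
      have "code_size (e ! j) \<le> code_size e" using that le by (intro code_size_member) auto
      then have "(2 :: nat) ^ code_size (e ! j) \<le> 2 ^ L" using \<open>code_size e \<le> L\<close> by (intro power_increasing) auto
      with less_power_code_size[of "e ! j"] show ?thesis by linarith
    qed
    have "height_le (\<Prod>j<n. p ! j ^ (e[k := e ! k - 1] ! j)) (2 ^ (3 * L))"
    proof (rule height_le_monomial)
      fix j assume j: "j < n"
      then have "rat_code (p ! j) \<in> set (map rat_code p)" using len by auto
      from code_size_member[OF this] p show "height_le (p ! j) L" by (intro height_le_rat_code) simp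
      show "e[k := e ! k - 1] ! j \<le> 2 ^ L" using ej[OF j] le j by (cases "j = k") auto
    qed (use n L in linarith)
    from height_le_term[OF height_le_rat_code[OF \<open>code_size (rat_code c) \<le> L\<close>] ej[OF k] this]
    show ?thesis by (simp add: ce le)
  qed
  moreover have "length f \<le> 2 ^ L"
  proof -
    have "length f = length (code_poly f)" by (simp add: code_poly_def)
    then show ?thesis using length_le_code_size[of "code_poly f"] f L by linarith
  qed
  ultimately have "height_le (\<Sum>i<length f. fst (f ! i) * of_nat (snd (f ! i) ! k) *
      (\<Prod>j<length (snd (f ! i)). p ! j ^ ((snd (f ! i))[k := snd (f ! i) ! k - 1] ! j))) (2 ^ (4 * L + 3))"
    by (intro height_le_entry) auto
  then show ?thesis unfolding rat_deriv_def by (simp add: sum_list_sum_nth atLeast0LessThan)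
qed

lemma code_size_list_bound:
  assumes "length ys \<le> L" "\<forall>y\<in>set ys. code_size (y :: 'a::codable) \<le> c"
  shows "code_size ys \<le> 1 + L * (1 + c)"
proof -
  have "code_size ys \<le> 1 + length ys * (1 + c)" by (rule code_size_list_le) (use assms(2) in blast)
  also have "\<dots> \<le> 1 + L * (1 + c)" using assms(1) by (intro add_left_mono mult_le_mono1)
  finally show ?thesis .
qed

text \<open>\<open>exists_prime_not_dvd_list\<close> with the exponent
  \<open>L * L + 5 * L + 4\<close> from \<open>height_le_det\<close> for \<open>g\<close>, and
  \<open>L + 2\<close> for \<open>c\<close>, because at most \<open>3 * L <= 4 * 2 ^ L\<close>
  numbers have to be avoided.\<close>

definition prime_bits :: "nat \<Rightarrow> nat" where
  "prime_bits L = 2 * ((L * L + 5 * L + 4) + (L + 2)) + 10"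

text \<open>The parts bound the codes of \<open>N\<close>, of the mask and of the nested lists of
  vectors: at most \<open>L\<close> points, vectors per point and coordinates per vector, with
  numbers below \<open>2 ^ prime_bits L\<close>.\<close>

definition certificate_bound :: "nat \<Rightarrow> nat" where
  "certificate_bound L = (2 * prime_bits L + 1) + ((1 + L * (1 + 1)) +
     (1 + L * (1 + (1 + L * (1 + (1 + L * (1 + (2 * prime_bits L + 1))))))))"

lemma check_complete:
  assumes promise: "lss_promise I" and yes: "lss_yes I"
  shows "\<exists>N w Us. check N w Us (num_vars I) (map code_poly (system I)) (map (map rat_code) (points I)) \<and>
    code_size (N, (w, Us)) \<le> certificate_bound (code_size (lss_code I))"
proof -
  let ?n = "num_vars I" and ?F = "system I" and ?pts = "points I"
  define L where "L = code_size (lss_code I)"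
  obtain A where A: "A \<subseteq> {..<length ?F}" "card A = ?n" and valid: "strongly_valid ?n ?F A"
    using yes unfolding lss_yes_def selection_def by blast
  define G where "G = nths ?F A"
  define w where "w = map (\<lambda>i. i \<in> A) [0..<length ?F]"
  have "{i. i < length w \<and> w ! i} = A" using A(1) by (auto simp: w_def)
  then have sel: "select w ?F = G" by (simp add: select_eq_nths G_def)
  have "{i. i < length ?F \<and> i \<in> A} = A" using A(1) by auto
  then have G: "length G = ?n" using A(2) by (simp add: G_def length_nths)
  have GF: "set G \<subseteq> set ?F" unfolding G_def by (rule set_nths_subset)
  have expsF: "length (snd t) = ?n" if "f \<in> set ?F" "t \<in> set f" for f t
    using promise that unfolding lss_promise_def by fastforce
  have exps: "length (snd t) = ?n" if "f \<in> set G" "t \<in> set f" for f t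
    using expsF that GF by blast
  note pts = promise_points[OF promise]
  have sizes: "code_size (map code_poly ?F) \<le> L" "code_size (map (map rat_code) ?pts) \<le> L"
    by (simp_all add: L_def lss_code_def)
  have psize: "code_size (map rat_code p) \<le> L" if "p \<in> set ?pts" for p
  proof -
    have "map rat_code p \<in> set (map (map rat_code) ?pts)" using that by simp
    from code_size_member[OF this] sizes(2) show ?thesis by linarith
  qed
  have fsize: "code_size (code_poly f) \<le> L" if "f \<in> set ?F" for f
  proof -
    have "code_poly f \<in> set (map code_poly ?F)" using that by simp
    from code_size_member[OF this] sizes(1) show ?thesis by linarith
  qed
  \<comment> \<open>The number of variables is written in binary, so its own code does not bound it
    by \<open>L\<close>. The length of a listed point does, and the nonempty solution set provides
    one.\<close>
  have n: "?n \<le> L"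
  proof -
    obtain p where p: "p \<in> set ?pts" using pts(3) by (meson list.set_sel(1))
    then have "?n = length (map rat_code p)" using pts(2)[OF p] by simp
    also have "\<dots> \<le> code_size (map rat_code p)" by (rule length_le_code_size)
    finally show ?thesis using psize[OF p] by linarith
  qed
  let ?g = "L * L + 5 * L + 4"
  \<comment> \<open>The denominator \<open>b\<close> may be divisible by the chosen prime, since the
    fraction need not be reduced; only the numerator has to avoid it.\<close>
  have "\<exists>a b :: int. det (rat_jacobian ?n G p) * of_int b = of_int a \<and> a \<noteq> 0 \<and> \<bar>a\<bar> \<le> 2 ^ (2 ^ ?g)"
    if p: "p \<in> set ?pts" for p
  proof -
    have "det (jacobian ?n G (map of_rat p)) \<noteq> 0"
      using valid pts(1)[OF p] unfolding strongly_valid_def G_def by blast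
    then have nz: "det (rat_jacobian ?n G p) \<noteq> 0" by (simp add: det_jacobian[OF G pts(2)[OF p] exps])
    have "height_le (det (rat_jacobian ?n G p)) (2 ^ ?g)"
    proof (rule height_le_det[OF _ n])
      fix i j assume ij: "i < ?n" "j < ?n"
      then have Gi: "G ! i \<in> set G" using G by simp
      have "height_le (rat_deriv (G ! i) j p) (2 ^ (4 * L + 3))"
        by (rule height_le_rat_deriv[OF pts(2)[OF p] n ij(2)]) (use exps[OF Gi] fsize GF Gi psize[OF p] in auto)
      then show "height_le (rat_jacobian ?n G p $$ (i, j)) (2 ^ (4 * L + 3))"
        using ij by (simp add: rat_jacobian_def)
    qed simp
    then obtain a b :: int where ab: "0 < b" "det (rat_jacobian ?n G p) * of_int b = of_int a" "\<bar>a\<bar> \<le> 2 ^ (2 ^ ?g)"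
      unfolding height_le_def by blast
    have "a \<noteq> 0"
    proof
      assume "a = 0"
      with ab(1,2) nz show False by simp
    qed
    with ab show ?thesis by blast
  qed
  then obtain a b :: "rat list \<Rightarrow> int" where ab: "\<And>p. p \<in> set ?pts \<Longrightarrow>
      det (rat_jacobian ?n G p) * of_int (b p) = of_int (a p) \<and> a p \<noteq> 0 \<and> \<bar>a p\<bar> \<le> 2 ^ (2 ^ ?g)"
    by metis
  define cs where "cs = map fst (concat ?F) @ concat ?pts"
  define xs where "xs = map (\<lambda>p. nat \<bar>a p\<bar>) ?pts @ map (\<lambda>c. snd (snd (rat_code c))) cs"
  have csize: "code_size (rat_code c) \<le> L" if c: "c \<in> set cs" for c
  proof -
    consider f t where "f \<in> set ?F" "t \<in> set f" "c = fst t" | p where "p \<in> set ?pts" "c \<in> set p"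
      using c by (auto simp: cs_def)
    then show ?thesis
    proof cases
      case 1
      then have "(rat_code c, snd t) \<in> set (code_poly f)" by (force simp: code_poly_def)
      from code_size_member[OF this] fsize[OF 1(1)] show ?thesis by simp
    next
      case 2
      then have "rat_code c \<in> set (map rat_code p)" by simp
      from code_size_member[OF this] psize[OF 2(1)] show ?thesis by linarith
    qed
  qed
  have xs_bound: "0 < x \<and> x \<le> 2 ^ (2 ^ ?g)" if x: "x \<in> set xs" for x
  proof -
    consider p where "p \<in> set ?pts" "x = nat \<bar>a p\<bar>" | c where "c \<in> set cs" "x = snd (snd (rat_code c))"
      using x by (auto simp: xs_def)
    then show ?thesis
    proof cases
      case 1
      then show ?thesis using ab[OF 1(1)] by (simp add: nat_le_iff)
    next
      case 2
      obtain u v where uv: "quotient_of c = (u, v)" by (cases "quotient_of c")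
      then have "v > 0" using quotient_of_denom_pos by blast
      then have pos: "0 < x" by (simp add: 2 rat_code_def uv)
      have "code_size x \<le> code_size (rat_code c)" by (simp add: 2 encode_prod_def)
      then have "code_size x \<le> 2 ^ ?g" using csize[OF 2(1)] less_exp[of ?g] by linarith
      then have "(2 :: nat) ^ code_size x \<le> 2 ^ (2 ^ ?g)" by (rule power_increasing) simp
      with less_power_code_size[of x] pos show ?thesis by linarith
    qed
  qed
  have "length xs \<le> 2 ^ (L + 2)"
  proof -
    have "length ?pts \<le> L" using length_le_code_size[of "map (map rat_code) ?pts"] sizes(2) by simp
    moreover have "length (concat (map code_poly ?F)) = length (concat ?F)"
      by (simp add: length_concat comp_def code_poly_def)
    moreover have "length (concat (map (map rat_code) ?pts)) = length (concat ?pts)"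
      by (simp add: length_concat comp_def)
    moreover note length_concat_le[of "map code_poly ?F"] length_concat_le[of "map (map rat_code) ?pts"] sizes
    ultimately have "length xs \<le> L + (L + L)" unfolding xs_def cs_def length_append length_map by linarith
    also have "\<dots> \<le> 4 * 2 ^ L" using less_exp[of L] by linarith
    finally show ?thesis by (simp add: power_add)
  qed
  from exists_prime_not_dvd_list[OF xs_bound this] obtain q where
    q: "prime q" "q < 2 ^ prime_bits L" "\<And>x. x \<in> set xs \<Longrightarrow> \<not> q dvd x"
    unfolding prime_bits_def by blast
  define N where "N = q - 2"
  have qN: "q = N + 2" using prime_ge_2_nat[OF q(1)] by (simp add: N_def)
  then have iq: "int q = int N + 2" by simp
  have unit: "unit_denominator N (rat_code c)" if "c \<in> set cs" for c
    by (rule unit_denominator_prime[OF q(1) qN q(3)]) (use that in \<open>auto simp: xs_def\<close>)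
  have coeffs: "unit_denominator N (rat_code (fst t))" if "f \<in> set G" "t \<in> set f" for f t
    by (rule unit) (use that GF in \<open>force simp: cs_def\<close>)
  have coords: "unit_denominator N (rat_code c)" if "p \<in> set ?pts" "c \<in> set p" for p c
    by (rule unit) (use that in \<open>auto simp: cs_def\<close>)
  have "\<exists>U. triangular N (map (\<lambda>c. residue N (rat_code c)) p) (map code_poly G) U \<and>
     length U = ?n \<and> (\<forall>v\<in>set U. length v = ?n \<and> (\<forall>x\<in>set v. x < N + 2))" if p: "p \<in> set ?pts" for p
  proof (rule triangular_complete[OF G pts(2)[OF p] exps coeffs coords[OF p]])
    show "prime (int N + 2)" using q(1) iq by (metis prime_int_nat_transfer prime_nat_int_transfer)
    show "det (rat_jacobian ?n G p) * of_int (b p) = of_int (a p)" using ab[OF p] by blast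
    have "\<not> q dvd nat \<bar>a p\<bar>" using p by (intro q(3)) (auto simp: xs_def)
    then show "\<not> int N + 2 dvd a p" unfolding iq[symmetric] by (simp only: dvd_nat_abs_iff not_False_eq_True)
  qed
  then obtain U where U: "\<And>p. p \<in> set ?pts \<Longrightarrow> triangular N (map (\<lambda>c. residue N (rat_code c)) p) (map code_poly G) (U p) \<and>
     length (U p) = ?n \<and> (\<forall>v\<in>set (U p). length v = ?n \<and> (\<forall>x\<in>set v. x < N + 2))"
    by metis
  have "check N w (map U ?pts) ?n (map code_poly ?F) (map (map rat_code) ?pts)"
    unfolding check_def select_map sel
  proof (intro conjI)
    show "length (map code_poly G) = ?n" using G by simp
    show "list_all (\<lambda>f. list_all (\<lambda>t. unit_denominator N (fst t)) f) (map code_poly G)"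
      using coeffs by (auto simp: list_all_iff code_poly_def)
    show "all_pairs (\<lambda>p U _. list_all (\<lambda>c. unit_denominator N c) p \<and>
       triangular N (map (\<lambda>c. residue N c) p) (map code_poly G) U) (map (map rat_code) ?pts) (map U ?pts)"
      unfolding all_pairs_iff
    proof (intro conjI allI impI)
      fix i assume "i < length (map (map rat_code) ?pts)"
      then have i: "i < length ?pts" "?pts ! i \<in> set ?pts" by simp_all
      show "list_all (\<lambda>c. unit_denominator N c) (map (map rat_code) ?pts ! i)"
        using i coords[OF i(2)] by (auto simp: list_all_iff)
      show "triangular N (map (\<lambda>c. residue N c) (map (map rat_code) ?pts ! i)) (map code_poly G) (map U ?pts ! i)"
        using i U[OF i(2)] by (simp add: comp_def)
    qed simp
  qed
  moreover have "code_size (N, (w, map U ?pts)) \<le> certificate_bound L"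
  proof -
    let ?B = "2 * prime_bits L + 1"
    have num: "code_size x \<le> ?B" if "x < N + 2" for x :: nat
      by (rule code_size_nat_le) (use that q(2) qN in linarith)
    have "code_size N \<le> ?B" by (rule num) simp
    moreover have "code_size w \<le> 1 + L * (1 + 1)"
    proof (rule code_size_list_bound)
      show "length w \<le> L" using length_le_code_size[of "map code_poly ?F"] sizes(1) by (simp add: w_def)
    qed simp
    moreover have "code_size (map U ?pts) \<le> 1 + L * (1 + (1 + L * (1 + (1 + L * (1 + ?B)))))"
    proof (rule code_size_list_bound)
      show "length (map U ?pts) \<le> L" using length_le_code_size[of "map (map rat_code) ?pts"] sizes(2) by simp
      show "\<forall>u\<in>set (map U ?pts). code_size u \<le> 1 + L * (1 + (1 + L * (1 + ?B)))"
      proof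
        fix u assume "u \<in> set (map U ?pts)"
        then obtain p where p: "p \<in> set ?pts" "u = U p" by auto
        show "code_size u \<le> 1 + L * (1 + (1 + L * (1 + ?B)))"
        proof (rule code_size_list_bound)
          show "length u \<le> L" using U[OF p(1)] n p(2) by simp
          show "\<forall>v\<in>set u. code_size v \<le> 1 + L * (1 + ?B)"
          proof
            fix v assume v: "v \<in> set u"
            show "code_size v \<le> 1 + L * (1 + ?B)"
            proof (rule code_size_list_bound)
              have "length v = ?n" using U[OF p(1)] v unfolding p(2) by blast
              then show "length v \<le> L" using n by linarith
              show "\<forall>x\<in>set v. code_size x \<le> ?B" using U[OF p(1)] v num unfolding p(2) by blast
            qed
          qed
        qed
      qed
    qed
    ultimately show ?thesis unfolding certificate_bound_def code_size_prod by (intro add_mono)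
  qed
  ultimately show ?thesis unfolding L_def by blast
qed

lemma certificate_bound_poly: "\<exists>k. \<forall>L. certificate_bound L \<le> (L + 2) ^ k"
proof -
  have "poly_bounded certificate_bound (\<lambda>L. L)"
    unfolding certificate_bound_def[abs_def] prime_bits_def
    by (intro pb_add pb_mult pb_const pb_self)
  then show ?thesis unfolding poly_bounded_def .
qed

theorem proposition5p3:
  shows "promise_NP enc_lss lss_promise lss_yes"
proof -
  obtain k where k: "\<And>L. certificate_bound L \<le> (L + 2) ^ k" using certificate_bound_poly by blast
  let ?chk = "\<lambda>z :: (nat \<times> bool list \<times> nat list list list) \<times> lss_code.
    check (fst (fst z)) (fst (snd (fst z))) (snd (snd (fst z))) (fst (snd z)) (fst (snd (snd z))) (snd (snd (snd z)))"
  show ?thesis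
  proof (rule promise_NP_if_fp[of ?chk enc_lss lss_code lss_promise lss_yes k])
    show "fp ?chk" by (rule fp_check)
    show "enc_lss I = encode (lss_code I)" for I by (rule enc_lss_eq)
    show "lss_yes I" if "lss_promise I" "?chk (g, lss_code I)" for I g
      using check_sound[OF that(1)] that(2) by (simp add: lss_code_def)
    fix I assume "lss_promise I" "lss_yes I"
    from check_complete[OF this] obtain N w Us where
      c: "check N w Us (num_vars I) (map code_poly (system I)) (map (map rat_code) (points I))"
      "code_size (N, (w, Us)) \<le> certificate_bound (code_size (lss_code I))" by blast
    show "\<exists>g. ?chk (g, lss_code I) \<and> code_size g \<le> (code_size (lss_code I) + 2) ^ k"
    proof (intro exI[of _ "(N, (w, Us))"] conjI)
      show "?chk ((N, (w, Us)), lss_code I)" using c(1) by (simp add: lss_code_def)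
      show "code_size (N, (w, Us)) \<le> (code_size (lss_code I) + 2) ^ k" using c(2) k le_trans by blast
    qed
  qed
qed

end
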